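(* Let $\mathbb K$ be a number field of degree $\kappa=[\mathbb K:\mathbb Q]$ with ring of integers $\mathbb Z_{\mathbb K}$. Let $m\in\mathbb Z_{\ge 1}$ and let $\alpha_1,\ldots,\alpha_m\in\mathbb Z_{\mathbb K}\setminus\{0\}$ be pairwise distinct. Let $\lambda_0,\lambda_1,\ldots,\lambda_m\in\mathbb Z_{\mathbb K}$ with $\lambda_j\neq 0$ for at least one $j$. Suppose $V\subseteq V_0$ is a collection of non-Archimedean places of $\mathbb K$ such that $$\limsup_{l\to\infty} c_2^l\,(ml+m)^\kappa\,(ml+m)!\prod_{v\in V}\|(ml)!\,l!\|_v=0,$$ where $c_2=c_2(\overline{\alpha},V)$ is as defined in the context. Then there exists a place $v'\in V$ for which $$\lambda_0+\lambda_1F_{v'}(\alpha_1)+\cdots+\lambda_mF_{v'}(\alpha_m)\neq 0.$$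
   Context: Places and normalisation: $V_\infty$ denotes the set of pairwise non-equivalent Archimedean places of $\mathbb K$ and $V_0$ the set of non-Archimedean places. For a non-Archimedean place $v$ lying over a prime $p$ (written $v\mid p$), $|\cdot|_v$ is the extension of the $p$-adic absolute value to $\mathbb K$ with $|p|_v=1/p$, $\mathbb K_v$ is the completion, $\kappa_v=[\mathbb K_v:\mathbb Q_p]$, and the normalised absolute value is $\|x\|_v=|x|_v^{\kappa_v/\kappa}$. For an Archimedean place $v$ corresponding to an embedding $x\mapsto x^{(i)}$ of $\mathbb K$ into $\mathbb C$, $\kappa_v=[\mathbb K_v:\mathbb R]$ and $\|x\|_v=|x^{(i)}|^{\kappa_v/\kappa}$. For $v\in V_0$ and $\alpha\in\mathbb Z_{\mathbb K}$ the series $\sum_{n=0}^\infty n!\,\alpha^n$ converges in $\mathbb K_v$ and $F_v(\alpha)$ denotes its sum. Products over an infinite set $V\subseteq V_0$ of factors in $[0,1]$ are understood as limits (infima) of finite subproducts. Constants: with $\overline\alpha=(\alpha_1,\ldots,\alpha_m)$, $$c_1=c_1(\overline\alpha)=\prod_{v\in V_\infty}\Big(\big(\max_{1\le j\le m}\{1,\|\alpha_j\|_v\}\big)^m\prod_{i=1}^m\big(\|\alpha_i\|_v+\max_{1\le j\le m}\{1,\|\alpha_j\|_v\}\big)\Big),$$ and for $V\subseteq V_0$, $c_2=c_2(\overline\alpha,V)=c_1\prod_{v\in V}\max_{1\le j\le m}\{\|\alpha_j\|_v\}$. *)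

theory Defs
  imports
    "HOL-Analysis.Analysis"
    "HOL-Computational_Algebra.Computational_Algebra"
    "HOL-Algebra.QuotRing"
    "HOL-Algebra.Embedded_Algebras"
begin

section \<open>Number fields\<close>

definition number_field :: "'k::field_char_0 itself \<Rightarrow> bool" where
  "number_field _ \<longleftrightarrow>
     (\<exists>B. finite_dimensional_vector_space (\<lambda>(q::rat) (x::'k). of_rat q * x) B)"

definition field_degree :: "'k::field_char_0 itself \<Rightarrow> nat" where
  "field_degree _ = vector_space.dim (\<lambda>(q::rat) (x::'k). of_rat q * x) UNIV"

section \<open>Places\<close>

text \<open>
  A place is represented by its absolute value \<open>v :: 'k \<Rightarrow> real\<close>, scaled so as to extend
  one of the standard absolute values of the rationals. Every equivalence class contains exactly
  one absolute value scaled in this way, so distinct functions are inequivalent places.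
\<close>

definition padic_abs :: "nat \<Rightarrow> rat \<Rightarrow> real" where
  "padic_abs p q = (if q = 0 then 0 else
     real p powi (int (multiplicity (int p) (snd (quotient_of q)))
                - int (multiplicity (int p) (fst (quotient_of q)))))"

definition nonarchimedean_abs :: "('k::field \<Rightarrow> real) \<Rightarrow> bool" where
  "nonarchimedean_abs v \<longleftrightarrow>
     (\<forall>x. v x \<ge> 0) \<and> (\<forall>x. v x = 0 \<longleftrightarrow> x = 0) \<and>
     (\<forall>x y. v (x * y) = v x * v y) \<and> (\<forall>x y. v (x + y) \<le> max (v x) (v y))"

definition nonarchimedean_places :: "('k::field_char_0 \<Rightarrow> real) set" where
  "nonarchimedean_places =
     {v. nonarchimedean_abs v \<and> (\<exists>p. prime p \<and> (\<forall>q. v (of_rat q) = padic_abs p q))}"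

definition complex_embedding :: "('k::field \<Rightarrow> complex) \<Rightarrow> bool" where
  "complex_embedding \<sigma> \<longleftrightarrow>
     \<sigma> 1 = 1 \<and> (\<forall>x y. \<sigma> (x + y) = \<sigma> x + \<sigma> y) \<and> (\<forall>x y. \<sigma> (x * y) = \<sigma> x * \<sigma> y)"

text \<open>
  Complex conjugate embeddings induce the same function, so this set has one element for each real
  embedding and one for each conjugate pair of non-real embeddings.
\<close>

definition archimedean_places :: "('k::field_char_0 \<Rightarrow> real) set" where
  "archimedean_places = {(\<lambda>x. cmod (\<sigma> x)) | \<sigma>. complex_embedding \<sigma>}"

section \<open>Completions\<close>

text \<open>The completion is the ring of Cauchy sequences modulo the ideal of null sequences.\<close>

definition cauchy_ring :: "('k::field \<Rightarrow> real) \<Rightarrow> (nat \<Rightarrow> 'k) ring" where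
  "cauchy_ring v =
     \<lparr>carrier = {x. \<forall>e>0. \<exists>N. \<forall>i\<ge>N. \<forall>j\<ge>N. v (x i - x j) < e},
      mult = (\<lambda>x y n. x n * y n), one = (\<lambda>_. 1), zero = (\<lambda>_. 0), add = (\<lambda>x y n. x n + y n)\<rparr>"

definition null_sequences :: "('k::field \<Rightarrow> real) \<Rightarrow> (nat \<Rightarrow> 'k) set" where
  "null_sequences v = {x. (\<lambda>n. v (x n)) \<longlonglongrightarrow> 0}"

definition field_completion :: "('k::field \<Rightarrow> real) \<Rightarrow> (nat \<Rightarrow> 'k) set ring" where
  "field_completion v = cauchy_ring v Quot null_sequences v"

definition to_completion :: "('k::field \<Rightarrow> real) \<Rightarrow> 'k \<Rightarrow> (nat \<Rightarrow> 'k) set" where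
  "to_completion v x = null_sequences v +>\<^bsub>cauchy_ring v\<^esub> (\<lambda>_. x)"

definition completion_abs :: "('k::field \<Rightarrow> real) \<Rightarrow> (nat \<Rightarrow> 'k) set \<Rightarrow> real" where
  "completion_abs v X = (THE r. \<forall>x\<in>X. (\<lambda>n. v (x n)) \<longlonglongrightarrow> r)"

text \<open>
  The completion of the rationals inside the completion of \<open>'k\<close>: a copy of the \<open>p\<close>-adic
  numbers if \<open>v\<close> lies over \<open>p\<close>, and of the reals if \<open>v\<close> is Archimedean.
\<close>

definition completion_of_rationals :: "('k::field_char_0 \<Rightarrow> real) \<Rightarrow> (nat \<Rightarrow> 'k) set set" where
  "completion_of_rationals v =
     {X \<in> carrier (field_completion v). \<exists>q. (\<lambda>n. of_rat (q n)) \<in> X}"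

definition local_degree :: "('k::field_char_0 \<Rightarrow> real) \<Rightarrow> nat" where
  "local_degree v =
     ring.dim (field_completion v) (completion_of_rationals v) (carrier (field_completion v))"

definition normalised_abs :: "('k::field_char_0 \<Rightarrow> real) \<Rightarrow> 'k \<Rightarrow> real" where
  "normalised_abs v x = v x powr (real (local_degree v) / real (field_degree TYPE('k)))"

definition series_value :: "('k::field \<Rightarrow> real) \<Rightarrow> (nat \<Rightarrow> 'k) \<Rightarrow> (nat \<Rightarrow> 'k) set" where
  "series_value v a = (THE s. s \<in> carrier (field_completion v) \<and>
     (\<lambda>N. completion_abs v (to_completion v (\<Sum>n<N. a n) \<ominus>\<^bsub>field_completion v\<^esub> s)) \<longlonglongrightarrow> 0)"

definition euler_series :: "('k::field_char_0 \<Rightarrow> real) \<Rightarrow> 'k \<Rightarrow> (nat \<Rightarrow> 'k) set" where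
  "euler_series v x = series_value v (\<lambda>n. fact n * x ^ n)"

section \<open>Products over places and the constants\<close>

text \<open>Possibly infinite product of factors in the unit interval, as the infimum of the finite subproducts.\<close>

definition inf_prod :: "'a set \<Rightarrow> ('a \<Rightarrow> real) \<Rightarrow> real" where
  "inf_prod V f = (INF F\<in>{F. finite F \<and> F \<subseteq> V}. \<Prod>v\<in>F. f v)"

definition c1 :: "nat \<Rightarrow> (nat \<Rightarrow> 'k::field_char_0) \<Rightarrow> real" where
  "c1 m \<alpha> = (\<Prod>v\<in>archimedean_places.
     (Max (insert 1 ((\<lambda>j. normalised_abs v (\<alpha> j)) ` {1..m}))) ^ m *
     (\<Prod>i=1..m. normalised_abs v (\<alpha> i)
        + Max (insert 1 ((\<lambda>j. normalised_abs v (\<alpha> j)) ` {1..m}))))"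

definition c2 :: "nat \<Rightarrow> (nat \<Rightarrow> 'k::field_char_0) \<Rightarrow> ('k \<Rightarrow> real) set \<Rightarrow> real" where
  "c2 m \<alpha> V = c1 m \<alpha> *
     inf_prod V (\<lambda>v. Max ((\<lambda>j. normalised_abs v (\<alpha> j)) ` {1..m}))"

end

theory Submission
  imports Defs "HOL-Algebra.Algebraic_Closure_Type"
begin

text \<open>
  Put \<open>w\<^sub>i = \<lambda>\<^sub>0 + \<Sum>\<^sub>j \<lambda>\<^sub>j \<Sum>\<^bsub>s<i\<^esub> s! \<alpha>\<^sub>j^s\<close>, so that the linear form vanishes
  at \<open>v\<close> iff \<open>v (w\<^sub>i) \<rightarrow> 0\<close>. For \<open>S = x^\<mu> \<Prod>\<^sub>j (x - \<alpha>\<^sub>j)^l\<close> with coefficients \<open>S\<^sub>i\<close>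
  and degree \<open>N = ml + \<mu>\<close>, the algebraic integer \<open>W = N! \<Sum>\<^sub>i S\<^sub>i w\<^sub>i / i!\<close> is the linear form
  evaluated at simultaneous Pade approximations with denominator given by \<open>S\<close>. Since \<open>S\<close> vanishes
  to order \<open>l\<close> at every \<open>\<alpha>\<^sub>j\<close>, the vanishing of the linear form at \<open>v\<close> makes \<open>v W\<close> at most
  \<open>v ((ml)! l!) max\<^sub>j v (\<alpha>\<^sub>j)^l\<close>. If this happens at all \<open>v \<in> V\<close> and \<open>W \<noteq> 0\<close>, the product
  formula bounds the quantity in the hypothesis away from \<open>0\<close>. That \<open>W \<noteq> 0\<close> for arbitrarily large
  \<open>l\<close> and some \<open>\<mu> < m\<close> follows from a differential relation for the functional
  \<open>x^i \<mapsto> w\<^sub>i / i!\<close>.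

  Only the inequality \<open>1 \<le> \<Prod>\<^sub>v \<parallel>y\<parallel>\<^sub>v\<close> over the Archimedean and finitely many other places is
  needed. Counting the algebraic integers \<open>z + y s\<close>, with \<open>z\<close> in a set of residues modulo \<open>y\<close> and
  \<open>s\<close> in a large box, against the number of small cells that contain them proves it up to a constant,
  and replacing \<open>y\<close> by \<open>y^n\<close> removes the constant.
\<close>

text \<open>Local degrees are dimensions of abstract completions, so the product inequality has to
  meet that definition directly. At every place finitely many field elements form a basis of the
  completion over the closure of the rationals, with a quantitative form of independence. At a
  non-Archimedean place digit expansions in such a basis give at least a constant times v(y)^(-d)
  residues modulo y, where d is the local degree; at an Archimedean place a box of size T has about
  T^d cells. Comparing the counts yields exactly the normalised exponents, without prime ideals,
  measures or a classification of the places over p. Residue counts at several places must be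
  multiplied, which calls for a Chinese remainder argument inside the algebraic integers; hence weak
  approximation and separators. Integrality is expressed through subrings with a bounded
  denominator, since closure under ring operations and bounds at all places follow easily from it.
  One polynomial per l could give W = 0; the shifts \<mu> < m are there because, over all levels l
  from some l0 on, the polynomials x^\<mu> P^l with P = \<Prod>(x - \<alpha> j) span the ideal
  generated by P^l0.\<close>

hide_const (open) up_ring.coeff up_ring.monom Polynomials.degree Polynomials.lead_coeff Coset.order
  Divisibility.prime Divisibility.irreducible module.smult

section \<open>Completions\<close>

text \<open>Only the ordinary triangle inequality is assumed, so that completions and local degrees
  are treated once for Archimedean and non-Archimedean places.\<close>

locale absolute_value =
  fixes v :: "'k::field_char_0 \<Rightarrow> real"
  assumes nonneg [simp]: "v x \<ge> 0"
    and eq_0_iff [simp]: "v x = 0 \<longleftrightarrow> x = 0"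
    and mult: "v (x * y) = v x * v y"
    and triangle: "v (x + y) \<le> v x + v y"
begin

lemma zero [simp]: "v 0 = 0"
  by simp

lemma one [simp]: "v 1 = 1"
proof -
  have "v 1 * v 1 = v 1 * 1" using mult[of 1 1] by simp
  then show ?thesis by (metis eq_0_iff mult_cancel_left one_neq_zero)
qed

lemma minus [simp]: "v (- x) = v x"
proof -
  have "v (-1) * v (-1) = 1" using mult[of "-1" "-1"] by simp
  then have "(v (-1))\<^sup>2 = 1\<^sup>2" by (simp add: power2_eq_square)
  then have "v (-1) = 1" by (rule power2_eq_imp_eq) simp_all
  then show ?thesis using mult[of "-1" x] by simp
qed

lemma minus_commute: "v (x - y) = v (y - x)"
  using minus[of "x - y"] by simp

lemma triangle_diff: "v (x - y) \<le> v x + v y"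
  using triangle[of x "- y"] by simp

lemma power: "v (x ^ n) = v x ^ n"
  by (induction n) (simp_all add: mult)

lemma inverse: "v (inverse x) = inverse (v x)"
proof (cases "x = 0")
  case False
  then have "v x * v (inverse x) = 1" by (simp flip: mult)
  then show ?thesis by (simp add: inverse_unique)
qed simp

lemma divide: "v (x / y) = v x / v y"
  by (simp add: divide_inverse mult inverse)

lemma pos [simp]: "x \<noteq> 0 \<Longrightarrow> v x > 0"
  by (simp add: order_less_le)

lemma sum_le: "v (\<Sum>i\<in>A. f i) \<le> (\<Sum>i\<in>A. v (f i))"
proof (induction A rule: infinite_finite_induct)
  case (insert a A)
  then show ?case using triangle[of "f a" "sum f A"] by simp
qed auto

lemma abs_diff_le: "\<bar>v x - v y\<bar> \<le> v (x - y)"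
  using triangle[of "x - y" y] triangle[of "y - x" x] minus_commute[of x y] by simp

section \<open>Cauchy sequences and null sequences\<close>

definition cau :: "(nat \<Rightarrow> 'k) \<Rightarrow> bool" where
  "cau x \<longleftrightarrow> (\<forall>e>0. \<exists>N. \<forall>i\<ge>N. \<forall>j\<ge>N. v (x i - x j) < e)"

definition null :: "(nat \<Rightarrow> 'k) \<Rightarrow> bool" where
  "null x \<longleftrightarrow> (\<lambda>n. v (x n)) \<longlonglongrightarrow> 0"

definition cls :: "(nat \<Rightarrow> 'k) \<Rightarrow> (nat \<Rightarrow> 'k) set" where
  "cls x = null_sequences v +>\<^bsub>cauchy_ring v\<^esub> x"

abbreviation Kv :: "(nat \<Rightarrow> 'k) set ring" where
  "Kv \<equiv> field_completion v"

abbreviation Qv :: "(nat \<Rightarrow> 'k) set set" where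
  "Qv \<equiv> completion_of_rationals v"

lemma mem_cauchy_ring: "x \<in> carrier (cauchy_ring v) \<longleftrightarrow> cau x"
  by (simp add: cauchy_ring_def cau_def)

lemma mem_null_sequences: "x \<in> null_sequences v \<longleftrightarrow> null x"
  by (simp add: null_sequences_def null_def)

lemma cauchy_ring_simps [simp]:
  "x \<otimes>\<^bsub>cauchy_ring v\<^esub> y = (\<lambda>n. x n * y n)"
  "x \<oplus>\<^bsub>cauchy_ring v\<^esub> y = (\<lambda>n. x n + y n)"
  "\<one>\<^bsub>cauchy_ring v\<^esub> = (\<lambda>_. 1)" "\<zero>\<^bsub>cauchy_ring v\<^esub> = (\<lambda>_. 0)"
  by (simp_all add: cauchy_ring_def)

lemma cauI: "(\<And>e. e > 0 \<Longrightarrow> \<exists>N. \<forall>i\<ge>N. \<forall>j\<ge>N. v (x i - x j) < e) \<Longrightarrow> cau x"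
  by (simp add: cau_def)

lemma cau_const [simp]: "cau (\<lambda>_. c)"
  by (simp add: cau_def)

lemma cau_add: assumes "cau x" "cau y" shows "cau (\<lambda>n. x n + y n)"
proof (rule cauI)
  fix e :: real assume "e > 0"
  then obtain N M where N: "\<forall>i\<ge>N. \<forall>j\<ge>N. v (x i - x j) < e/2"
    and M: "\<forall>i\<ge>M. \<forall>j\<ge>M. v (y i - y j) < e/2"
    using assms unfolding cau_def by (meson half_gt_zero)
  have "v (x i + y i - (x j + y j)) < e" if "i \<ge> max N M" "j \<ge> max N M" for i j
  proof -
    have "v (x i + y i - (x j + y j)) = v ((x i - x j) + (y i - y j))" by (simp add: algebra_simps)
    also have "\<dots> \<le> v (x i - x j) + v (y i - y j)" by (rule triangle)
    also have "\<dots> < e" using N[rule_format, of i j] M[rule_format, of i j] that by simp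
    finally show ?thesis .
  qed
  then show "\<exists>N. \<forall>i\<ge>N. \<forall>j\<ge>N. v (x i + y i - (x j + y j)) < e" by blast
qed

lemma cau_bounded: assumes "cau x" obtains B where "B > 0" "\<And>n. v (x n) \<le> B"
proof -
  from assms obtain N where N: "\<forall>i\<ge>N. \<forall>j\<ge>N. v (x i - x j) < 1"
    unfolding cau_def by (meson zero_less_one)
  define B where "B = Max ((\<lambda>n. v (x n)) ` {..N}) + 1"
  have le: "v (x n) \<le> B - 1" if "n \<le> N" for n
    unfolding B_def using that by (simp add: Max_ge)
  have "v (x n) \<le> B" for n
  proof (cases "n \<le> N")
    case False
    have "v (x n) \<le> v (x n - x N) + v (x N)" using triangle[of "x n - x N" "x N"] by simp
    also have "\<dots> \<le> 1 + (B - 1)" using N[rule_format, of n N] le[of N] False by simp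
    finally show ?thesis by simp
  qed (use le[of n] in auto)
  moreover have "B > 0" using le[of N] nonneg[of "x N"] by linarith
  ultimately show ?thesis using that by blast
qed

lemma cau_mult: assumes "cau x" "cau y" shows "cau (\<lambda>n. x n * y n)"
proof (rule cauI)
  fix e :: real assume e: "e > 0"
  obtain B where B: "B > 0" "\<And>n. v (x n) \<le> B" using cau_bounded[OF assms(1)] by blast
  obtain C where C: "C > 0" "\<And>n. v (y n) \<le> C" using cau_bounded[OF assms(2)] by blast
  have "e / (2*C) > 0" "e / (2*B) > 0" using e B C by auto
  then obtain N M where N: "\<forall>i\<ge>N. \<forall>j\<ge>N. v (x i - x j) < e/(2*C)"
    and M: "\<forall>i\<ge>M. \<forall>j\<ge>M. v (y i - y j) < e/(2*B)"
    using assms unfolding cau_def by meson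
  have "v (x i * y i - (x j * y j)) < e" if "i \<ge> max N M" "j \<ge> max N M" for i j
  proof -
    have "v (x i * y i - (x j * y j)) = v ((x i - x j) * y i + x j * (y i - y j))"
      by (simp add: algebra_simps)
    also have "\<dots> \<le> v (x i - x j) * v (y i) + v (x j) * v (y i - y j)"
      using triangle by (simp flip: mult)
    also have "\<dots> \<le> v (x i - x j) * C + B * v (y i - y j)"
      using B C by (intro add_mono mult_mono) auto
    also have "\<dots> < e/(2*C) * C + B * (e/(2*B))"
      using N[rule_format, of i j] M[rule_format, of i j] that B C
      by (intro add_strict_mono mult_strict_right_mono mult_strict_left_mono) auto
    also have "\<dots> = e" using B C by simp
    finally show ?thesis .
  qed
  then show "\<exists>N. \<forall>i\<ge>N. \<forall>j\<ge>N. v (x i * y i - (x j * y j)) < e" by blast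
qed

lemma null_imp_cau: assumes "null x" shows "cau x"
proof (rule cauI)
  fix e :: real assume "e > 0"
  then obtain N where N: "\<forall>n\<ge>N. v (x n) < e/2"
    using assms unfolding null_def lim_sequentially dist_real_def
    by (metis abs_of_nonneg diff_zero half_gt_zero nonneg)
  have "v (x i - x j) < e" if "i \<ge> N" "j \<ge> N" for i j
    using triangle_diff[of "x i" "x j"] N that by (smt (verit) field_sum_of_halves)
  then show "\<exists>N. \<forall>i\<ge>N. \<forall>j\<ge>N. v (x i - x j) < e" by blast
qed

lemma cau_minus: "cau x \<Longrightarrow> cau (\<lambda>n. - x n)"
  using cau_mult[of "\<lambda>_. -1" x] by simp

lemma cau_diff: "cau x \<Longrightarrow> cau y \<Longrightarrow> cau (\<lambda>n. x n - y n)"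
  using cau_add[of x "\<lambda>n. - y n"] cau_minus by simp

lemma null_0 [simp]: "null (\<lambda>_. 0)" by (simp add: null_def)

lemma null_const [simp]: "null (\<lambda>_. c) \<longleftrightarrow> c = 0"
  by (simp add: null_def LIMSEQ_const_iff)

lemma null_le:
  assumes "null x" "\<And>n. v (y n) \<le> C * v (x n)" shows "null y"
  unfolding null_def
proof (rule tendsto_sandwich[OF _ _ tendsto_const])
  show "(\<lambda>n. C * v (x n)) \<longlonglongrightarrow> 0"
    using assms(1) unfolding null_def by (auto intro: tendsto_eq_intros)
qed (use assms in auto)

lemma null_add: assumes "null x" "null y" shows "null (\<lambda>n. x n + y n)"
  unfolding null_def
proof (rule tendsto_sandwich[OF _ _ tendsto_const])
  show "(\<lambda>n. v (x n) + v (y n)) \<longlonglongrightarrow> 0"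
    using assms unfolding null_def by (auto intro: tendsto_eq_intros)
qed (use triangle in auto)

lemma null_mult: assumes "cau x" "null y" shows "null (\<lambda>n. x n * y n)"
proof -
  obtain B where B: "B > 0" "\<And>n. v (x n) \<le> B" using cau_bounded[OF assms(1)] by blast
  show ?thesis by (rule null_le[OF assms(2), of _ B]) (use B in \<open>auto simp: mult intro!: mult_right_mono\<close>)
qed

lemma null_minus: "null x \<Longrightarrow> null (\<lambda>n. - x n)"
  by (simp add: null_def)

lemma null_diff: "null x \<Longrightarrow> null y \<Longrightarrow> null (\<lambda>n. x n - y n)"
  using null_add[of x "\<lambda>n. - y n"] null_minus by simp

lemma cauchy_cring: "cring (cauchy_ring v)"
proof (rule cringI)
  have "\<exists>y\<in>carrier (cauchy_ring v). y \<oplus>\<^bsub>cauchy_ring v\<^esub> x = \<zero>\<^bsub>cauchy_ring v\<^esub>"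
    if "x \<in> carrier (cauchy_ring v)" for x
    using that by (intro bexI[of _ "\<lambda>n. - x n"]) (auto simp: mem_cauchy_ring cau_minus)
  then show "abelian_group (cauchy_ring v)"
    by (intro abelian_groupI) (simp_all add: mem_cauchy_ring cau_add algebra_simps)
  show "comm_monoid (cauchy_ring v)"
    by (rule comm_monoidI) (simp_all add: mem_cauchy_ring cau_mult algebra_simps)
qed (simp add: algebra_simps)

lemma null_ideal: "ideal (null_sequences v) (cauchy_ring v)"
proof (rule idealI)
  interpret cring "cauchy_ring v" by (rule cauchy_cring)
  show "Ring.ring (cauchy_ring v)" by (rule ring_axioms)
  have inv: "\<ominus>\<^bsub>cauchy_ring v\<^esub> x = (\<lambda>n. - x n)" if "null x" for x
    using minus_equality[of "\<lambda>n. - x n" x] that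
    by (simp add: mem_cauchy_ring cau_minus null_imp_cau)
  have "null_sequences v \<noteq> {}" using null_0 mem_null_sequences by blast
  then show "subgroup (null_sequences v) (add_monoid (cauchy_ring v))"
    by (intro add.subgroupI)
       (auto simp: mem_cauchy_ring mem_null_sequences null_imp_cau null_add null_minus inv simp flip:
           a_inv_def)
  fix a x assume "a \<in> null_sequences v" "x \<in> carrier (cauchy_ring v)"
  then have "null (\<lambda>n. x n * a n)" by (simp add: mem_cauchy_ring mem_null_sequences null_mult)
  then show "x \<otimes>\<^bsub>cauchy_ring v\<^esub> a \<in> null_sequences v" "a \<otimes>\<^bsub>cauchy_ring v\<^esub> x \<in> null_sequences v"
    by (simp_all add: mem_null_sequences mult.commute)
qed

sublocale R: cring "cauchy_ring v" by (rule cauchy_cring)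
sublocale I: ideal "null_sequences v" "cauchy_ring v" by (rule null_ideal)
sublocale Kv: cring Kv
  unfolding field_completion_def by (rule I.quotient_is_cring[OF cauchy_cring])

section \<open>The completion as a field and the closure of the rationals in it\<close>

lemma cls_eq: "cls x = {y. null (\<lambda>n. y n - x n)}"
proof -
  have "y \<in> cls x \<longleftrightarrow> (\<exists>h. null h \<and> y = (\<lambda>n. h n + x n))" for y
    by (auto simp: cls_def a_r_coset_def' mem_null_sequences)
  moreover have "(\<exists>h. null h \<and> y = (\<lambda>n. h n + x n)) \<longleftrightarrow> null (\<lambda>n. y n - x n)" for y
    by (auto intro!: exI[of _ "\<lambda>n. y n - x n"])
  ultimately show ?thesis by blast
qed

lemma mem_cls: "y \<in> cls x \<longleftrightarrow> null (\<lambda>n. y n - x n)"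
  by (simp add: cls_eq)

lemma cls_eq_iff: "cls x = cls y \<longleftrightarrow> null (\<lambda>n. x n - y n)"
proof
  assume "cls x = cls y"
  then have "x \<in> cls y" by (auto simp: mem_cls simp flip: \<open>cls x = cls y\<close>)
  then show "null (\<lambda>n. x n - y n)" by (simp add: mem_cls)
next
  assume n: "null (\<lambda>n. x n - y n)"
  have "null (\<lambda>n. z n - x n) \<longleftrightarrow> null (\<lambda>n. z n - y n)" for z
    using null_add[OF n, of "\<lambda>n. z n - x n"] null_diff[OF _ n, of "\<lambda>n. z n - y n"]
    by (auto simp: algebra_simps)
  then show "cls x = cls y" by (auto simp: cls_eq)
qed

lemma carrier_Kv: "carrier Kv = cls ` {x. cau x}"
  by (auto simp: field_completion_def FactRing_def A_RCOSETS_def' cls_def mem_cauchy_ring)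

lemma cls_in_carrier [simp]: "cau x \<Longrightarrow> cls x \<in> carrier Kv"
  by (simp add: carrier_Kv)

lemma cls_add: "cau x \<Longrightarrow> cau y \<Longrightarrow> cls x \<oplus>\<^bsub>Kv\<^esub> cls y = cls (\<lambda>n. x n + y n)"
  using ring_hom_add[OF I.rcos_ring_hom, of x y]
  by (simp add: field_completion_def cls_def mem_cauchy_ring)

lemma cls_mult: "cau x \<Longrightarrow> cau y \<Longrightarrow> cls x \<otimes>\<^bsub>Kv\<^esub> cls y = cls (\<lambda>n. x n * y n)"
  using ring_hom_mult[OF I.rcos_ring_hom, of x y]
  by (simp add: field_completion_def cls_def mem_cauchy_ring)

lemma cls_one: "\<one>\<^bsub>Kv\<^esub> = cls (\<lambda>_. 1)"
  using ring_hom_one[OF I.rcos_ring_hom]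
  by (simp add: field_completion_def cls_def)

lemma cls_zero: "\<zero>\<^bsub>Kv\<^esub> = cls (\<lambda>_. 0)"
proof -
  have "\<zero>\<^bsub>Kv\<^esub> = null_sequences v" by (simp add: field_completion_def FactRing_def)
  also have "\<dots> = cls (\<lambda>_. 0)" by (auto simp: cls_eq mem_null_sequences)
  finally show ?thesis .
qed

lemma cls_eq_zero_iff: "cls x = \<zero>\<^bsub>Kv\<^esub> \<longleftrightarrow> null x"
  by (simp add: cls_zero cls_eq_iff)

lemma cls_minus: "cau x \<Longrightarrow> \<ominus>\<^bsub>Kv\<^esub> cls x = cls (\<lambda>n. - x n)"
  by (rule Kv.minus_equality) (auto simp: cau_minus cls_add cls_zero)

lemma to_completion_eq: "to_completion v x = cls (\<lambda>_. x)"
  by (simp add: to_completion_def cls_def)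

text \<open>Infinitely many terms have absolute value at least some e, and from some index on all
  terms lie within e/2 of each other. This makes termwise inversion possible.\<close>

lemma cau_not_null:
  assumes "cau x" "\<not> null x"
  obtains c N where "c > 0" "\<And>n. n \<ge> N \<Longrightarrow> v (x n) \<ge> c"
proof -
  from assms(2) obtain e where e: "e > 0" "\<And>N. \<exists>n\<ge>N. v (x n) \<ge> e"
    unfolding null_def lim_sequentially dist_real_def by (auto simp: not_less)
  obtain N where N: "\<forall>i\<ge>N. \<forall>j\<ge>N. v (x i - x j) < e/2"
    using assms(1) e(1) unfolding cau_def by (meson half_gt_zero)
  obtain m where m: "m \<ge> N" "v (x m) \<ge> e" using e(2) by blast
  have "v (x n) \<ge> e/2" if "n \<ge> N" for n
    using N[rule_format, of m n] m that triangle[of "x m - x n" "x n"] by simp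
  then show ?thesis using that[of "e/2" N] e(1) by auto
qed

lemma cau_inverse:
  assumes "cau x" "\<not> null x"
  shows "cau (\<lambda>n. inverse (x n))" "null (\<lambda>n. x n * inverse (x n) - 1)"
proof -
  obtain c N where c: "c > 0" "\<And>n. n \<ge> N \<Longrightarrow> v (x n) \<ge> c" using cau_not_null[OF assms] by blast
  \<comment> \<open>Terms before N may vanish; \<open>inverse 0 = 0\<close> there, and finitely many
    terms influence neither claim.\<close>
  have nz: "x n \<noteq> 0" if "n \<ge> N" for n using c(1) c(2)[OF that] by auto
  show "cau (\<lambda>n. inverse (x n))"
  proof (rule cauI)
    fix e :: real assume "e > 0"
    then have "e * c\<^sup>2 > 0" using c by simp
    then obtain M where M: "\<forall>i\<ge>M. \<forall>j\<ge>M. v (x i - x j) < e * c\<^sup>2"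
      using assms(1) unfolding cau_def by meson
    have "v (inverse (x i) - inverse (x j)) < e" if "i \<ge> max N M" "j \<ge> max N M" for i j
    proof -
      have nzi: "x i \<noteq> 0" "x j \<noteq> 0" using nz that by auto
      then have "inverse (x i) - inverse (x j) = (x j - x i) / (x i * x j)"
        by (simp add: field_simps)
      then have "v (inverse (x i) - inverse (x j)) = v (x j - x i) / (v (x i) * v (x j))"
        by (simp add: divide mult)
      also have "\<dots> \<le> v (x j - x i) / (c * c)"
        using c that by (intro divide_left_mono mult_mono mult_pos_pos) (auto simp: nzi)
      also have "\<dots> < e"
        using M[rule_format, of j i] that c by (simp add: divide_simps power2_eq_square)
      finally show ?thesis .
    qed
    then show "\<exists>N. \<forall>i\<ge>N. \<forall>j\<ge>N. v (inverse (x i) - inverse (x j)) < e" by blast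
  qed
  show "null (\<lambda>n. x n * inverse (x n) - 1)"
    unfolding null_def
    by (rule tendsto_eventually, rule eventually_sequentiallyI[of N]) (use nz in auto)
qed

lemma Kv_field: "Ring.field Kv"
proof (rule Kv.cring_fieldI2)
  show "\<zero>\<^bsub>Kv\<^esub> \<noteq> \<one>\<^bsub>Kv\<^esub>"
    using cls_eq_zero_iff[of "\<lambda>_. 1"] by (auto simp: cls_one)
  fix a assume "a \<in> carrier Kv" "a \<noteq> \<zero>\<^bsub>Kv\<^esub>"
  then obtain x where x: "a = cls x" "cau x" by (auto simp: carrier_Kv)
  with \<open>a \<noteq> _\<close> have "\<not> null x" by (simp flip: cls_eq_zero_iff)
  with x have x: "a = cls x" "cau x" "\<not> null x" by auto
  then show "\<exists>b\<in>carrier Kv. a \<otimes>\<^bsub>Kv\<^esub> b = \<one>\<^bsub>Kv\<^esub>"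
    by (intro bexI[of _ "cls (\<lambda>n. inverse (x n))"])
       (auto simp: cau_inverse cls_mult cls_one cls_eq_iff)
qed

sublocale Kv: Ring.field Kv by (rule Kv_field)

text \<open>A rational sequence in the class of a Cauchy sequence differs from it by a null
  sequence, so it is itself Cauchy and can represent the class.\<close>

lemma Qv_eq: "Qv = {cls (\<lambda>n. of_rat (q n)) | q. cau (\<lambda>n. of_rat (q n))}"
proof -
  have "Y \<in> Qv \<longleftrightarrow> (\<exists>q. Y = cls (\<lambda>n. of_rat (q n)) \<and> cau (\<lambda>n. of_rat (q n)))" for Y
  proof
    assume "Y \<in> Qv"
    then obtain x q where x: "Y = cls x" "cau x" and q: "(\<lambda>n. of_rat (q n)) \<in> cls x"
      by (auto simp: completion_of_rationals_def carrier_Kv)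
    then have n: "null (\<lambda>n. of_rat (q n) - x n)" by (simp add: mem_cls)
    then have "cau (\<lambda>n. x n + (of_rat (q n) - x n))" using cau_add x null_imp_cau by blast
    then show "\<exists>q. Y = cls (\<lambda>n. of_rat (q n)) \<and> cau (\<lambda>n. of_rat (q n))"
      using n x cls_eq_iff[of "\<lambda>n. of_rat (q n)" x] by auto
  next
    assume "\<exists>q. Y = cls (\<lambda>n. of_rat (q n)) \<and> cau (\<lambda>n. of_rat (q n))"
    then obtain q where "Y = cls (\<lambda>n. of_rat (q n))" "cau (\<lambda>n. of_rat (q n))" by blast
    moreover from this have "(\<lambda>n. of_rat (q n)) \<in> Y" by (simp add: mem_cls)
    ultimately show "Y \<in> Qv" by (auto simp: completion_of_rationals_def)
  qed
  then show ?thesis by blast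
qed

lemma Qv_memI: "cau (\<lambda>n. of_rat (q n)) \<Longrightarrow> cls (\<lambda>n. of_rat (q n)) \<in> Qv"
  by (auto simp: Qv_eq)

lemma Qv_subfield: "subfield Qv Kv"
proof (rule Kv.subfieldI')
  show "subring Qv Kv"
  proof (rule Kv.subringI)
    show "Qv \<subseteq> carrier Kv" by (auto simp: Qv_eq)
    show "\<one>\<^bsub>Kv\<^esub> \<in> Qv" using Qv_memI[of "\<lambda>_. 1"] by (simp add: cls_one)
    fix a assume "a \<in> Qv"
    then obtain q where q: "a = cls (\<lambda>n. of_rat (q n))" "cau (\<lambda>n. of_rat (q n))"
      by (auto simp: Qv_eq)
    show "\<ominus>\<^bsub>Kv\<^esub> a \<in> Qv"
      using Qv_memI[of "\<lambda>n. - q n"] cau_minus[OF q(2)] q by (simp add: cls_minus of_rat_minus)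
    fix b assume "b \<in> Qv"
    then obtain r where r: "b = cls (\<lambda>n. of_rat (r n))" "cau (\<lambda>n. of_rat (r n))"
      by (auto simp: Qv_eq)
    show "a \<otimes>\<^bsub>Kv\<^esub> b \<in> Qv"
      using Qv_memI[of "\<lambda>n. q n * r n"] cau_mult[OF q(2) r(2)] q r by (simp add: cls_mult of_rat_mult)
    show "a \<oplus>\<^bsub>Kv\<^esub> b \<in> Qv"
      using Qv_memI[of "\<lambda>n. q n + r n"] cau_add[OF q(2) r(2)] q r by (simp add: cls_add of_rat_add)
  qed
  fix a assume "a \<in> Qv - {\<zero>\<^bsub>Kv\<^esub>}"
  then obtain q where q: "a = cls (\<lambda>n. of_rat (q n))" "cau (\<lambda>n. of_rat (q n))"
    by (auto simp: Qv_eq)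
  have nn: "\<not> null (\<lambda>n. of_rat (q n))"
    using \<open>a \<in> Qv - _\<close> by (simp add: q(1) flip: cls_eq_zero_iff)
  note q = q nn
  have "inv\<^bsub>Kv\<^esub> a = cls (\<lambda>n. of_rat (inverse (q n)))"
    by (rule Kv.comm_inv_char)
       (use q cau_inverse[OF q(2,3)] in \<open>auto simp: of_rat_inverse cls_mult cls_one cls_eq_iff\<close>)
  then show "inv\<^bsub>Kv\<^esub> a \<in> Qv"
    using Qv_memI[of "\<lambda>n. inverse (q n)"] cau_inverse[OF q(2,3)] by (simp add: of_rat_inverse)
qed

section \<open>Bases of the completion and the local degree\<close>

lemma combine_cls:
  assumes "\<And>b. b \<in> set bs \<Longrightarrow> cau (x b)" "\<And>b. b \<in> set bs \<Longrightarrow> cau (y b)"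
  shows "Kv.combine (map (\<lambda>b. cls (x b)) bs) (map (\<lambda>b. cls (y b)) bs)
       = cls (\<lambda>n. \<Sum>b\<leftarrow>bs. x b n * y b n) \<and> cau (\<lambda>n. \<Sum>b\<leftarrow>bs. x b n * y b n)"
  using assms by (induction bs) (auto simp: cls_zero cls_mult cls_add cau_mult cau_add)

text \<open>Uniform linear independence: the value of a combination controls its coefficients. The
  inequality survives limits, so it expresses independence over the closure of the rationals and not
  only over the rationals.\<close>

definition independent_over_rat :: "'k set \<Rightarrow> bool" where
  "independent_over_rat B \<longleftrightarrow>
     (\<exists>C>0. \<forall>c. \<forall>b\<in>B. v (of_rat (c b)) \<le> C * v (\<Sum>b\<in>B. of_rat (c b) * b))"

text \<open>The limit version of spanning: for a finite independent \<open>B\<close> it makes the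
  completion the span of \<open>B\<close> over the closure of the rationals.\<close>

definition dense_over_rat :: "'k set \<Rightarrow> bool" where
  "dense_over_rat B \<longleftrightarrow>
     (\<forall>x. \<forall>e>0. \<exists>c. v (x - (\<Sum>b\<in>B. of_rat (c b) * b)) < e)"

text \<open>The constant of uniform independence works twice: a combination tending to zero has
  coefficients tending to zero, which is independence in the completion, and a Cauchy sequence of
  combinations has Cauchy coefficients, so that limits of combinations are again
  combinations.\<close>

theorem local_degree_eq_card:
  assumes "finite B" "independent_over_rat B" "dense_over_rat B"
  shows "local_degree v = card B"
proof -
  obtain C where C: "C > 0" "\<And>c b. b \<in> B \<Longrightarrow> v (of_rat (c b)) \<le> C * v (\<Sum>b\<in>B. of_rat (c b) * b)"
    using assms(2) unfolding independent_over_rat_def by blast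
  obtain bs where bs: "set bs = B" "distinct bs"
    using finite_distinct_list[OF assms(1)] by blast
  define Us where "Us = map (\<lambda>b. cls (\<lambda>_. b)) bs"
  have Us: "set Us \<subseteq> carrier Kv" by (auto simp: Us_def)
  have comb: "Kv.combine (map (\<lambda>b. cls (\<lambda>n. of_rat (q b n))) bs) Us
      = cls (\<lambda>n. \<Sum>b\<in>B. of_rat (q b n) * b)"
    if "\<And>b. b \<in> B \<Longrightarrow> cau (\<lambda>n. of_rat (q b n))" for q :: "'k \<Rightarrow> nat \<Rightarrow> rat"
  proof -
    have "(\<Sum>b\<leftarrow>bs. f b) = (\<Sum>b\<in>B. f b)" for f :: "'k \<Rightarrow> 'k"
      using bs sum_list_distinct_conv_sum_set by metis
    then show ?thesis
      using combine_cls[of bs "\<lambda>b n. of_rat (q b n)" "\<lambda>b n. b"] that bs(1) by (simp add: Us_def)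
  qed
  have coeffs: "\<exists>q. (\<forall>b\<in>B. cau (\<lambda>n. of_rat (q b n))) \<and> Ks = map (\<lambda>b. cls (\<lambda>n. of_rat (q b n))) bs"
    if "set Ks \<subseteq> Qv" "length Ks = length bs" for Ks
  proof -
    have "\<forall>k\<in>Qv. \<exists>q. cau (\<lambda>n. of_rat (q n)) \<and> k = cls (\<lambda>n. of_rat (q n))" by (auto simp: Qv_eq)
    then obtain Q where Q: "\<And>k. k \<in> Qv \<Longrightarrow> cau (\<lambda>n. of_rat (Q k n)) \<and> k = cls (\<lambda>n. of_rat (Q k n))"
      by metis
    \<comment> \<open>Coefficient lists become functions on \<open>B\<close> through the position of
      an element in \<open>bs\<close>.\<close>
    define idx where "idx b = (THE i. i < length bs \<and> bs ! i = b)" for b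
    have idx: "idx (bs ! i) = i" if "i < length bs" for i
      unfolding idx_def using that bs(2) by (intro the_equality) (auto simp: nth_eq_iff_index_eq)
    define q where "q b = Q (Ks ! idx b)" for b
    have "Ks ! i \<in> Qv" if "i < length bs" for i using that \<open>length Ks = _\<close> \<open>set Ks \<subseteq> _\<close> by auto
    then have "cau (\<lambda>n. of_rat (q (bs ! i) n)) \<and> Ks ! i = cls (\<lambda>n. of_rat (q (bs ! i) n))"
      if "i < length bs" for i
      using Q[of "Ks ! i"] that by (auto simp: q_def idx)
    then have "(\<forall>b\<in>B. cau (\<lambda>n. of_rat (q b n))) \<and> Ks = map (\<lambda>b. cls (\<lambda>n. of_rat (q b n))) bs"
      using bs(1) that(2) by (auto simp: in_set_conv_nth intro!: nth_equalityI)
    then show ?thesis by blast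
  qed
  have "Kv.independent Qv Us"
  proof (rule Kv.trivial_combine_imp_independent[OF Qv_subfield Us])
    fix Ks assume Ks: "set Ks \<subseteq> Qv" "Kv.combine Ks Us = \<zero>\<^bsub>Kv\<^esub>"
    define n where "n = length Us - length Ks"
    \<comment> \<open>The list \<open>Ks\<close> may be shorter or longer than \<open>Us\<close>;
      \<open>combine\<close> ignores the surplus, so \<open>Ks\<close> is cut or padded with zeros
      to the exact length.\<close>
    define Ks' where "Ks' = take (length Us) Ks @ replicate (length Us - length Ks) \<zero>\<^bsub>Kv\<^esub>"
    have z: "\<zero>\<^bsub>Kv\<^esub> \<in> Qv" using subringE(2)[OF subfieldE(1)[OF Qv_subfield]] .
    have "set Ks' \<subseteq> Qv" "length Ks' = length bs"
      using Ks z by (auto simp: Ks'_def Us_def dest: in_set_takeD)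
    then obtain q where q: "\<forall>b\<in>B. cau (\<lambda>n. of_rat (q b n))" "Ks' = map (\<lambda>b. cls (\<lambda>n. of_rat (q b n))) bs"
      using coeffs by blast
    have "Kv.combine Ks' Us = Kv.combine (take (length Us) Ks) Us"
      unfolding Ks'_def by (rule Kv.combine_append_replicate[OF Us])
    also have "\<dots> = \<zero>\<^bsub>Kv\<^esub>" using Ks by (simp add: Kv.combine_take)
    finally have n: "null (\<lambda>n. \<Sum>b\<in>B. of_rat (q b n) * b)"
      using comb[of q] q by (simp add: cls_eq_zero_iff)
    have "null (\<lambda>n. of_rat (q b n))" if "b \<in> B" for b
      by (rule null_le[OF n, of _ C]) (use C(2)[OF that, of "\<lambda>b. q b _"] in simp)
    then have "set Ks' \<subseteq> {\<zero>\<^bsub>Kv\<^esub>}"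
      using q bs(1) cls_eq_zero_iff by auto
    then show "set (take (length Us) Ks) \<subseteq> {\<zero>\<^bsub>Kv\<^esub>}" by (simp add: Ks'_def)
  qed
  moreover have "Kv.Span Qv Us = carrier Kv"
  proof
    show "Kv.Span Qv Us \<subseteq> carrier Kv"
      using Kv.Span_in_carrier[OF subfieldE(3)[OF Qv_subfield] Us] .
    show "carrier Kv \<subseteq> Kv.Span Qv Us"
    proof
      fix a assume "a \<in> carrier Kv"
      then obtain x where x: "a = cls x" "cau x" by (auto simp: carrier_Kv)
      have "\<forall>n. \<exists>c. v (x n - (\<Sum>b\<in>B. of_rat (c b) * b)) < inverse (real (Suc n))"
        using assms(3) unfolding dense_over_rat_def by simp
      then obtain c where c: "\<And>n. v (x n - (\<Sum>b\<in>B. of_rat (c n b) * b)) < inverse (real (Suc n))"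
        by metis
      have n: "null (\<lambda>n. x n - (\<Sum>b\<in>B. of_rat (c n b) * b))"
        unfolding null_def
        by (rule tendsto_sandwich[OF _ _ tendsto_const LIMSEQ_inverse_real_of_nat])
           (use c in \<open>auto intro!: always_eventually less_imp_le\<close>)
      have s: "cau (\<lambda>n. \<Sum>b\<in>B. of_rat (c n b) * b)"
        using cau_diff[OF x(2) null_imp_cau[OF n]] by simp
      have cb: "cau (\<lambda>n. of_rat (c n b))" if b: "b \<in> B" for b
      proof (rule cauI)
        fix e :: real assume "e > 0"
        then have "e / C > 0" using C by simp
        then obtain N where N: "\<forall>i\<ge>N. \<forall>j\<ge>N.
            v ((\<Sum>b\<in>B. of_rat (c i b) * b) - (\<Sum>b\<in>B. of_rat (c j b) * b)) < e / C"
          using s unfolding cau_def by meson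
        have "v (of_rat (c i b) - of_rat (c j b)) < e" if "i \<ge> N" "j \<ge> N" for i j
        proof -
          have "v (of_rat (c i b) - of_rat (c j b)) = v (of_rat (c i b - c j b))"
            by (simp add: of_rat_diff)
          also have "\<dots> \<le> C * v (\<Sum>b\<in>B. of_rat (c i b - c j b) * b)"
            using C(2)[OF b, of "\<lambda>b. c i b - c j b"] .
          also have "(\<Sum>b\<in>B. of_rat (c i b - c j b) * b)
              = (\<Sum>b\<in>B. of_rat (c i b) * b) - (\<Sum>b\<in>B. of_rat (c j b) * b)"
            by (simp add: of_rat_diff algebra_simps sum_subtractf)
          also have "C * v \<dots> < e"
            using N[rule_format, OF that] C(1) by (simp add: field_simps)
          finally show ?thesis .
        qed
        then show "\<exists>N. \<forall>i\<ge>N. \<forall>j\<ge>N. v (of_rat (c i b) - of_rat (c j b)) < e" by blast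
      qed
      have "a = Kv.combine (map (\<lambda>b. cls (\<lambda>n. of_rat (c n b))) bs) Us"
        using comb[of "\<lambda>b n. c n b"] cb n by (simp add: x(1) cls_eq_iff)
      moreover have "set (map (\<lambda>b. cls (\<lambda>n. of_rat (c n b))) bs) \<subseteq> Qv"
        using cb bs by (auto intro!: Qv_memI)
      ultimately show "a \<in> Kv.Span Qv Us"
        unfolding Kv.Span_eq_combine_set[OF Qv_subfield Us] by blast
    qed
  qed
  ultimately have "Kv.dimension (length Us) Qv (carrier Kv)"
    by (rule Kv.dimensionI[OF Qv_subfield])
  then have "Kv.dim Qv (carrier Kv) = length Us"
    using Kv.dimI[OF Qv_subfield] by (simp add: over_def)
  moreover have "length Us = card B" using bs distinct_card by (force simp: Us_def)
  ultimately show ?thesis by (simp add: local_degree_def)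
qed

text \<open>An independent subset B of maximal size is dense: if the combinations of B stayed at a
  positive distance from some w in W, that distance would bound the coefficient of w in any
  combination, and adding w to B would keep independence.\<close>

lemma exists_independent_dense:
  assumes "finite W" and span: "\<And>x. \<exists>c. x = (\<Sum>w\<in>W. of_rat (c w) * w)"
  obtains B where "B \<subseteq> W" "independent_over_rat B" "dense_over_rat B"
proof -
  have "independent_over_rat {}" unfolding independent_over_rat_def by (auto intro: exI[of _ 1])
  then obtain B where B: "B \<subseteq> W" "independent_over_rat B"
    and max: "\<And>B'. B' \<subseteq> W \<Longrightarrow> independent_over_rat B' \<Longrightarrow> card B' \<le> card B"
  proof -
    have "\<exists>B. (B \<subseteq> W \<and> independent_over_rat B) \<and> (\<forall>B'. B' \<subseteq> W \<and> independent_over_rat B' \<longrightarrow> card B' \<le> card B)"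
      by (rule ex_has_greatest_nat[of _ "{}" _ "Suc (card W)"])
         (use \<open>independent_over_rat {}\<close> assms(1) in \<open>auto simp: less_Suc_eq_le intro!: card_mono\<close>)
    then show ?thesis using that by blast
  qed
  have fB: "finite B" using B(1) assms(1) by (rule finite_subset)
  obtain C where C: "C > 0" "\<And>c b. b \<in> B \<Longrightarrow> v (of_rat (c b)) \<le> C * v (\<Sum>b\<in>B. of_rat (c b) * b)"
    using B(2) unfolding independent_over_rat_def by blast
  have approx: "\<exists>c. v (w - (\<Sum>b\<in>B. of_rat (c b) * b)) < e" if "w \<in> W" "e > 0" for w e
  proof (cases "w \<in> B")
    case True
    have "(\<Sum>b\<in>B. of_rat (if b = w then 1 else 0) * b) = (\<Sum>b\<in>B. if b = w then b else 0)"
      by (intro sum.cong) auto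
    also have "\<dots> = w" using True fB by simp
    finally show ?thesis using that by (intro exI[of _ "\<lambda>b. if b = w then 1 else 0"]) simp
  next
    case False
    show ?thesis
    proof (rule ccontr)
      assume "\<not> ?thesis"
      then have far: "v (w - (\<Sum>b\<in>B. of_rat (c b) * b)) \<ge> e" for c by (meson not_less)
      \<comment> \<open>For a combination t * w + s with value of size r: the distance
        \<open>e\<close> bounds v t by r / e, hence v s by r (1 + v w / e), and \<open>C\<close>
        then bounds the coefficients of s.\<close>
      define C' where "C' = 1 / e + C * (1 + v w / e)"
      have "C' > 0" using C(1) \<open>e > 0\<close> by (auto simp: C'_def intro!: add_pos_nonneg)
      moreover have "v (of_rat (c b)) \<le> C' * v (\<Sum>b\<in>insert w B. of_rat (c b) * b)"
        if b: "b \<in> insert w B" for c b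
      proof -
        define s where "s = (\<Sum>b\<in>B. of_rat (c b) * b)"
        define t where "t = (of_rat (c w) :: 'k)"
        have u: "(\<Sum>b\<in>insert w B. of_rat (c b) * b) = t * w + s"
          using False fB by (simp add: s_def t_def)
        have t: "v t \<le> v (t * w + s) / e"
        proof (cases "t = 0")
          case False
          then have "c w \<noteq> 0" by (auto simp: t_def)
          then have "t * (w - (\<Sum>b\<in>B. of_rat (- (c b / c w)) * b)) = t * w + s"
            by (simp add: s_def t_def distrib_left sum_distrib_left of_rat_divide of_rat_minus sum_negf)
          then have "v t * v (w - (\<Sum>b\<in>B. of_rat (- (c b / c w)) * b)) = v (t * w + s)"
            by (metis mult)
          moreover have "v t * e \<le> v t * v (w - (\<Sum>b\<in>B. of_rat (- (c b / c w)) * b))"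
            using far[of "\<lambda>b. - (c b / c w)"] by (intro mult_left_mono) auto
          ultimately show ?thesis using \<open>e > 0\<close> by (simp add: field_simps)
        qed (use \<open>e > 0\<close> in simp)
        have "v s \<le> v (t * w + s) + v t * v w"
          using triangle_diff[of "t * w + s" "t * w"] by (simp add: mult)
        also have "\<dots> \<le> v (t * w + s) + v (t * w + s) / e * v w"
          using t by (intro add_left_mono mult_right_mono) auto
        finally have s: "v s \<le> v (t * w + s) * (1 + v w / e)" by (simp add: algebra_simps)
        show ?thesis
        proof (cases "b = w")
          case True
          have "0 \<le> C * (1 + v w / e) * v (t * w + s)" using C(1) \<open>e > 0\<close> by simp
          then show ?thesis using t True unfolding u C'_def by (simp add: t_def algebra_simps)
        next
          case False
          then have "v (of_rat (c b)) \<le> C * v s" using C(2)[of b c] b by (simp add: s_def)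
          also have "\<dots> \<le> C * (v (t * w + s) * (1 + v w / e))" using s C(1) by simp
          also have "\<dots> \<le> C' * v (t * w + s)" using \<open>e > 0\<close> by (simp add: C'_def algebra_simps)
          finally show ?thesis unfolding u .
        qed
      qed
      ultimately have "\<exists>C>0. \<forall>c. \<forall>b\<in>insert w B.
          v (of_rat (c b)) \<le> C * v (\<Sum>b\<in>insert w B. of_rat (c b) * b)" by metis
      then have "independent_over_rat (insert w B)" unfolding independent_over_rat_def .
      then have "card (insert w B) \<le> card B" using max[of "insert w B"] B(1) \<open>w \<in> W\<close> by simp
      then show False using False fB by simp
    qed
  qed
  have "dense_over_rat B"
    unfolding dense_over_rat_def
  proof (intro allI impI)
    fix x and e :: real assume "e > 0"
    obtain c where c: "x = (\<Sum>w\<in>W. of_rat (c w) * w)" using span by blast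
    define d where "d = e / (1 + (\<Sum>w\<in>W. v (of_rat (c w))))"
    have "(\<Sum>w\<in>W. v (of_rat (c w))) \<ge> 0" by (rule sum_nonneg) simp
    then have dpos: "1 + (\<Sum>w\<in>W. v (of_rat (c w))) > 0" by linarith
    have "d > 0" using \<open>e > 0\<close> dpos by (simp add: d_def)
    then have "\<forall>w\<in>W. \<exists>c. v (w - (\<Sum>b\<in>B. of_rat (c b) * b)) < d"
      using approx by auto
    from bchoice[OF this] obtain g
      where g: "\<And>w. w \<in> W \<Longrightarrow> v (w - (\<Sum>b\<in>B. of_rat (g w b) * b)) < d"
      by auto
    have "(\<Sum>w\<in>W. of_rat (c w) * (w - (\<Sum>b\<in>B. of_rat (g w b) * b)))
        = x - (\<Sum>w\<in>W. \<Sum>b\<in>B. of_rat (c w) * (of_rat (g w b) * b))"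
      unfolding c by (simp add: right_diff_distrib sum_subtractf sum_distrib_left)
    also have "(\<Sum>w\<in>W. \<Sum>b\<in>B. of_rat (c w) * (of_rat (g w b) * b))
        = (\<Sum>b\<in>B. of_rat (\<Sum>w\<in>W. c w * g w b) * b)"
      by (subst sum.swap) (simp add: of_rat_sum of_rat_mult sum_distrib_right mult.assoc)
    finally have "v (x - (\<Sum>b\<in>B. of_rat (\<Sum>w\<in>W. c w * g w b) * b))
        = v (\<Sum>w\<in>W. of_rat (c w) * (w - (\<Sum>b\<in>B. of_rat (g w b) * b)))" by simp
    also have "\<dots> \<le> (\<Sum>w\<in>W. v (of_rat (c w)) * v (w - (\<Sum>b\<in>B. of_rat (g w b) * b)))"
      using sum_le by (simp flip: mult)
    also have "\<dots> \<le> (\<Sum>w\<in>W. v (of_rat (c w)) * d)"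
      using g by (intro sum_mono mult_left_mono) (auto intro: less_imp_le)
    also have "\<dots> = (\<Sum>w\<in>W. v (of_rat (c w))) * d" by (rule sum_distrib_right[symmetric])
    also have "\<dots> < (1 + (\<Sum>w\<in>W. v (of_rat (c w)))) * d" using \<open>d > 0\<close> by simp
    also have "\<dots> = e" using dpos by (simp add: d_def)
    finally show "\<exists>c. v (x - (\<Sum>b\<in>B. of_rat (c b) * b)) < e" by (intro exI[of _ "\<lambda>b. \<Sum>w\<in>W. c w * g w b"])
  qed
  then show ?thesis using that B by blast
qed

section \<open>Absolute values and series in the completion\<close>

lemma completion_abs_cls:
  assumes "cau x"
  shows "(\<lambda>n. v (x n)) \<longlonglongrightarrow> completion_abs v (cls x)"
proof -
  have "Cauchy (\<lambda>n. v (x n))"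
  proof (rule metric_CauchyI)
    fix e :: real assume "e > 0"
    then obtain N where "\<forall>i\<ge>N. \<forall>j\<ge>N. v (x i - x j) < e" using assms unfolding cau_def by meson
    then show "\<exists>N. \<forall>i\<ge>N. \<forall>j\<ge>N. dist (v (x i)) (v (x j)) < e"
      using abs_diff_le unfolding dist_real_def by (meson le_less_trans)
  qed
  then obtain r where r: "(\<lambda>n. v (x n)) \<longlonglongrightarrow> r" using convergent_eq_Cauchy by blast
  have "completion_abs v (cls x) = r"
    unfolding completion_abs_def
  proof (rule the_equality)
    show "\<forall>y\<in>cls x. (\<lambda>n. v (y n)) \<longlonglongrightarrow> r"
    proof
      fix y assume "y \<in> cls x"
      then have "null (\<lambda>n. y n - x n)" by (simp add: mem_cls)
      then have "(\<lambda>n. v (y n) - v (x n)) \<longlonglongrightarrow> 0"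
        unfolding null_def by (rule Lim_null_comparison[rotated]) (simp add: abs_diff_le)
      then show "(\<lambda>n. v (y n)) \<longlonglongrightarrow> r" using tendsto_add[OF _ r] by force
    qed
    show "s = r" if "\<forall>y\<in>cls x. (\<lambda>n. v (y n)) \<longlonglongrightarrow> s" for s
    proof -
      have "x \<in> cls x" by (simp add: mem_cls)
      then show ?thesis using that r LIMSEQ_unique by blast
    qed
  qed
  with r show ?thesis by simp
qed

text \<open>Justifies the description operator: Cauchy partial sums converge to their own class, and
  any other limit is represented by a sequence differing from them by a null sequence.\<close>

lemma series_value_eq:
  fixes a :: "nat \<Rightarrow> 'k"
  defines "S \<equiv> \<lambda>N. \<Sum>n<N. a n"
  assumes "cau S"
  shows "series_value v a = cls S"
  unfolding series_value_def
proof (rule the_equality)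
  have minus: "to_completion v (S N) \<ominus>\<^bsub>Kv\<^esub> cls y = cls (\<lambda>n. S N - y n)" if "cau y" for N y
    using that by (simp add: to_completion_eq a_minus_def cls_minus cls_add cau_minus)
  have lim: "(\<lambda>n. v (S N - y n)) \<longlonglongrightarrow> completion_abs v (cls (\<lambda>n. S N - y n))" if "cau y" for N y
    by (rule completion_abs_cls) (simp add: cau_diff that)
  have "(\<lambda>N. completion_abs v (cls (\<lambda>n. S N - S n))) \<longlonglongrightarrow> 0"
  proof (rule LIMSEQ_I)
    fix e :: real assume "e > 0"
    then obtain N where N: "\<forall>i\<ge>N. \<forall>j\<ge>N. v (S i - S j) < e / 2"
      using assms(2) unfolding cau_def by (meson half_gt_zero)
    have "norm (completion_abs v (cls (\<lambda>n. S M - S n)) - 0) < e" if "M \<ge> N" for M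
    proof -
      have "completion_abs v (cls (\<lambda>n. S M - S n)) \<le> e / 2"
        by (rule LIMSEQ_le_const2[OF lim[OF assms(2)]]) (use N that in \<open>auto intro: less_imp_le\<close>)
      moreover have "completion_abs v (cls (\<lambda>n. S M - S n)) \<ge> 0"
        by (rule LIMSEQ_le_const[OF lim[OF assms(2)]]) simp
      ultimately show ?thesis using \<open>e > 0\<close> by simp
    qed
    then show "\<exists>N. \<forall>M\<ge>N. norm (completion_abs v (cls (\<lambda>n. S M - S n)) - 0) < e" by blast
  qed
  then show "cls S \<in> carrier Kv \<and>
      (\<lambda>N. completion_abs v (to_completion v (\<Sum>n<N. a n) \<ominus>\<^bsub>Kv\<^esub> cls S)) \<longlonglongrightarrow> 0"
    using minus[OF assms(2)] assms(2) by (simp add: S_def)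
  fix s assume s: "s \<in> carrier Kv \<and>
      (\<lambda>N. completion_abs v (to_completion v (\<Sum>n<N. a n) \<ominus>\<^bsub>Kv\<^esub> s)) \<longlonglongrightarrow> 0"
  then obtain y where y: "s = cls y" "cau y" by (auto simp: carrier_Kv)
  then have l: "(\<lambda>N. completion_abs v (cls (\<lambda>n. S N - y n))) \<longlonglongrightarrow> 0"
    using s minus[OF y(2)] by (simp add: S_def)
  have "null (\<lambda>n. y n - S n)"
    unfolding null_def
  proof (rule LIMSEQ_I)
    fix e :: real assume e: "e > 0"
    then obtain N where N: "\<forall>i\<ge>N. \<forall>j\<ge>N. v (S i - S j) < e / 2"
      using assms(2) unfolding cau_def by (meson half_gt_zero)
    have "\<forall>\<^sub>F M in sequentially. completion_abs v (cls (\<lambda>n. S M - y n)) < e / 2 \<and> M \<ge> N"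
      using order_tendstoD(2)[OF l, of "e/2"] e eventually_ge_at_top[of N]
      by (auto intro: eventually_conj)
    then obtain M where M: "completion_abs v (cls (\<lambda>n. S M - y n)) < e / 2" "M \<ge> N"
      using eventually_happens by fastforce
    have "\<forall>\<^sub>F n in sequentially. v (S M - y n) < e / 2 \<and> n \<ge> N"
      using order_tendstoD(2)[OF lim[OF y(2), of M] M(1)] eventually_ge_at_top[of N]
      by (auto intro: eventually_conj)
    then have "\<forall>\<^sub>F n in sequentially. norm (v (y n - S n) - 0) < e"
    proof (rule eventually_mono)
      fix n assume n: "v (S M - y n) < e / 2 \<and> n \<ge> N"
      have "v (y n - S n) \<le> v (S M - S n) + v (S M - y n)"
        using triangle_diff[of "S M - S n" "S M - y n"] by simp
      also have "\<dots> < e" using n N[rule_format, of M n] M(2) by simp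
      finally show "norm (v (y n - S n) - 0) < e" by simp
    qed
    then show "\<exists>N. \<forall>n\<ge>N. norm (v (y n - S n) - 0) < e" by (simp add: eventually_sequentially)
  qed
  then show "s = cls S" by (simp add: y(1) cls_eq_iff)
qed

lemma linear_form_eq_zero_iff:
  fixes m :: nat
  assumes "\<And>j. j \<in> {1..m} \<Longrightarrow> cau (x j)"
  shows "to_completion v (c 0) \<oplus>\<^bsub>Kv\<^esub>
      (\<Oplus>\<^bsub>Kv\<^esub>j\<in>{1..m}. to_completion v (c j) \<otimes>\<^bsub>Kv\<^esub> cls (x j)) = \<zero>\<^bsub>Kv\<^esub>
    \<longleftrightarrow> null (\<lambda>n. c 0 + (\<Sum>j=1..m. c j * x j n))"
proof -
  have fs: "(\<Oplus>\<^bsub>Kv\<^esub>j\<in>A. to_completion v (c j) \<otimes>\<^bsub>Kv\<^esub> cls (x j))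
      = cls (\<lambda>n. \<Sum>j\<in>A. c j * x j n) \<and> cau (\<lambda>n. \<Sum>j\<in>A. c j * x j n)"
    if "finite A" "A \<subseteq> {1..m}" for A
    using that
  proof (induction A)
    case empty
    then show ?case by (simp add: cls_zero)
  next
    case (insert j A)
    then show ?case
      using assms by (subst Kv.finsum_insert)
        (auto simp: to_completion_eq cls_mult cau_mult cls_add cau_add Pi_def subset_iff)
  qed
  show ?thesis
    using fs[of "{1..m}"] by (simp add: to_completion_eq cls_add cls_eq_zero_iff)
qed

end

section \<open>Non-Archimedean places\<close>

locale nonarchimedean_place =
  fixes v :: "'k::field_char_0 \<Rightarrow> real" and p :: nat
  assumes abs: "nonarchimedean_abs v" and prime: "Factorial_Ring.prime p"
    and padic: "v (of_rat q) = padic_abs p q"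
begin

sublocale absolute_value v
proof
  fix x y
  show "v x \<ge> 0" "v x = 0 \<longleftrightarrow> x = 0" "v (x * y) = v x * v y"
    using abs by (auto simp: nonarchimedean_abs_def)
  have "v (x + y) \<le> max (v x) (v y)" "v x \<ge> 0" "v y \<ge> 0"
    using abs by (auto simp: nonarchimedean_abs_def)
  then show "v (x + y) \<le> v x + v y" by linarith
qed

lemma ultra: "v (x + y) \<le> max (v x) (v y)"
  using abs by (auto simp: nonarchimedean_abs_def)

lemma add_le: "v x \<le> c \<Longrightarrow> v y \<le> c \<Longrightarrow> v (x + y) \<le> c"
  using ultra[of x y] by simp

lemma sum_le_bound: "c \<ge> 0 \<Longrightarrow> (\<And>i. i \<in> A \<Longrightarrow> v (f i) \<le> c) \<Longrightarrow> v (\<Sum>i\<in>A. f i) \<le> c"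
  by (induction A rule: infinite_finite_induct) (auto intro: add_le)

lemma add_eq_of_less: "v y < v x \<Longrightarrow> v (x + y) = v x"
  using ultra[of x y] ultra[of "x + y" "- y"] by auto

lemma p_gt_1: "real p > 1"
  using prime prime_gt_1_nat by simp

section \<open>Integers, factorials and series at a non-Archimedean place\<close>

lemma v_of_int: "v (of_int a) = (if a = 0 then 0 else inverse (real p) ^ multiplicity (int p) a)"
proof -
  have "v (of_int a) = padic_abs p (of_int a)" using padic[of "of_int a"] by simp
  then show ?thesis
    by (auto simp: padic_abs_def power_int_minus power_inverse)
qed

lemma v_of_int_le [simp]: "v (of_int a) \<le> 1"
  using p_gt_1 by (auto simp: v_of_int intro!: power_le_one inverse_le_1_iff[THEN iffD2])

lemma v_of_nat_le [simp]: "v (of_nat a) \<le> 1"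
  using v_of_int_le[of "int a"] by simp

lemma v_fact_le [simp]: "v (fact n) \<le> 1"
  using v_of_nat_le[of "fact n"] by simp

lemma v_p: "v (of_nat p) = inverse (real p)"
  using v_of_int[of "int p"] prime prime_gt_0_nat[of p] by (simp add: multiplicity_self)

lemma v_of_int_eq_1: "\<not> int p dvd a \<Longrightarrow> v (of_int a) = 1"
  by (auto simp: v_of_int not_dvd_imp_multiplicity_0)

lemma v_of_int_ge:
  assumes "a \<noteq> 0" "\<bar>a\<bar> < int p ^ Suc n"
  shows "v (of_int a) \<ge> inverse (real p) ^ n"
proof -
  have "multiplicity (int p) a \<le> n"
  proof (rule ccontr)
    assume "\<not> ?thesis"
    then have "int p ^ Suc n dvd a" using multiplicity_dvd' by (metis not_less_eq_eq)
    then show False using assms dvd_imp_le_int[of a "int p ^ Suc n"] by simp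
  qed
  then show ?thesis
    using assms p_gt_1 by (auto simp: v_of_int intro!: power_decreasing inverse_le_1_iff[THEN iffD2])
qed

text \<open>A crude form of Legendre's formula, counting each multiple of p up to n once; it serves
  to show that factorials tend to zero.\<close>

lemma v_fact: "v (fact n) \<le> inverse (real p) ^ (n div p)"
proof (induction n)
  case (Suc n)
  have e: "v (fact (Suc n)) = v (of_nat (Suc n)) * v (fact n)"
    by (simp only: fact_Suc mult)
  show ?case
  proof (cases "Suc n mod p = 0")
    case True
    then obtain k where k: "Suc n = p * k" by auto
    have "v (of_nat (Suc n)) = v (of_nat p) * v (of_nat k)" by (simp only: k of_nat_mult mult)
    then have "v (of_nat (Suc n)) \<le> inverse (real p)" using v_of_nat_le[of k] by (simp add: v_p mult_left_le)
    then have "v (fact (Suc n)) \<le> inverse (real p) * inverse (real p) ^ (n div p)"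
      unfolding e using Suc by (intro mult_mono) auto
    then show ?thesis using True by (simp add: div_Suc)
  next
    case False
    have "v (fact (Suc n)) \<le> 1 * inverse (real p) ^ (n div p)"
      unfolding e using Suc v_of_nat_le[of "Suc n"] by (intro mult_mono) auto
    then show ?thesis using False by (simp add: div_Suc)
  qed
qed simp

lemma v_fact_antimono: assumes "k \<le> n" shows "v (fact n) \<le> v (fact k)"
proof -
  have "(fact k :: nat) dvd fact n" using assms by (simp add: fact_dvd)
  then obtain c where "(fact n :: nat) = fact k * c" by (auto elim: dvdE)
  then have "(fact n :: 'k) = fact k * of_nat c" by (metis of_nat_fact of_nat_mult)
  then show ?thesis by (simp add: mult mult_right_le_one_le)
qed

lemma v_fact_tendsto_0: "(\<lambda>n. v (fact n)) \<longlonglongrightarrow> 0"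
proof (rule tendsto_sandwich[OF _ _ tendsto_const])
  have "filterlim (\<lambda>n. n div p) sequentially sequentially"
  proof (rule filterlim_at_top[THEN iffD2], rule allI)
    fix Z show "\<forall>\<^sub>F n in sequentially. Z \<le> n div p"
      using prime_gt_0_nat[OF prime]
      by (auto simp: less_eq_div_iff_mult_less_eq intro: eventually_ge_at_top)
  qed
  moreover have "(\<lambda>n. inverse (real p) ^ n) \<longlonglongrightarrow> 0"
    using p_gt_1 by (intro LIMSEQ_power_zero) (simp add: inverse_less_1_iff)
  ultimately show "(\<lambda>n. inverse (real p) ^ (n div p)) \<longlonglongrightarrow> 0"
    using filterlim_compose by blast
qed (use v_fact in auto)

text \<open>By the ultrametric inequality a block of consecutive terms is no larger than its largest
  term, so terms tending to zero suffice.\<close>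

lemma cau_partial_sums:
  assumes "null a" shows "cau (\<lambda>N. \<Sum>n<N. a n)"
proof (rule cauI)
  fix e :: real assume e: "e > 0"
  then obtain M where M: "\<And>n. n \<ge> M \<Longrightarrow> v (a n) < e / 2"
    using assms order_tendstoD(2)[of "\<lambda>n. v (a n)" 0 sequentially "e/2"]
    by (auto simp: null_def eventually_sequentially)
  have le: "v ((\<Sum>n<i. a n) - (\<Sum>n<j. a n)) \<le> e / 2" if "M \<le> j" "j \<le> i" for i j
  proof -
    have "(\<Sum>n<i. a n) - (\<Sum>n<j. a n) = (\<Sum>n=j..<i. a n)"
      using that by (simp add: lessThan_atLeast0 flip: sum_diff_nat_ivl[of 0 j i])
    also have "v \<dots> \<le> e / 2" using e M that by (intro sum_le_bound) (auto intro: less_imp_le)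
    finally show ?thesis .
  qed
  have "v ((\<Sum>n<i. a n) - (\<Sum>n<j. a n)) < e" if "i \<ge> M" "j \<ge> M" for i j
    using le[of i j] le[of j i] that e minus_commute[of "\<Sum>n<i. a n" "\<Sum>n<j. a n"] by linarith
  then show "\<exists>N. \<forall>i\<ge>N. \<forall>j\<ge>N. v ((\<Sum>n<i. a n) - (\<Sum>n<j. a n)) < e" by blast
qed

text \<open>Moves the vanishing of the linear form from the completion to a limit of elements of the
  field itself, namely the \<open>w i\<close> of the locale \<open>euler_form\<close>; afterwards
  completions matter only through local degrees.\<close>

lemma euler_linear_form:
  fixes m :: nat
  assumes "\<And>j. j \<in> {1..m} \<Longrightarrow> v (\<alpha> j) \<le> 1"
    and "to_completion v (c 0) \<oplus>\<^bsub>Kv\<^esub>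
      (\<Oplus>\<^bsub>Kv\<^esub>j\<in>{1..m}. to_completion v (c j) \<otimes>\<^bsub>Kv\<^esub> euler_series v (\<alpha> j)) = \<zero>\<^bsub>Kv\<^esub>"
  shows "(\<lambda>i. v (c 0 + (\<Sum>j=1..m. c j * (\<Sum>s<i. fact s * \<alpha> j ^ s)))) \<longlonglongrightarrow> 0"
proof -
  have cau: "cau (\<lambda>i. \<Sum>s<i. fact s * \<alpha> j ^ s)" if "j \<in> {1..m}" for j
  proof (rule cau_partial_sums)
    show "null (\<lambda>s. fact s * \<alpha> j ^ s)"
      unfolding null_def
      by (rule tendsto_sandwich[OF _ _ tendsto_const v_fact_tendsto_0])
         (use assms(1)[OF that] in \<open>auto simp: mult power power_le_one intro!: mult_left_le\<close>)
  qed
  have eq: "(\<Oplus>\<^bsub>Kv\<^esub>j\<in>{1..m}. to_completion v (c j) \<otimes>\<^bsub>Kv\<^esub> euler_series v (\<alpha> j))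
    = (\<Oplus>\<^bsub>Kv\<^esub>j\<in>{1..m}. to_completion v (c j) \<otimes>\<^bsub>Kv\<^esub> cls (\<lambda>i. \<Sum>s<i. fact s * \<alpha> j ^ s))"
    by (rule Kv.finsum_cong')
       (auto simp: euler_series_def series_value_eq cau to_completion_eq)
  show ?thesis
    using iffD1[OF linear_form_eq_zero_iff[where c = c, OF cau] assms(2)[unfolded eq]]
    unfolding null_def .
qed

end

lemma nonarchimedean_places_iff:
  "v \<in> nonarchimedean_places \<longleftrightarrow> (\<exists>p. nonarchimedean_place v p)"
  by (auto simp: nonarchimedean_places_def nonarchimedean_place_def)

lemma absolute_value_nonarchimedean: "v \<in> nonarchimedean_places \<Longrightarrow> absolute_value v"
proof -
  assume "v \<in> nonarchimedean_places"
  then obtain p where "nonarchimedean_place v p" using nonarchimedean_places_iff by blast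
  then interpret nonarchimedean_place v p .
  show ?thesis by unfold_locales
qed

section \<open>Subrings and embeddings\<close>

text \<open>Subrings are sets because one field carries many of them: valuation rings, the order
  Z[\<theta>], the algebraic integers and rational subalgebras all use the closure lemmas
  below.\<close>

definition unital_subring :: "'k::comm_ring_1 set \<Rightarrow> bool" where
  "unital_subring R \<longleftrightarrow> 1 \<in> R \<and> (\<forall>x\<in>R. \<forall>y\<in>R. x - y \<in> R \<and> x * y \<in> R)"

context
  fixes R :: "'k::comm_ring_1 set"
  assumes R: "unital_subring R"
begin

lemma unital_subring_1: "1 \<in> R" and unital_subring_diff: "x \<in> R \<Longrightarrow> y \<in> R \<Longrightarrow> x - y \<in> R"
  and unital_subring_mult: "x \<in> R \<Longrightarrow> y \<in> R \<Longrightarrow> x * y \<in> R"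
  using R by (auto simp: unital_subring_def)

lemma unital_subring_0: "0 \<in> R"
  using unital_subring_diff[OF unital_subring_1 unital_subring_1] by simp

lemma unital_subring_minus: "x \<in> R \<Longrightarrow> - x \<in> R"
  using unital_subring_diff[OF unital_subring_0] by fastforce

lemma unital_subring_add: "x \<in> R \<Longrightarrow> y \<in> R \<Longrightarrow> x + y \<in> R"
  using unital_subring_diff[of x "- y"] unital_subring_minus by simp

lemma unital_subring_power: "x \<in> R \<Longrightarrow> x ^ n \<in> R"
  by (induction n) (auto intro: unital_subring_mult unital_subring_1)

lemma unital_subring_sum: "(\<And>i. i \<in> A \<Longrightarrow> f i \<in> R) \<Longrightarrow> sum f A \<in> R"
  by (induction A rule: infinite_finite_induct) (auto intro: unital_subring_add unital_subring_0)

lemma unital_subring_of_nat: "of_nat n \<in> R"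
  by (induction n) (auto intro: unital_subring_add unital_subring_0 unital_subring_1)

lemma unital_subring_coeff_mult:
  assumes "\<And>i. coeff p i \<in> R" "\<And>i. coeff q i \<in> R"
  shows "coeff (p * q) i \<in> R"
  using assms by (auto simp: coeff_mult intro!: unital_subring_sum unital_subring_mult)

lemma unital_subring_coeff_power:
  assumes "\<And>i. coeff p i \<in> R"
  shows "coeff (p ^ n) i \<in> R"
  by (induction n arbitrary: i)
     (auto intro: unital_subring_coeff_mult assms unital_subring_0 unital_subring_1 simp: coeff_1)

lemma unital_subring_coeff_prod:
  assumes "\<And>j i. j \<in> A \<Longrightarrow> coeff (p j) i \<in> R"
  shows "coeff (\<Prod>j\<in>A. p j) i \<in> R"
  using assms
  by (induction A arbitrary: i rule: infinite_finite_induct)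
     (auto intro: unital_subring_coeff_mult unital_subring_0 unital_subring_1 simp: coeff_1)

end

lemma (in nonarchimedean_place) unital_subring_unit_ball: "unital_subring {x. v x \<le> 1}"
  unfolding unital_subring_def using add_le[of _ 1 "- _"] by (auto simp: mult intro: mult_le_one)

locale embedded_field =
  fixes \<sigma> :: "'k::field_char_0 \<Rightarrow> complex"
  assumes embedding: "complex_embedding \<sigma>"
begin

lemma hom_1 [simp]: "\<sigma> 1 = 1" and hom_add: "\<sigma> (x + y) = \<sigma> x + \<sigma> y"
  and hom_mult: "\<sigma> (x * y) = \<sigma> x * \<sigma> y"
  using embedding unfolding complex_embedding_def by blast+

lemma hom_0 [simp]: "\<sigma> 0 = 0"
  using hom_add[of 0 0] by simp

lemma hom_minus: "\<sigma> (- x) = - \<sigma> x"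
  using hom_add[of x "- x"] by (simp add: eq_neg_iff_add_eq_0 add.commute)

lemma hom_diff: "\<sigma> (x - y) = \<sigma> x - \<sigma> y"
  using hom_add[of x "- y"] by (simp add: hom_minus)

lemma hom_power: "\<sigma> (x ^ n) = \<sigma> x ^ n"
  by (induction n) (simp_all add: hom_mult)

lemma hom_sum: "\<sigma> (\<Sum>i\<in>A. f i) = (\<Sum>i\<in>A. \<sigma> (f i))"
  by (induction A rule: infinite_finite_induct) (simp_all add: hom_add)

lemma hom_of_nat: "\<sigma> (of_nat n) = of_nat n"
  by (induction n) (simp_all add: hom_add)

lemma hom_of_int: "\<sigma> (of_int n) = of_int n"
  by (cases n) (simp_all add: hom_of_nat hom_minus hom_diff del: of_nat_Suc)

lemma hom_fact: "\<sigma> (fact n) = fact n"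
  using hom_of_nat[of "fact n"] by simp

lemma hom_eq_0_iff [simp]: "\<sigma> x = 0 \<longleftrightarrow> x = 0"
proof
  assume "\<sigma> x = 0"
  then show "x = 0" using hom_mult[of x "inverse x"] by (cases "x = 0") auto
qed simp

lemma hom_inverse: "\<sigma> (inverse x) = inverse (\<sigma> x)"
proof (cases "x = 0")
  case False
  then have "\<sigma> x * \<sigma> (inverse x) = 1" by (simp flip: hom_mult)
  then show ?thesis by (metis inverse_unique)
qed simp

lemma hom_divide: "\<sigma> (x / y) = \<sigma> x / \<sigma> y"
  by (simp add: divide_inverse hom_mult hom_inverse)

lemma hom_of_rat: "\<sigma> (of_rat q) = of_rat q"
  by (cases q) (simp add: of_rat_rat hom_divide hom_of_int)

sublocale absolute_value "\<lambda>x. cmod (\<sigma> x)"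
  by unfold_locales (simp_all add: hom_mult norm_mult hom_add norm_triangle_ineq)

end

section \<open>Simultaneous approximations\<close>

lemma poly_eq_sum_atMost:
  fixes p :: "'a::comm_semiring_1 poly"
  assumes "degree p \<le> n" shows "poly p x = (\<Sum>i\<le>n. coeff p i * x ^ i)"
  unfolding poly_altdef using assms
  by (intro sum.mono_neutral_left) (auto simp: coeff_eq_0)

text \<open>The cofactor of M vanishes at \<open>a\<close> because M does not, so it absorbs the
  linear factor.\<close>

lemma dvd_linear_mult_cancel:
  fixes M T :: "'k::field poly"
  assumes "M dvd [:- a, 1:] * T" "poly M a \<noteq> 0"
  shows "M dvd T"
proof -
  obtain G where G: "[:- a, 1:] * T = M * G" using assms(1) by (auto elim: dvdE)
  have "poly M a * poly G a = poly ([:- a, 1:] * T) a" unfolding G by simp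
  then have "poly G a = 0" using assms(2) by simp
  then obtain H where "G = [:- a, 1:] * H" unfolding poly_eq_0_iff_dvd by (auto elim: dvdE)
  then have "[:- a, 1:] * T = [:- a, 1:] * (M * H)" using G by (simp only: mult.left_commute)
  then have "T = M * H" by (subst (asm) mult_cancel_left) auto
  then show ?thesis by simp
qed

text \<open>Cancelling the linear factors one at a time leaves a divisor of 1. In
  \<open>nonvanishing\<close> this disposes of a generator that has none of the \<alpha> j as a
  root.\<close>

lemma dvd_prod_linear_power_imp_degree_0:
  fixes M :: "'k::field poly"
  assumes "finite J" "M dvd (\<Prod>j\<in>J. [:- \<alpha> j, 1:] ^ l)" "\<And>j. j \<in> J \<Longrightarrow> poly M (\<alpha> j) \<noteq> 0"
  shows "degree M = 0"
  using assms
proof (induction J)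
  case (insert j J)
  have "M dvd T" if "M dvd [:- \<alpha> j, 1:] ^ n * T" for n T
    using that
  proof (induction n arbitrary: T)
    case (Suc n)
    then have "M dvd [:- \<alpha> j, 1:] * ([:- \<alpha> j, 1:] ^ n * T)" by (simp only: power_Suc mult.assoc)
    then have "M dvd [:- \<alpha> j, 1:] ^ n * T" by (rule dvd_linear_mult_cancel) (rule insert.prems(2),
        rule insertI1)
    then show ?case by (rule Suc.IH)
  qed simp
  moreover have "M dvd [:- \<alpha> j, 1:] ^ l * (\<Prod>j\<in>J. [:- \<alpha> j, 1:] ^ l)"
    using insert.prems(1) unfolding prod.insert[OF insert.hyps] .
  ultimately have "M dvd (\<Prod>j\<in>J. [:- \<alpha> j, 1:] ^ l)" .
  then show ?case by (rule insert.IH) (rule insert.prems(2), rule insertI2)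
next
  case empty
  then have "M dvd 1" by simp
  moreover from this have "M \<noteq> 0" by force
  ultimately show ?case using is_unit_iff_degree by blast
qed

locale euler_form =
  fixes m :: nat and \<alpha> lam :: "nat \<Rightarrow> 'k::field_char_0"
  assumes m: "m \<ge> 1" and \<alpha>_nz: "\<And>j. j \<in> {1..m} \<Longrightarrow> \<alpha> j \<noteq> 0"
    and \<alpha>_inj: "inj_on \<alpha> {1..m}" and lam_nz: "\<exists>j\<in>{0..m}. lam j \<noteq> 0"
begin

definition w :: "nat \<Rightarrow> 'k" where
  "w i = lam 0 + (\<Sum>j=1..m. lam j * (\<Sum>s<i. fact s * \<alpha> j ^ s))"

definition P :: "'k poly" where
  "P = (\<Prod>j=1..m. [:- \<alpha> j, 1:])"

definition \<phi> :: "'k poly \<Rightarrow> 'k" where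
  "\<phi> S = (\<Sum>i\<le>degree S. coeff S i * (w i / fact i))"

definition \<psi> :: "'k poly \<Rightarrow> 'k" where
  "\<psi> Q = (\<Sum>j=1..m. lam j * poly Q (\<alpha> j))"

section \<open>The functional and the non-vanishing of the approximations\<close>

lemma \<phi>_eq: "degree S \<le> N \<Longrightarrow> \<phi> S = (\<Sum>i\<le>N. coeff S i * (w i / fact i))"
  unfolding \<phi>_def by (rule sum.mono_neutral_left) (auto simp: coeff_eq_0)

lemma \<phi>_add: "\<phi> (S + T) = \<phi> S + \<phi> T"
proof -
  define N where "N = max (degree S) (degree T)"
  have "degree (S + T) \<le> N" "degree S \<le> N" "degree T \<le> N"
    by (auto simp: N_def degree_add_le_max)
  then show ?thesis by (simp add: \<phi>_eq[of _ N] distrib_right add_divide_distrib sum.distrib)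
qed

lemma \<phi>_smult: "\<phi> (smult c S) = c * \<phi> S"
  by (cases "c = 0") (simp_all add: \<phi>_def sum_distrib_left mult.assoc)

lemma \<phi>_diff: "\<phi> (S - T) = \<phi> S - \<phi> T"
  using \<phi>_add[of S "smult (-1) T"] \<phi>_smult[of "-1" T] by simp

lemma \<phi>_0 [simp]: "\<phi> 0 = 0"
  by (simp add: \<phi>_def)

lemma \<phi>_sum: "\<phi> (\<Sum>i\<in>A. f i) = (\<Sum>i\<in>A. \<phi> (f i))"
  by (induction A rule: infinite_finite_induct) (simp_all add: \<phi>_add)

lemma w_Suc: "w (Suc i) - w i = fact i * (\<Sum>j=1..m. lam j * \<alpha> j ^ i)"
  by (simp add: w_def algebra_simps sum_subtractf[symmetric] sum_distrib_left)

text \<open>The recurrence \<open>w_Suc\<close> makes the functional \<open>\<phi>\<close>, sending \<open>x^i\<close> to \<open>w i / i!\<close>, satisfy a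
  first order differential relation.\<close>

lemma \<phi>_differential: "\<phi> (pCons 0 (pderiv (pCons 0 Q)) - Q) = \<psi> Q"
proof -
  define N where "N = degree Q"
  define D where "D = pderiv (pCons 0 Q)"
  have D: "coeff D i = of_nat (Suc i) * coeff Q i" for i
    by (simp add: D_def coeff_pderiv)
  have "degree D \<le> N" by (rule degree_le) (auto simp: D N_def coeff_eq_0)
  then have "degree (pCons 0 D) \<le> Suc N" by (metis degree_pCons_le Suc_le_mono le_trans)
  then have "\<phi> (pCons 0 D) = (\<Sum>i\<le>Suc N. coeff (pCons 0 D) i * (w i / fact i))" by (rule \<phi>_eq)
  also have "\<dots> = (\<Sum>i\<le>N. coeff D i * (w (Suc i) / fact (Suc i)))"
    by (subst sum.atMost_Suc_shift) simp
  \<comment> \<open>The derivative supplies a factor i + 1 that reduces (i + 1)! to i!, so both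
    parts get the same denominator and the difference of \<open>w_Suc\<close> appears.\<close>
  also have "\<dots> = (\<Sum>i\<le>N. coeff Q i * (w (Suc i) / fact i))"
    by (intro sum.cong refl) (simp add: D del: of_nat_Suc)
  finally have "\<phi> (pCons 0 D - Q) = (\<Sum>i\<le>N. coeff Q i * ((w (Suc i) - w i) / fact i))"
    by (simp add: \<phi>_diff \<phi>_eq[of Q N] N_def right_diff_distrib diff_divide_distrib sum_subtractf)
  also have "\<dots> = (\<Sum>i\<le>N. coeff Q i * (\<Sum>j=1..m. lam j * \<alpha> j ^ i))"
    by (simp add: w_Suc)
  also have "\<dots> = (\<Sum>i\<le>N. \<Sum>j=1..m. lam j * (coeff Q i * \<alpha> j ^ i))"
    by (simp add: sum_distrib_left mult_ac)
  also have "\<dots> = \<psi> Q"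
    by (subst sum.swap) (simp add: \<psi>_def poly_altdef sum_distrib_left N_def)
  finally show ?thesis by (simp add: D_def)
qed

lemma P_nz: "P \<noteq> 0"
  by (simp add: P_def)

lemma degree_P: "degree P = m"
  unfolding P_def by (subst degree_prod_eq_sum_degree) auto

lemma degree_monom_mult_P_power: "degree (monom 1 \<mu> * P ^ l) \<le> m * l + \<mu>"
  by (rule order.trans[OF degree_mult_le])
     (simp add: degree_monom_eq degree_power_eq P_nz degree_P mult.commute)

lemma poly_P: "j \<in> {1..m} \<Longrightarrow> poly P (\<alpha> j) = 0"
  by (auto simp: P_def poly_prod)

text \<open>Division by P splits Q into a remainder, handled by the hypothesis at level l, and a
  quotient of smaller degree, which moves to level l + 1. Hence the hypothesis covers all levels
  from l0 on.\<close>

lemma \<phi>_ideal: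
  assumes "\<And>l \<mu>. l \<ge> l0 \<Longrightarrow> \<mu> < m \<Longrightarrow> \<phi> (monom 1 \<mu> * P ^ l) = 0"
  shows "l \<ge> l0 \<Longrightarrow> \<phi> (P ^ l * Q) = 0"
proof (induction "degree Q" arbitrary: Q l rule: less_induct)
  case less
  have small: "\<phi> (P ^ l * T) = 0" if "degree T < m" for T
  proof -
    have "P ^ l * T = (\<Sum>i\<le>degree T. smult (coeff T i) (monom 1 i * P ^ l))"
      by (subst (1) poly_as_sum_of_monoms[of T, symmetric])
         (simp add: sum_distrib_left mult.commute smult_monom flip: mult_smult_left)
    also have "\<phi> \<dots> = 0"
      using assms less.prems that by (simp add: \<phi>_sum \<phi>_smult)
    finally show ?thesis .
  qed
  show ?case
  proof (cases "degree Q < m")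
    case False
    have deg: "degree (Q mod P) < m"
      using degree_mod_less[of P Q] P_nz degree_P m by auto
    have "degree Q \<noteq> 0" "Q \<noteq> 0" using False m by auto
    then have deg2: "degree (Q div P) < degree Q"
      using degree_div_less[of Q P] degree_P m by auto
    have "P ^ l * (P * D + T) = P ^ Suc l * D + P ^ l * T" for D T
      by (simp add: algebra_simps)
    from this[of "Q div P" "Q mod P"]
    have "P ^ l * Q = P ^ Suc l * (Q div P) + P ^ l * (Q mod P)"
      by (simp only: mult_div_mod_eq)
    then show ?thesis
      using less.hyps[OF deg2, of "Suc l"] small[OF deg] less.prems by (simp add: \<phi>_add)
  qed (rule small)
qed

text \<open>The constant polynomial 1 detects \<open>lam 0\<close>. If \<phi> vanished identically,
  so would \<psi> by the differential relation, and \<psi> detects each other \<open>lam j\<close>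
  through a polynomial vanishing at all remaining nodes.\<close>

lemma \<phi>_nonzero: "\<exists>Q. \<phi> Q \<noteq> 0"
proof (rule ccontr)
  assume "\<not> ?thesis"
  then have z: "\<phi> Q = 0" for Q by simp
  have "w 0 = 0" using z[of 1] by (simp add: \<phi>_def)
  then have "lam 0 = 0" by (simp add: w_def)
  moreover have "lam j = 0" if j: "j \<in> {1..m}" for j
  proof -
    define Q where "Q = (\<Prod>i\<in>{1..m}-{j}. [:- \<alpha> i, 1:])"
    have "0 = \<psi> Q" using \<phi>_differential[of Q] z by simp
    also have "\<dots> = (\<Sum>i\<in>{j}. lam i * poly Q (\<alpha> i))"
      unfolding \<psi>_def using j by (intro sum.mono_neutral_right) (auto simp: Q_def poly_prod)
    finally have "lam j * poly Q (\<alpha> j) = 0" by simp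
    moreover have "poly Q (\<alpha> j) \<noteq> 0"
      using j by (auto simp: Q_def poly_prod dest: inj_onD[OF \<alpha>_inj])
    ultimately show ?thesis by simp
  qed
  ultimately have "lam j = 0" if "j \<in> {0..m}" for j using that by (cases "j = 0") auto
  then show False using lam_nz by blast
qed

text \<open>If all approximations of high level vanished, \<open>\<phi>\<close> would kill an ideal of \<open>K[x]\<close>; at a root of
  a generator of the largest such ideal, the differential relation lowers the order of vanishing.\<close>

theorem nonvanishing: "\<exists>l\<ge>l0. \<exists>\<mu><m. \<phi> (monom 1 \<mu> * P ^ l) \<noteq> 0"
proof (rule ccontr)
  assume "\<not> ?thesis"
  then have "\<phi> (P ^ l0 * G) = 0" for G using \<phi>_ideal[of l0 l0] by blast
  then have "\<exists>M. M \<noteq> 0 \<and> (\<forall>G. \<phi> (M * G) = 0)" using P_nz by (intro exI[of _ "P ^ l0"]) auto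
  \<comment> \<open>By division with remainder, a nonzero M of least degree generates the largest
    ideal on which \<phi> vanishes.\<close>
  then obtain M where M: "M \<noteq> 0" "\<And>G. \<phi> (M * G) = 0"
    and min: "\<And>M'. M' \<noteq> 0 \<Longrightarrow> (\<forall>G. \<phi> (M' * G) = 0) \<Longrightarrow> degree M \<le> degree M'"
    using ex_has_least_nat[of "\<lambda>M. M \<noteq> 0 \<and> (\<forall>G. \<phi> (M * G) = 0)" _ degree] by metis
  have dvd: "M dvd A" if A: "\<And>G. \<phi> (A * G) = 0" for A
  proof (rule ccontr)
    assume "\<not> M dvd A"
    then have nz: "A mod M \<noteq> 0" by (simp add: dvd_eq_mod_eq_0)
    have "\<phi> (A mod M * G) = 0" for G
    proof -
      have "A mod M * G = A * G - M * (A div M * G)"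
        by (simp add: minus_mult_div_eq_mod[symmetric] algebra_simps)
      then show ?thesis by (simp only: \<phi>_diff A M(2)) simp
    qed
    then have "degree M \<le> degree (A mod M)" using min nz by blast
    then show False using degree_mod_less'[OF M(1) nz] by simp
  qed
  have "M dvd P ^ l0" using dvd \<open>\<And>G. \<phi> (P ^ l0 * G) = 0\<close> by blast
  then have dP: "M dvd (\<Prod>j=1..m. [:- \<alpha> j, 1:] ^ l0)" by (simp add: P_def prod_power_distrib)
  show False
  proof (cases "\<exists>j\<in>{1..m}. poly M (\<alpha> j) = 0")
    case False
    then have "degree M = 0" using dvd_prod_linear_power_imp_degree_0[OF _ dP] by blast
    then obtain c where c: "M = [:c:]" by (rule degree_eq_zeroE)
    then have "c \<noteq> 0" using M(1) by auto
    then have "\<phi> G = 0" for G using M(2)[of "smult (inverse c) G"] c by simp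
    then show False using \<phi>_nonzero by blast
  next
    case True
    then obtain j where j: "j \<in> {1..m}" "poly M (\<alpha> j) = 0" by blast
    define a where "a = \<alpha> j"
    obtain M1 where M1: "M = [:- a, 1:] * M1"
      using j(2) unfolding poly_eq_0_iff_dvd a_def by (auto elim: dvdE)
    define P1 where "P1 = (\<Prod>i\<in>{1..m}-{j}. [:- \<alpha> i, 1:])"
    have P1: "P = [:- a, 1:] * P1" unfolding P_def P1_def a_def using j(1) by (simp add: prod.remove)
    define X2 :: "'k poly" where "X2 = [:0, 1:] * [:0, 1:]"
    have pX: "pCons 0 S = [:0, 1:] * S" for S :: "'k poly" by simp
    \<comment> \<open>The product M P1 G is divisible by P, so \<psi> kills it; modulo multiples of
      M, the polynomial in the differential relation for it is x^2 M' P1 G.\<close>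
    have "\<phi> (X2 * pderiv M * P1 * G) = 0" for G
    proof -
      have "\<psi> (M * (P1 * G)) = \<psi> (P * (M1 * G))"
        by (rule arg_cong[of _ _ \<psi>]) (simp add: M1 P1 mult_ac del: mult_pCons_left mult_pCons_right)
      also have "\<dots> = 0" by (auto simp: \<psi>_def poly_P)
      finally have z: "\<phi> (pCons 0 (pderiv (pCons 0 (M * (P1 * G)))) - M * (P1 * G)) = 0"
        by (simp only: \<phi>_differential)
      have "x * pderiv (x * (M * C)) - M * C = x * x * pderiv M * C + M * (x * C + x * x * pderiv C - C)"
        if "pderiv x = 1" for x C :: "'k poly"
        unfolding pderiv_mult that by (simp add: algebra_simps)
      from this[of "[:0, 1:]" "P1 * G"]
      have "pCons 0 (pderiv (pCons 0 (M * (P1 * G)))) - M * (P1 * G)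
        = X2 * pderiv M * P1 * G + M * ([:0, 1:] * (P1 * G) + X2 * pderiv (P1 * G) - P1 * G)"
        unfolding pX[of "pderiv _"] pX[of "_ * _"] X2_def by (simp only: pderiv_pCons mult.assoc) simp
      then show ?thesis using z by (simp only: \<phi>_add M(2)) simp
    qed
    then have d: "M dvd X2 * pderiv M * P1" by (rule dvd)
    have degM: "degree M > 0" using M1 M(1) degree_mult_eq[of "[:- a, 1:]" M1] by (cases "M1 = 0") auto
    then have "pderiv M \<noteq> 0" by (simp add: pderiv_eq_0_iff)
    moreover have "P1 \<noteq> 0" by (simp add: P1_def)
    ultimately have nz: "X2 * pderiv M * P1 \<noteq> 0" by (simp add: X2_def)
    \<comment> \<open>Neither x^2 nor P1 vanishes at \<open>a\<close>, while M' vanishes there to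
      one order less than M, so M cannot divide their product.\<close>
    have "a \<noteq> 0" using \<alpha>_nz j by (simp add: a_def)
    then have "order a X2 = 0" by (intro order_0I) (simp add: X2_def)
    moreover have "order a P1 = 0"
      using j(1) by (intro order_0I) (auto simp: P1_def a_def poly_prod dest: inj_onD[OF \<alpha>_inj])
    moreover have "order a M \<noteq> 0" using M(1) j(2) by (simp add: order_root a_def)
    then have "order a M = Suc (order a (pderiv M))"
      using order_pderiv[of M a] M(1) j(2) \<open>pderiv M \<noteq> 0\<close> unfolding a_def by blast
    moreover have "order a M \<le> order a (X2 * pderiv M * P1)" by (rule dvd_imp_order_le[OF nz d])
    moreover have "X2 * pderiv M \<noteq> 0" using nz by auto
    then have "order a (X2 * pderiv M * P1) = order a X2 + order a (pderiv M) + order a P1"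
      using order_mult[OF nz, of a] order_mult[of X2 "pderiv M" a] by simp
    ultimately show False by linarith
  qed
qed

section \<open>Integrality and local bounds of the approximations\<close>

definition W :: "nat \<Rightarrow> 'k poly \<Rightarrow> 'k" where
  "W N S = fact N * \<phi> S"

lemma W_eq: "degree S \<le> N \<Longrightarrow> W N S = (\<Sum>i\<le>N. coeff S i * (fact N / fact i) * w i)"
  by (simp add: W_def \<phi>_eq sum_distrib_left mult_ac)

lemma fact_quotient:
  assumes "i \<le> N"
  shows "(fact N / fact i :: 'k) = of_nat (fact N div fact i)"
proof -
  obtain k where k: "(fact N :: nat) = fact i * k" using fact_dvd[OF assms] by (auto elim: dvdE)
  then have "(fact N :: 'k) = fact i * of_nat k" by (metis of_nat_fact of_nat_mult)
  with k show ?thesis by simp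
qed

lemma W_in_subring:
  assumes R: "unital_subring R" and "degree S \<le> N" "\<And>i. coeff S i \<in> R"
    and "\<And>j. j \<in> {1..m} \<Longrightarrow> \<alpha> j \<in> R" "\<And>j. j \<in> {0..m} \<Longrightarrow> lam j \<in> R"
  shows "W N S \<in> R"
proof -
  have "(fact s :: 'k) \<in> R" for s using unital_subring_of_nat[OF R, of "fact s"] by simp
  then have "w i \<in> R" for i
    unfolding w_def
    by (intro unital_subring_add[OF R] unital_subring_sum[OF R] unital_subring_mult[OF R]
        unital_subring_power[OF R] assms) auto
  then show ?thesis
    unfolding W_eq[OF assms(2)]
    by (intro unital_subring_sum[OF R] unital_subring_mult[OF R] assms(3))
       (auto simp: fact_quotient unital_subring_of_nat[OF R])
qed

text \<open>Vanishing of the \<open>k\<close>-th derivative of \<open>x^k S\<close> at \<open>\<alpha> j\<close>.\<close>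

lemma sum_fact_quotient_eq_0:
  fixes a :: 'k
  assumes "[:- a, 1:] ^ l dvd S" "k < l" "degree S \<le> N"
  shows "(\<Sum>i\<le>N. coeff S i * (fact (i + k) / fact i) * a ^ i) = 0"
proof -
  \<comment> \<open>Each derivative lowers the order of vanishing at \<open>a\<close> by at most
    one; for n at least l the truncated exponent is 0 and the claim is trivial.\<close>
  have "[:- a, 1:] ^ (l - n) dvd (pderiv ^^ n) (monom 1 k * S)" for n
  proof (induction n)
    case (Suc n)
    show ?case
    proof (cases "l - n")
      case (Suc r)
      then obtain T where T: "(pderiv ^^ n) (monom 1 k * S) = [:- a, 1:] ^ Suc r * T"
        using Suc.IH by (auto elim: dvdE)
      define L where "L = [:- a, 1:]"
      have "L ^ r dvd L ^ Suc r * pderiv T" "L ^ r dvd T * (smult (of_nat (Suc r)) (L ^ r) * pderiv L)"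
        by (simp_all del: of_nat_Suc add: dvd_smult)
      then have "[:- a, 1:] ^ r dvd pderiv ([:- a, 1:] ^ Suc r * T)"
        unfolding pderiv_mult pderiv_power_Suc L_def by (rule dvd_add)
      moreover have "l - Suc n = r" using Suc by simp
      ultimately show ?thesis using T by simp
    qed simp
  qed (use assms in auto)
  from this[of k] have "[:- a, 1:] dvd (pderiv ^^ k) (monom 1 k * S)"
    using assms(2) by (metis dvd_power dvd_trans zero_less_diff)
  then have "poly ((pderiv ^^ k) (monom 1 k * S)) a = 0" by (simp add: poly_eq_0_iff_dvd)
  moreover define D where "D = (pderiv ^^ k) (monom 1 k * S)"
  have D: "coeff D i = coeff S i * (fact (i + k) / fact i)" for i
  proof -
    have "coeff D i = pochhammer (of_nat (Suc i)) k * coeff S i"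
      by (simp add: D_def coeff_higher_pderiv coeff_monom_mult)
    moreover have "pochhammer (of_nat (Suc i)) k = (fact (i + k) / fact i :: 'k)"
    proof -
      have "(fact (i + k) :: 'k) = fact i * pochhammer (of_nat (Suc i)) k"
        using pochhammer_product[of i "i + k" "1::'k"] unfolding pochhammer_fact by simp
      then show ?thesis by simp
    qed
    ultimately show ?thesis by simp
  qed
  have "degree D \<le> N" by (rule degree_le) (use assms(3) in \<open>auto simp: D coeff_eq_0\<close>)
  then have "poly D a = (\<Sum>i\<le>N. coeff D i * a ^ i)" by (rule poly_eq_sum_atMost)
  ultimately show ?thesis unfolding D by (simp only: D_def)
qed

lemma w_diff: "i \<le> T \<Longrightarrow> w T = w i + (\<Sum>j=1..m. lam j * (\<Sum>k<T - i. fact (i + k) * \<alpha> j ^ (i + k)))"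
proof -
  assume "i \<le> T"
  have "(\<Sum>s<i + d. f s) = (\<Sum>s<i. f s) + (\<Sum>k<d. f (i + k))" for f :: "nat \<Rightarrow> 'k" and d
    by (induction d) (simp_all add: add.assoc)
  from this[of _ "T - i"] \<open>i \<le> T\<close>
  have "(\<Sum>s<T. f s) = (\<Sum>s<i. f s) + (\<Sum>k<T - i. f (i + k))" for f :: "nat \<Rightarrow> 'k"
    by simp
  then show ?thesis by (simp add: w_def distrib_left sum.distrib)
qed

text \<open>Each \<open>w i\<close> is replaced by a late term \<open>w T\<close>, negligible at v,
  minus a tail. Regrouped by the shift k, and with N! taken out, the tail has as coefficient of
  \<open>\<alpha> j ^ k\<close> a sum that vanishes for k < l and is divisible by k!, hence by l!,
  for larger k.\<close>

theorem nonarchimedean_bound: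
  assumes "nonarchimedean_place v p"
    and dvd: "\<And>j. j \<in> {1..m} \<Longrightarrow> [:- \<alpha> j, 1:] ^ l dvd S"
    and deg: "degree S \<le> N" and coeff: "\<And>i. v (coeff S i) \<le> 1"
    and lam: "\<And>j. j \<in> {0..m} \<Longrightarrow> v (lam j) \<le> 1"
    and \<alpha>: "\<And>j. j \<in> {1..m} \<Longrightarrow> v (\<alpha> j) \<le> M" and M: "0 < M" "M \<le> 1"
    and lim: "(\<lambda>i. v (w i)) \<longlonglongrightarrow> 0"
  shows "v (W N S) \<le> v (fact N) * v (fact l) * M ^ l"
proof -
  interpret nonarchimedean_place v p by fact
  define B where "B = v (fact N) * v (fact l) * M ^ l"
  have Bpos: "B > 0" using M by (simp add: B_def)
  then have "\<forall>\<^sub>F T in sequentially. v (w T) < B \<and> T \<ge> N + l"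
    using order_tendstoD(2)[OF lim] eventually_ge_at_top by (auto intro: eventually_conj)
  \<comment> \<open>For i at most N and k < l, the choice T \<ge> N + l makes the truncation i + k <
    T vacuous, so that the vanishing lemma applies to the full sum.\<close>
  then obtain T where T: "v (w T) < B" "T \<ge> N + l"
    using eventually_happens by fastforce
  define t where "t j k = (\<Sum>i\<le>N. if i + k < T then coeff S i * (fact (i + k) / fact i) * \<alpha> j ^ i else 0)"
    for j k
  have t: "v (fact N * (t j k * \<alpha> j ^ k)) \<le> B" if j: "j \<in> {1..m}" for j k
  proof (cases "k < l")
    case True
    have "t j k = (\<Sum>i\<le>N. coeff S i * (fact (i + k) / fact i) * \<alpha> j ^ i)"
      unfolding t_def using True T(2) by (intro sum.cong) auto
    also have "\<dots> = 0" by (rule sum_fact_quotient_eq_0[OF dvd[OF j] True deg])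
    finally show ?thesis using Bpos by simp
  next
    case False
    have aj: "v (\<alpha> j) \<le> 1" using \<alpha>[OF j] M by simp
    have "v (t j k) \<le> v (fact l)"
      unfolding t_def
    proof (rule sum_le_bound)
      fix i
      \<comment> \<open>This is k! times a binomial coefficient.\<close>
      have "(fact (i + k) / fact i :: 'k) = of_nat (fact (i + k) div (fact k * fact i)) * fact k"
      proof -
        have "(fact k * fact i :: nat) dvd fact (i + k)" using fact_fact_dvd_fact[of k i]
            by (simp add: add.commute)
        then obtain c where c: "(fact (i + k) :: nat) = fact k * fact i * c" by (auto elim: dvdE)
        then have "(fact (i + k) :: 'k) = fact k * fact i * of_nat c" by (metis of_nat_fact of_nat_mult)
        with c show ?thesis by simp
      qed
      then have "v (fact (i + k) / fact i) \<le> v (fact k)"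
        by (simp only: mult) (intro mult_left_le_one_le, simp_all)
      also have "\<dots> \<le> v (fact l)" using False by (intro v_fact_antimono) simp
      finally have f: "v (fact (i + k) / fact i) \<le> v (fact l)" .
      have "v (coeff S i) * v (fact (i + k) / fact i) * v (\<alpha> j ^ i) \<le> 1 * v (fact l) * 1"
        using coeff f aj by (intro mult_mono) (auto simp: power power_le_one)
      then show "v (if i + k < T then coeff S i * (fact (i + k) / fact i) * \<alpha> j ^ i else 0) \<le> v (fact l)"
        by (cases "i + k < T") (simp_all only: if_True if_False mult zero nonneg mult_1 mult_1_right)
    qed simp
    moreover have "v (\<alpha> j ^ k) \<le> M ^ l"
    proof -
      have "v (\<alpha> j) ^ k \<le> v (\<alpha> j) ^ l" using aj False by (intro power_decreasing) auto
      also have "\<dots> \<le> M ^ l" using \<alpha>[OF j] by (intro power_mono) auto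
      finally show ?thesis by (simp add: power)
    qed
    ultimately have "v (fact N) * (v (t j k) * v (\<alpha> j ^ k)) \<le> v (fact N) * (v (fact l) * M ^ l)"
      by (intro mult_left_mono mult_mono) auto
    then show ?thesis by (simp add: B_def mult mult.assoc)
  qed
  define q where "q i = (fact N / fact i :: 'k)" for i
  have "W N S = (\<Sum>i\<le>N. coeff S i * q i * (w T - (\<Sum>j=1..m. lam j * (\<Sum>k<T - i. fact (i + k) * \<alpha> j ^ (i + k)))))"
    unfolding W_eq[OF deg] q_def
  proof (intro sum.cong refl)
    fix i assume "i \<in> {..N}"
    then have "i \<le> T" using T(2) by simp
    then have wi: "w i = w T - (\<Sum>j=1..m. lam j * (\<Sum>k<T - i. fact (i + k) * \<alpha> j ^ (i + k)))"
      by (simp add: w_diff[of i T])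
    show "coeff S i * (fact N / fact i) * w i = coeff S i * (fact N / fact i) *
        (w T - (\<Sum>j=1..m. lam j * (\<Sum>k<T - i. fact (i + k) * \<alpha> j ^ (i + k))))"
      unfolding wi ..
  qed
  also have "\<dots> = w T * (\<Sum>i\<le>N. coeff S i * q i)
      - (\<Sum>i\<le>N. \<Sum>j=1..m. coeff S i * q i * (lam j * (\<Sum>k<T - i. fact (i + k) * \<alpha> j ^ (i + k))))"
    by (simp add: right_diff_distrib sum_subtractf sum_distrib_left mult_ac)
  also have "(\<Sum>i\<le>N. \<Sum>j=1..m. coeff S i * q i * (lam j * (\<Sum>k<T - i. fact (i + k) * \<alpha> j ^ (i + k))))
      = (\<Sum>j=1..m. \<Sum>i\<le>N. \<Sum>k<T. lam j * (fact N * ((if i + k < T then coeff S i * (fact (i + k) / fact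
          i) * \<alpha> j ^ i else 0) * \<alpha> j ^ k)))"
  proof (subst sum.swap, intro sum.cong refl)
    fix j i
    have "(\<Sum>k<T - i. f (i + k)) = (\<Sum>k<T. if i + k < T then f (i + k) else 0)" for f :: "nat \<Rightarrow> 'k"
      by (intro sum.mono_neutral_cong_left) auto
    from this[of "\<lambda>n. fact n * \<alpha> j ^ n"]
    show "coeff S i * q i * (lam j * (\<Sum>k<T - i. fact (i + k) * \<alpha> j ^ (i + k)))
      = (\<Sum>k<T. lam j * (fact N * ((if i + k < T then coeff S i * (fact (i + k) / fact i) * \<alpha> j ^ i
          else 0) * \<alpha> j ^ k)))"
      by (simp add: sum_distrib_left q_def power_add if_distrib[of "\<lambda>x. _ * x"] if_distrib[of
          "\<lambda>x. x * _"] mult_ac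
          cong: if_cong)
  qed
  also have "\<dots> = (\<Sum>j=1..m. \<Sum>k<T. lam j * (fact N * (t j k * \<alpha> j ^ k)))"
    by (subst sum.swap) (simp add: t_def sum_distrib_left sum_distrib_right)
  finally have W: "W N S = w T * (\<Sum>i\<le>N. coeff S i * q i)
     - (\<Sum>j=1..m. \<Sum>k<T. lam j * (fact N * (t j k * \<alpha> j ^ k)))" .
  have "v (\<Sum>i\<le>N. coeff S i * q i) \<le> 1"
  proof (rule sum_le_bound)
    fix i assume "i \<in> {..N}"
    then show "v (coeff S i * q i) \<le> 1"
      using coeff by (auto simp: q_def fact_quotient mult intro: mult_le_one)
  qed simp
  then have "v (w T * (\<Sum>i\<le>N. coeff S i * q i)) \<le> B * 1"
    unfolding mult using T(1) Bpos by (intro mult_mono) auto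
  moreover have "v (- (\<Sum>j=1..m. \<Sum>k<T. lam j * (fact N * (t j k * \<alpha> j ^ k)))) \<le> B"
    unfolding minus
  proof (intro sum_le_bound)
    fix j k assume j: "j \<in> {1..m}"
    have "v (lam j) * v (fact N * (t j k * \<alpha> j ^ k)) \<le> 1 * B"
      using t[OF j] lam[of j] j by (intro mult_mono) auto
    then show "v (lam j * (fact N * (t j k * \<alpha> j ^ k))) \<le> B" by (simp add: mult)
  qed (use Bpos in auto)
  ultimately have "v (W N S) \<le> B"
    unfolding W diff_conv_add_uminus by (intro add_le) auto
  then show ?thesis by (simp add: B_def)
qed

text \<open>Coefficient by coefficient, S is majorised by x^\<mu> times the l-th power of the
  product of all x + |\<sigma>(\<alpha> j)|, and \<open>w i\<close> is at most a constant times i!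
  M^i. The factorials i! cancel, which leaves N! times the majorant at M.\<close>

theorem archimedean_bound:
  assumes "embedded_field \<sigma>" and M: "M \<ge> 1" "\<And>j. j \<in> {1..m} \<Longrightarrow> cmod (\<sigma> (\<alpha> j)) \<le> M"
    and S: "S = monom 1 \<mu> * P ^ l" and N: "N = m * l + \<mu>"
  shows "cmod (\<sigma> (W N S)) \<le> (\<Sum>j=0..m. cmod (\<sigma> (lam j))) * fact N * M ^ \<mu> *
    (\<Prod>j=1..m. cmod (\<sigma> (\<alpha> j)) + M) ^ l"
proof -
  interpret embedded_field \<sigma> by fact
  have deg: "degree S \<le> N"
    unfolding S N by (rule degree_monom_mult_P_power)
  define C where "C = (\<Sum>j=0..m. cmod (\<sigma> (lam j)))"
  have w: "cmod (\<sigma> (w i)) \<le> C * (fact i * M ^ i)" for i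
  proof -
    \<comment> \<open>There are i terms, each at most (i - 1)! M^i because M \<ge> 1.\<close>
    have M1: "(\<Sum>s<i. fact s * M ^ s) \<le> fact i * M ^ i" if "i > 0"
    proof -
      have "(\<Sum>s<i. fact s * M ^ s) \<le> (\<Sum>s<i. fact (i - 1) * M ^ i)"
        using M(1) by (intro sum_mono mult_mono fact_mono power_increasing) auto
      also have "\<dots> = fact i * M ^ i" using that by (simp add: fact_reduce[of i])
      finally show ?thesis .
    qed
    have M1: "(\<Sum>s<i. fact s * M ^ s) \<le> fact i * M ^ i" using M1 by (cases "i > 0") auto
    have one: "1 \<le> fact i * M ^ i"
      using mult_mono[of 1 "fact i" 1 "M ^ i"] M(1) by (simp add: one_le_power)
    have part: "cmod (\<sigma> (\<Sum>s<i. fact s * \<alpha> j ^ s)) \<le> fact i * M ^ i" if "j \<in> {1..m}" for j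
    proof -
      have "cmod (\<sigma> (\<Sum>s<i. fact s * \<alpha> j ^ s)) \<le> (\<Sum>s<i. fact s * cmod (\<sigma> (\<alpha> j)) ^ s)"
        unfolding hom_sum by (rule order.trans[OF norm_sum]) (simp add: hom_mult hom_fact hom_power
            norm_mult norm_power)
      also have "\<dots> \<le> (\<Sum>s<i. fact s * M ^ s)"
        using M(2)[OF that] by (intro sum_mono mult_left_mono power_mono) auto
      finally show ?thesis using M1 by simp
    qed
    have "cmod (\<sigma> (w i)) \<le> cmod (\<sigma> (lam 0)) + (\<Sum>j=1..m. cmod (\<sigma> (lam j)) * cmod (\<sigma> (\<Sum>s<i. fact s * \<alpha> j ^ s)))"
      unfolding w_def hom_add
      by (rule order.trans[OF norm_triangle_ineq])
         (simp add: hom_sum[of _ "{Suc 0..m}"] hom_mult norm_mult[symmetric] norm_sum)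
    also have "\<dots> \<le> cmod (\<sigma> (lam 0)) * (fact i * M ^ i) + (\<Sum>j=1..m. cmod (\<sigma> (lam j)) * (fact i * M ^ i))"
      using part one by (intro add_mono sum_mono mult_left_mono) (auto intro: mult_left_le[of 1] simp:
          mult_le_cancel_left1)
    also have "\<dots> = C * (fact i * M ^ i)"
      unfolding C_def by (simp add: sum.atLeast_Suc_atMost[of 0 m] distrib_right sum_distrib_right)
    finally show ?thesis .
  qed
  define dom where "dom p q \<longleftrightarrow> (\<forall>i. cmod (\<sigma> (coeff p i)) \<le> coeff q i)" for p :: "'k poly" and q :: "real poly"
  have dom_mult: "dom (p * p') (q * q')" if "dom p q" "dom p' q'" for p p' q q'
    unfolding dom_def
  proof
    fix i
    have "cmod (\<sigma> (coeff (p * p') i)) \<le> (\<Sum>k\<le>i. cmod (\<sigma> (coeff p k)) * cmod (\<sigma> (coeff p' (i - k))))"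
      unfolding coeff_mult hom_sum by (rule order.trans[OF norm_sum]) (simp add: hom_mult norm_mult)
    also have "\<dots> \<le> (\<Sum>k\<le>i. coeff q k * coeff q' (i - k))"
    proof (intro sum_mono mult_mono)
      show "0 \<le> coeff q k" for k using that(1) unfolding dom_def by (meson norm_ge_zero order.trans)
    qed (use that in \<open>auto simp: dom_def\<close>)
    finally show "cmod (\<sigma> (coeff (p * p') i)) \<le> coeff (q * q') i" by (simp add: coeff_mult)
  qed
  have dom_1: "dom 1 1" by (simp add: dom_def)
  have dom_prod: "dom (\<Prod>j\<in>J. [:- \<alpha> j, 1:]) (\<Prod>j\<in>J. [:cmod (\<sigma> (\<alpha> j)), 1:])" if "finite J" for J
    using that
  proof (induction J)
    case (insert j J)
    have "dom [:- \<alpha> j, 1:] [:cmod (\<sigma> (\<alpha> j)), 1:]"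
      by (auto simp: dom_def coeff_pCons hom_minus split: nat.split)
    from dom_mult[OF this insert.IH] show ?case unfolding prod.insert[OF insert.hyps] .
  qed (simp add: dom_1)
  have dom_power: "dom (p ^ n) (q ^ n)" if "dom p q" for p q n
    by (induction n) (auto intro: dom_mult dom_1 that)
  define Q where "Q = monom 1 \<mu> * (\<Prod>j=1..m. [:cmod (\<sigma> (\<alpha> j)), 1:]) ^ l"
  have "dom S Q"
    unfolding S Q_def P_def by (intro dom_mult dom_power dom_prod) (auto simp: dom_def)
  then have SQ: "cmod (\<sigma> (coeff S i)) \<le> coeff Q i" for i by (simp add: dom_def)
  have degQ: "degree Q \<le> N"
  proof -
    have nz: "(\<Prod>j=1..m. [:cmod (\<sigma> (\<alpha> j)), 1:]) \<noteq> 0" by simp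
    have "degree (\<Prod>j=1..m. [:cmod (\<sigma> (\<alpha> j)), 1:]) = m" by (subst degree_prod_eq_sum_degree) auto
    then show ?thesis
      unfolding Q_def N
      by (intro order.trans[OF degree_mult_le]) (simp add: degree_monom_eq degree_power_eq nz mult.commute)
  qed
  have "cmod (\<sigma> (W N S)) \<le> (\<Sum>i\<le>N. cmod (\<sigma> (coeff S i)) * (fact N / fact i) * cmod (\<sigma> (w i)))"
    unfolding W_eq[OF deg] hom_sum
    by (rule order.trans[OF norm_sum]) (simp add: hom_mult hom_divide hom_fact norm_mult norm_divide)
  also have "\<dots> \<le> (\<Sum>i\<le>N. coeff Q i * (fact N / fact i) * (C * (fact i * M ^ i)))"
    using SQ w by (intro sum_mono mult_mono mult_nonneg_nonneg order.trans[OF norm_ge_zero SQ]) auto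
  also have "\<dots> = (\<Sum>i\<le>N. C * fact N * (coeff Q i * M ^ i))"
    by (intro sum.cong) auto
  also have "\<dots> = C * fact N * poly Q M"
    unfolding poly_eq_sum_atMost[OF degQ] by (simp add: sum_distrib_left)
  also have "poly Q M = M ^ \<mu> * (\<Prod>j=1..m. cmod (\<sigma> (\<alpha> j)) + M) ^ l"
    by (simp add: Q_def poly_monom poly_power poly_prod)
  finally show ?thesis by (simp add: C_def mult.assoc)
qed

end

section \<open>Primitive elements\<close>

definition rat_subalgebra :: "'k::field_char_0 set \<Rightarrow> bool" where
  "rat_subalgebra R \<longleftrightarrow> unital_subring R \<and> range of_rat \<subseteq> R"

text \<open>The ring Q[x]; for algebraic elements it is a field, by
  \<open>inverse_in_subalgebra\<close>.\<close>

definition adjoin :: "'k::field_char_0 \<Rightarrow> 'k set" where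
  "adjoin x = \<Inter>{R. rat_subalgebra R \<and> x \<in> R}"

lemma rat_subalgebra_adjoin: "rat_subalgebra (adjoin x)"
  unfolding rat_subalgebra_def unital_subring_def adjoin_def by (auto simp: subset_iff)

lemma adjoin_self: "x \<in> adjoin x"
  by (simp add: adjoin_def)

lemma adjoin_minimal: "rat_subalgebra R \<Longrightarrow> x \<in> R \<Longrightarrow> adjoin x \<subseteq> R"
  by (auto simp: adjoin_def)

lemma rat_subalgebra_of_rat: "rat_subalgebra R \<Longrightarrow> of_rat q \<in> R"
  by (auto simp: rat_subalgebra_def)

text \<open>Polymorphic in the target, so that one rational polynomial can be evaluated both in the
  number field and in the complex numbers.\<close>

definition ev :: "rat poly \<Rightarrow> 'a::field_char_0 \<Rightarrow> 'a" where
  "ev p x = poly (map_poly of_rat p) x"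

lemma ev_0 [simp]: "ev 0 x = 0"
  by (simp add: ev_def)

lemma ev_pCons [simp]: "ev (pCons a p) x = of_rat a + x * ev p x"
  by (simp add: ev_def map_poly_pCons)

lemma ev_1 [simp]: "ev 1 x = 1"
  by (simp add: one_pCons)

lemma ev_add: "ev (p + q) x = ev p x + ev q x"
  by (induction p q rule: poly_induct2) (simp_all add: of_rat_add algebra_simps)

lemma ev_smult: "ev (smult c p) x = of_rat c * ev p x"
  by (induction p) (simp_all add: of_rat_mult algebra_simps)

lemma ev_mult: "ev (p * q) x = ev p x * ev q x"
  by (induction p) (simp_all add: ev_add ev_smult algebra_simps)

lemma ev_diff: "ev (p - q) x = ev p x - ev q x"
  using ev_add[of p "smult (-1) q" x] ev_smult[of "-1" q x] by (simp add: of_rat_minus)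

lemma ev_monom: "ev (monom c n) x = of_rat c * x ^ n"
  by (simp add: ev_def map_poly_monom poly_monom)

lemma ev_sum: "ev (\<Sum>i\<in>A. f i) x = (\<Sum>i\<in>A. ev (f i) x)"
  by (induction A rule: infinite_finite_induct) (simp_all add: ev_add)

lemma ev_altdef: "degree p \<le> n \<Longrightarrow> ev p x = (\<Sum>i\<le>n. of_rat (coeff p i) * x ^ i)"
  unfolding ev_def by (subst poly_eq_sum_atMost[of _ n]) (simp_all add: coeff_map_poly degree_map_poly)

lemma ev_in_subalgebra:
  assumes "rat_subalgebra R" "x \<in> R" shows "ev p x \<in> R"
  using assms by (induction p)
    (auto simp: rat_subalgebra_of_rat intro!: unital_subring_add unital_subring_mult unital_subring_0
      simp: rat_subalgebra_def)

lemma (in embedded_field) hom_ev: "\<sigma> (ev p x) = ev p (\<sigma> x)"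
  by (induction p) (simp_all add: hom_add hom_mult hom_of_rat)

text \<open>The minimal polynomial of x over the rationals, determined only up to a scalar.\<close>

definition minimal_relation :: "rat poly \<Rightarrow> 'a::field_char_0 \<Rightarrow> bool" where
  "minimal_relation p x \<longleftrightarrow> p \<noteq> 0 \<and> ev p x = 0 \<and> (\<forall>q. q \<noteq> 0 \<longrightarrow> ev q x = 0 \<longrightarrow> degree p \<le> degree q)"

lemma minimal_relation_exists:
  assumes "p \<noteq> 0" "ev p x = 0" obtains q where "minimal_relation q x"
  using ex_has_least_nat[of "\<lambda>q. q \<noteq> 0 \<and> ev q x = 0" p degree] assms
  unfolding minimal_relation_def by blast

lemma minimal_relation_dvd:
  assumes "minimal_relation p x" "ev q x = 0" shows "p dvd q"
proof (rule ccontr)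
  assume "\<not> p dvd q"
  then have nz: "q mod p \<noteq> 0" by (simp add: dvd_eq_mod_eq_0)
  have "ev (p * (q div p) + q mod p) x = 0" using assms(2) by simp
  then have "ev (q mod p) x = 0" using assms(1) by (simp only: ev_add ev_mult) (simp add:
      minimal_relation_def)
  then have "degree p \<le> degree (q mod p)" using assms(1) nz by (simp add: minimal_relation_def)
  then show False using degree_mod_less'[of p q] assms(1) nz by (simp add: minimal_relation_def)
qed

text \<open>The constant term of a minimal relation is nonzero, as otherwise a factor x could be
  removed; solving the relation for it expresses the inverse as a polynomial in x.\<close>

lemma inverse_in_subalgebra:
  assumes R: "rat_subalgebra R" "x \<in> R" and p: "p \<noteq> 0" "ev p x = 0"
  shows "inverse x \<in> R"
proof (cases "x = 0")
  case False
  obtain q where q: "minimal_relation q x" using minimal_relation_exists[OF p] .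
  obtain a r where qr: "q = pCons a r" by (cases q)
  have "a \<noteq> 0"
  proof
    assume "a = 0"
    then have "r \<noteq> 0" "ev r x = 0" using q qr False by (auto simp: minimal_relation_def)
    then have "degree q \<le> degree r" using q by (simp add: minimal_relation_def)
    then show False using qr \<open>r \<noteq> 0\<close> by simp
  qed
  have "of_rat a + x * ev r x = 0" using q qr by (simp add: minimal_relation_def)
  then have xr: "x * ev r x = of_rat (- a)" by (simp add: of_rat_minus eq_neg_iff_add_eq_0 add.commute)
  have "x * (of_rat (- inverse a) * ev r x) = of_rat (- inverse a) * (x * ev r x)"
    by (simp only: mult.left_commute)
  also have "\<dots> = of_rat (- inverse a * - a)" unfolding xr of_rat_mult ..
  finally have "x * (of_rat (- inverse a) * ev r x) = 1" using \<open>a \<noteq> 0\<close> by simp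
  then have "inverse x = of_rat (- inverse a) * ev r x" by (rule inverse_unique)
  also have "\<dots> \<in> R"
    using R ev_in_subalgebra[OF R] rat_subalgebra_of_rat[OF R(1)]
        by (auto simp: rat_subalgebra_def intro: unital_subring_mult)
  finally show ?thesis .
qed (use R in \<open>auto simp: rat_subalgebra_def intro: unital_subring_0\<close>)

text \<open>Division by q with all coefficients kept in the set \<open>L\<close>, one leading term
  at a time; as q is monic, no inverses are introduced.\<close>

lemma dvd_of_minimal_over_subfield:
  fixes L :: "'k::field set" and b :: 'k
  assumes L: "unital_subring L"
    and q: "\<And>i. coeff q i \<in> L" "lead_coeff q = 1" "poly q b = 0"
    and min: "\<And>r. r \<noteq> 0 \<Longrightarrow> (\<And>i. coeff r i \<in> L) \<Longrightarrow> poly r b = 0 \<Longrightarrow> degree q \<le> degree r"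
    and A: "\<And>i. coeff A i \<in> L" "poly A b = 0"
  shows "q dvd A"
  using A
proof (induction "degree A" arbitrary: A rule: less_induct)
  case less
  show ?case
  proof (cases "A = 0")
    case False
    then have le: "degree q \<le> degree A" using min less.prems by blast
    define A' where "A' = A - monom (lead_coeff A) (degree A - degree q) * q"
    have L': "coeff A' i \<in> L" for i
      unfolding A'_def coeff_diff
      by (intro unital_subring_diff[OF L] unital_subring_coeff_mult[OF L])
         (use less.prems q L in \<open>auto intro: unital_subring_0\<close>)
    have z: "poly A' b = 0" using less.prems q by (simp add: A'_def)
    have "q dvd A'"
    proof (cases "A' = 0")
      case False
      have "q \<noteq> 0" using q(2) by auto
      have dm: "degree (monom (lead_coeff A) (degree A - degree q) * q) = degree A"
        using \<open>A \<noteq> 0\<close> \<open>q \<noteq> 0\<close> le by (subst degree_mult_eq) (auto simp: degree_monom_eq)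
      have "coeff A' (degree A) = 0"
        using le q(2) by (simp add: A'_def coeff_monom_mult)
      moreover have "degree A' \<le> degree A"
        unfolding A'_def by (rule degree_diff_le) (simp_all add: dm)
      ultimately have "degree A' < degree A"
        using False by (metis le_neq_implies_less leading_coeff_0_iff)
      then show ?thesis using less.hyps L' z by blast
    qed simp
    then have "q dvd A' + monom (lead_coeff A) (degree A - degree q) * q" by simp
    then show ?thesis by (simp add: A'_def)
  qed simp
qed

section \<open>Two elements lie in a simple extension\<close>

lemma of_int_to_ac_of_rat: "to_ac (of_rat r) = of_rat r"
  by (cases r) (simp add: of_rat_rat)

lemma map_poly_to_ac_mult: "map_poly to_ac (p * q) = map_poly to_ac p * map_poly to_ac q"
  by (intro poly_eqI) (simp add: coeff_map_poly coeff_mult to_ac_sum)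

lemma map_poly_to_ac_dvd: "p dvd q \<Longrightarrow> map_poly to_ac p dvd map_poly to_ac q"
  by (auto elim!: dvdE simp: map_poly_to_ac_mult)

lemma poly_map_poly_to_ac: "poly (map_poly to_ac p) (to_ac x) = to_ac (poly p x)"
  by (induction p) (simp_all add: map_poly_pCons)

lemma map_poly_to_ac_of_rat: "map_poly to_ac (map_poly of_rat p) = map_poly of_rat p"
  by (intro poly_eqI) (simp add: coeff_map_poly of_int_to_ac_of_rat)

text \<open>The minimal polynomial of \<open>b\<close> over \<open>\<rat>(\<theta> + c b)\<close> divides those of \<open>b\<close> over \<open>\<rat>\<close> and
  \<open>f(\<theta> + c b - c x)\<close>, whose only common root is \<open>b\<close> for a suitable \<open>c\<close>.\<close>

lemma adjoin_two:
  fixes \<theta> b :: "'k::field_char_0"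
  assumes algebraic: "\<And>x::'k. \<exists>p. p \<noteq> 0 \<and> ev p x = 0"
  obtains \<gamma> where "\<theta> \<in> adjoin \<gamma>" "b \<in> adjoin \<gamma>"
proof -
  obtain f where f: "f \<noteq> 0" "ev f \<theta> = 0" using algebraic by blast
  obtain g where g: "minimal_relation g b" using minimal_relation_exists algebraic by metis
  define fa where "fa = (map_poly of_rat f :: 'k alg_closure poly)"
  define ga where "ga = (map_poly of_rat g :: 'k alg_closure poly)"
  have nz: "fa \<noteq> 0" "ga \<noteq> 0" using f g by (simp_all add: fa_def ga_def minimal_relation_def map_poly_eq_0_iff)
  \<comment> \<open>If t is a root of g other than b and \<theta> + c (b - t) is a root of f, then c
    lies in this finite set, which some natural number avoids.\<close>
  define bad where "bad = (\<lambda>(s, t). (s - to_ac \<theta>) / (to_ac b - t)) ` ({s. poly fa s =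
      0} \<times> {t. poly ga t = 0})"
  have "finite bad" unfolding bad_def using nz by (intro finite_imageI finite_cartesian_product
      poly_roots_finite)
  moreover have "infinite (range (of_nat :: nat \<Rightarrow> 'k alg_closure))"
    by (rule range_inj_infinite) (simp add: inj_on_def)
  ultimately obtain c :: nat where c: "of_nat c \<notin> bad" by (metis finite_subset image_subset_iff)
  define \<gamma> where "\<gamma> = \<theta> + of_nat c * b"
  define L where "L = adjoin \<gamma>"
  have L: "rat_subalgebra L" "unital_subring L"
    using rat_subalgebra_adjoin[of \<gamma>] by (simp_all add: L_def rat_subalgebra_def)
  have inv: "inverse x \<in> L" if "x \<in> L" for x using inverse_in_subalgebra[OF L(1) that] algebraic by blast
  have \<gamma>L: "\<gamma> \<in> L" by (simp add: L_def adjoin_self)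
  define G where "G = (map_poly of_rat g :: 'k poly)"
  define H where "H = pcompose (map_poly of_rat f) [:\<gamma>, - of_nat c:]"
  have GL: "coeff G i \<in> L" for i by (simp add: G_def coeff_map_poly rat_subalgebra_of_rat[OF L(1)])
  have HL: "coeff H i \<in> L" for i
  proof -
    have lin: "coeff [:\<gamma>, - of_nat c:] i \<in> L" for i
      using \<gamma>L L by (auto simp: coeff_pCons intro: unital_subring_minus unital_subring_of_nat
          unital_subring_0 split: nat.split)
    have "coeff (pcompose (map_poly of_rat p) [:\<gamma>, - of_nat c:]) i \<in> L" for p i
    proof (induction p arbitrary: i)
      case (pCons a p)
      have "coeff [:of_rat a:] i \<in> L" for i
        using L rat_subalgebra_of_rat by (auto simp: coeff_pCons intro: unital_subring_0 split: nat.split)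
      then show ?case
        using L(2) unital_subring_coeff_mult[OF L(2) lin pCons.IH]
        by (simp only: map_poly_pCons of_rat_0 pcompose_pCons coeff_add) (intro unital_subring_add)
    qed (simp add: unital_subring_0 L)
    then show ?thesis by (simp add: H_def)
  qed
  have "G \<noteq> 0 \<and> (\<forall>i. coeff G i \<in> L) \<and> poly G b = 0"
    using g GL by (auto simp: G_def minimal_relation_def ev_def map_poly_eq_0_iff)
  then obtain q0 where q0: "q0 \<noteq> 0" "\<And>i. coeff q0 i \<in> L" "poly q0 b = 0"
    and min0: "\<And>r. r \<noteq> 0 \<Longrightarrow> (\<forall>i. coeff r i \<in> L) \<Longrightarrow> poly r b = 0 \<Longrightarrow> degree q0 \<le> degree r"
    using ex_has_least_nat[of "\<lambda>q. q \<noteq> 0 \<and> (\<forall>i. coeff q i \<in> L) \<and> poly q b = 0" G degree] by blast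
  define q where "q = smult (inverse (lead_coeff q0)) q0"
  have q: "\<And>i. coeff q i \<in> L" "lead_coeff q = 1" "poly q b = 0" "degree q = degree q0"
    using q0 L inv by (auto simp: q_def intro: unital_subring_mult)
  have dvd: "q dvd A" if "\<And>i. coeff A i \<in> L" "poly A b = 0" for A
    by (rule dvd_of_minimal_over_subfield[OF L(2) q(1-3)]) (use min0 that q(4) in auto)
  have "poly G b = 0" using g by (simp add: G_def minimal_relation_def ev_def)
  then have "q dvd G" using dvd GL by blast
  from map_poly_to_ac_dvd[OF this] have dG: "map_poly to_ac q dvd ga"
    by (simp add: G_def ga_def map_poly_to_ac_of_rat)
  have "poly H b = 0" using f by (simp add: H_def poly_pcompose \<gamma>_def ev_def)
  then have "q dvd H" using dvd HL by blast
  then obtain K where K: "H = q * K" by (auto elim: dvdE)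
  \<comment> \<open>In the algebraic closure a root of q is a common root of G and H, and the choice
    of c leaves only b.\<close>
  have only: "t = to_ac b" if t: "poly (map_poly to_ac q) t = 0" for t
  proof (rule ccontr)
    assume ne: "t \<noteq> to_ac b"
    have "poly (map_poly to_ac H) t = 0" unfolding K map_poly_to_ac_mult using t by simp
    moreover have "map_poly to_ac H = pcompose fa [:to_ac \<gamma>, - of_nat c:]"
    proof -
      have "map_poly to_ac (pcompose (map_poly of_rat p) [:\<gamma>, - of_nat c:])
          = pcompose (map_poly of_rat p) [:to_ac \<gamma>, - of_nat c:]" for p
      proof (induction p)
        case (pCons a p)
        have add: "map_poly to_ac (u + v) = map_poly to_ac u + map_poly to_ac v" for u v :: "'k poly"
          by (intro poly_eqI) (simp add: coeff_map_poly)
        have lin: "map_poly to_ac [:\<gamma>, - of_nat c:] = [:to_ac \<gamma>, - of_nat c:]"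
          by (simp add: map_poly_pCons)
        have const: "map_poly to_ac [:of_rat a:] = [:of_rat a:]"
            by (simp add: map_poly_pCons of_int_to_ac_of_rat)
        then show ?case
          by (simp only: map_poly_pCons of_rat_0 pcompose_pCons add map_poly_to_ac_mult lin const pCons.IH)
      qed simp
      then show ?thesis by (simp add: H_def fa_def)
    qed
    ultimately have s: "poly fa (to_ac \<gamma> - of_nat c * t) = 0" by (simp add: poly_pcompose mult.commute)
    have t': "poly ga t = 0" using t dG by (auto elim!: dvdE)
    have "(to_ac \<gamma> - of_nat c * t - to_ac \<theta>) / (to_ac b - t) = of_nat c"
      using ne by (simp add: \<gamma>_def field_simps)
    then have "of_nat c \<in> bad" unfolding bad_def using s t' by force
    then show False using c by simp
  qed
  have "poly (map_poly to_ac q) (to_ac b) = 0" by (simp add: poly_map_poly_to_ac q)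
  then obtain r where r: "map_poly to_ac q = [:- to_ac b, 1:] * r" unfolding poly_eq_0_iff_dvd
      by (auto elim: dvdE)
  \<comment> \<open>A double root of q would be a double root of g, hence a root of g',
    contradicting that g is a relation of least degree. So q is linear and its constant term
    exhibits b as an element of \<open>L\<close>.\<close>
  have simple: "poly r (to_ac b) \<noteq> 0"
  proof
    assume "poly r (to_ac b) = 0"
    then obtain r' where "r = [:- to_ac b, 1:] * r'" unfolding poly_eq_0_iff_dvd by (auto elim: dvdE)
    with r dG obtain u where u: "ga = [:- to_ac b, 1:] * ([:- to_ac b, 1:] * u)"
      by (auto elim!: dvdE simp del: mult_pCons_left mult_pCons_right simp add: mult.assoc)
    have "poly (pderiv ga) (to_ac b) = 0" unfolding u pderiv_mult by (simp add: pderiv_pCons)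
    moreover have "pderiv ga = map_poly to_ac (map_poly of_rat (pderiv g))"
      unfolding map_poly_to_ac_of_rat ga_def
      by (intro poly_eqI) (simp add: coeff_pderiv coeff_map_poly of_rat_mult of_rat_add)
    ultimately have "ev (pderiv g) b = 0" by (simp add: poly_map_poly_to_ac ev_def)
    moreover have "degree g \<noteq> 0"
    proof
      assume "degree g = 0"
      then obtain a where "g = [:a:]" by (rule degree_eq_zeroE)
      then show False using g by (simp add: minimal_relation_def)
    qed
    then have "pderiv g \<noteq> 0" "degree (pderiv g) < degree g" by (simp_all add: pderiv_eq_0_iff degree_pderiv)
    ultimately show False using g unfolding minimal_relation_def by (meson not_le)
  qed
  have "degree r = 0"
  proof (rule ccontr)
    assume "degree r \<noteq> 0"
    then obtain t where t: "poly r t = 0" using alg_closed_imp_poly_has_root by blast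
    then have "t = to_ac b" by (intro only) (simp add: r)
    then show False using simple t by simp
  qed
  moreover have "r \<noteq> 0" using simple by auto
  ultimately have "degree (map_poly to_ac q) = 1" unfolding r by (subst degree_mult_eq) auto
  then have deg: "degree q = 1" by (simp add: degree_map_poly)
  then have "poly q b = coeff q 0 + coeff q 1 * b" by (simp add: poly_altdef)
  then have "b = - coeff q 0" using q(2,3) deg by (simp add: eq_neg_iff_add_eq_0 add.commute)
  then have bL: "b \<in> L" using q(1) L(2) unital_subring_minus by metis
  have "\<theta> = \<gamma> - of_nat c * b" by (simp add: \<gamma>_def)
  then have "\<theta> \<in> L"
    using \<gamma>L bL L(2) by (auto intro: unital_subring_diff unital_subring_mult unital_subring_of_nat)
  then show ?thesis using bL that L_def by blast
qed

text \<open>The monic relation rewrites the power d through lower ones, so multiplication by \<eta>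
  preserves the span. It is used over the rationals, over the integers and over subrings with
  bounded denominators.\<close>

lemma power_span_subring:
  fixes S :: "'a::comm_ring_1 set"
  assumes S: "unital_subring S" and pow: "\<eta> ^ d = (\<Sum>j<d. s j * \<eta> ^ j)"
    and s: "\<And>j. j < d \<Longrightarrow> s j \<in> S" and d: "d > 0"
  defines "R \<equiv> {\<Sum>j<d. c j * \<eta> ^ j | c. \<forall>j. c j \<in> S}"
  shows "unital_subring R" "S \<subseteq> R" "\<eta> \<in> R"
proof -
  have R_scale_diff: "q * x - y \<in> R" if xy: "x \<in> R" "y \<in> R" and q: "q \<in> S" for q x y
  proof -
    obtain c c' where c: "x = (\<Sum>j<d. c j * \<eta> ^ j)" "\<forall>j. c j \<in> S" "y = (\<Sum>j<d. c' j * \<eta> ^ j)" "\<forall>j. c' j \<in> S"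
      using xy by (auto simp: R_def)
    then have "q * x - y = (\<Sum>j<d. (q * c j - c' j) * \<eta> ^ j)"
      by (simp add: left_diff_distrib sum_subtractf sum_distrib_left mult.assoc)
    moreover have "\<forall>j. q * c j - c' j \<in> S"
      using c(2,4) q unital_subring_diff[OF S] unital_subring_mult[OF S] by blast
    ultimately show ?thesis unfolding R_def mem_Collect_eq by (intro exI conjI)
  qed
  have R0: "0 \<in> R" unfolding R_def using unital_subring_0[OF S] by (auto intro!: exI[of _ "\<lambda>_. 0"])
  have R_diff: "x - y \<in> R" if "x \<in> R" "y \<in> R" for x y
    using R_scale_diff[OF that unital_subring_1[OF S]] by simp
  have R_add: "x + y \<in> R" if "x \<in> R" "y \<in> R" for x y
    using R_diff[OF that(1) R_diff[OF R0 that(2)]] by simp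
  have R_scale: "q * x \<in> R" if "x \<in> R" "q \<in> S" for q x
    using R_scale_diff[OF that(1) R0 that(2)] by simp
  have R_sum: "(\<And>i. i \<in> A \<Longrightarrow> h i \<in> R) \<Longrightarrow> sum h A \<in> R" for h :: "nat \<Rightarrow> 'a" and A
    by (induction A rule: infinite_finite_induct) (simp_all add: R0 R_add)
  have R_pow_less: "\<eta> ^ j \<in> R" if "j < d" for j
  proof -
    have "(\<Sum>i<d. (if i = j then 1 else 0) * \<eta> ^ i) = (\<Sum>i<d. if i = j then \<eta> ^ i else 0)"
      by (intro sum.cong) auto
    then have "\<eta> ^ j = (\<Sum>i<d. (if i = j then 1 else 0) * \<eta> ^ i)" using that by simp
    moreover have "\<forall>i. (if i = j then 1 else 0) \<in> S" using unital_subring_0[OF S] unital_subring_1[OF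
        S] by simp
    ultimately show ?thesis unfolding R_def mem_Collect_eq by (intro exI conjI)
  qed
  have R_eta: "\<eta> * x \<in> R" if x: "x \<in> R" for x
  proof -
    obtain c where c: "x = (\<Sum>j<d. c j * \<eta> ^ j)" "\<forall>j. c j \<in> S" using x by (auto simp: R_def)
    have "\<eta> ^ Suc j \<in> R" if "j < d" for j
    proof (cases "Suc j = d")
      case True
      then have "\<eta> ^ Suc j = (\<Sum>j<d. s j * \<eta> ^ j)" using pow by simp
      then show ?thesis using s R_pow_less by (auto intro!: R_sum R_scale)
    qed (use that R_pow_less[of "Suc j"] in simp)
    then have "(\<Sum>j<d. c j * \<eta> ^ Suc j) \<in> R" using c(2) by (intro R_sum R_scale) auto
    then show ?thesis by (simp add: c sum_distrib_left mult_ac)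
  qed
  have R_pow: "\<eta> ^ n * x \<in> R" if x: "x \<in> R" for n x
    by (induction n) (use R_eta x in \<open>auto simp: mult.assoc\<close>)
  have one: "1 \<in> R" using R_pow_less[OF d] by simp
  have R_mult: "x * y \<in> R" if x: "x \<in> R" and y: "y \<in> R" for x y
  proof -
    obtain c where c: "x = (\<Sum>j<d. c j * \<eta> ^ j)" "\<forall>j. c j \<in> S" using x by (auto simp: R_def)
    have "(\<Sum>j<d. c j * (\<eta> ^ j * y)) \<in> R" using c(2) by (intro R_sum R_scale R_pow y) auto
    then show ?thesis by (simp add: c sum_distrib_right mult.assoc)
  qed
  show "unital_subring R" unfolding unital_subring_def using one R_diff R_mult by blast
  show "S \<subseteq> R" using R_scale[OF one] by auto
  show "\<eta> \<in> R" using R_eta[OF one] by simp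
qed

text \<open>An integral primitive element with its power basis; \<open>a\<close> holds the
  coefficients of its monic integral equation, solved for the leading power.\<close>

locale integral_generator =
  fixes \<theta> :: "'k::field_char_0" and \<kappa> :: nat and a :: "nat \<Rightarrow> int"
  assumes power_eq: "\<theta> ^ \<kappa> = (\<Sum>j<\<kappa>. of_int (a j) * \<theta> ^ j)"
    and span: "\<exists>c. x = (\<Sum>j<\<kappa>. of_rat (c j) * \<theta> ^ j)"
    and indep: "(\<Sum>j<\<kappa>. of_rat (c j) * \<theta> ^ j) = 0 \<Longrightarrow> j < \<kappa> \<Longrightarrow> c j = 0"
    and degree: "\<kappa> = field_degree TYPE('k)" and number_field: "number_field TYPE('k)"

section \<open>Existence of an integral primitive element\<close>

lemma rat_common_denominator:
  fixes f :: "nat \<Rightarrow> rat"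
  shows "\<exists>D::int. D > 0 \<and> (\<forall>i<n. of_int D * f i \<in> \<int>)"
proof (induction n)
  case (Suc n)
  then obtain D :: int where D: "D > 0" "\<And>i. i < n \<Longrightarrow> of_int D * f i \<in> \<int>" by blast
  obtain x y where xy: "quotient_of (f n) = (x, y)" by (cases "quotient_of (f n)")
  then have "y > 0" "f n = of_int x / of_int y" using quotient_of_denom_pos quotient_of_div by auto
  then have y: "y > 0" "of_int y * f n \<in> \<int>" by auto
  have "of_int (D * y) * f i \<in> \<int>" if "i < Suc n" for i
  proof (cases "i < n")
    case True
    then have "of_int y * (of_int D * f i) \<in> \<int>" by (rule Ints_mult[OF Ints_of_int D(2)])
    then show ?thesis by (simp add: mult_ac)
  next
    case False
    have "of_int D * (of_int y * f i) \<in> \<int>"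
      by (rule Ints_mult[OF Ints_of_int]) (use y that False in \<open>auto simp: less_Suc_eq\<close>)
    then show ?thesis by (simp add: mult_ac)
  qed
  then show ?case using D y by (intro exI[of _ "D * y"]) auto
qed (auto intro: exI[of _ 1])

text \<open>Dimensions are cardinalities of sets, so the powers must be distinct before their number
  can be read off.\<close>

lemma inj_on_powers:
  fixes x :: "'k::field_char_0"
  assumes "\<And>c j. (\<Sum>j<d. of_rat (c j) * x ^ j) = 0 \<Longrightarrow> j < d \<Longrightarrow> c j = 0"
  shows "inj_on (\<lambda>j. x ^ j) {..<d}"
proof (rule inj_onI, rule ccontr)
  fix i j assume ij: "i \<in> {..<d}" "j \<in> {..<d}" "x ^ i = x ^ j" "i \<noteq> j"
  have "(\<Sum>k<d. of_rat ((if k = i then 1 else 0) - (if k = j then 1 else 0)) * x ^ k)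
      = (\<Sum>k<d. (if k = i then x ^ k else 0) - (if k = j then x ^ k else 0))"
    by (intro sum.cong) (auto simp: of_rat_minus)
  also have "\<dots> = 0" using ij by (simp add: sum_subtractf)
  finally show False using assms[of _ i] ij by fastforce
qed

lemma number_field_algebraic:
  fixes x :: "'k::field_char_0"
  assumes "number_field TYPE('k)"
  shows "\<exists>p. p \<noteq> 0 \<and> ev p x = 0"
proof -
  define scale where "scale = (\<lambda>(q::rat) (x::'k). of_rat q * x)"
  obtain B where "finite_dimensional_vector_space scale B"
    using assms by (auto simp: number_field_def scale_def)
  then interpret V: finite_dimensional_vector_space scale B .
  show ?thesis
  proof (cases "inj_on (\<lambda>i. x ^ i) {..V.dim UNIV}")
    case False
    then obtain i j where ij: "x ^ i = x ^ j" "i \<noteq> j" by (auto simp: inj_on_def)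
    show ?thesis
      by (intro exI[of _ "monom 1 i - monom 1 j"])
         (use ij in \<open>auto simp: ev_diff ev_monom poly_eq_iff dest: spec[of _ i]\<close>)
  next
    case True
    define S where "S = (\<lambda>i. x ^ i) ` {..V.dim UNIV}"
    have "card S > V.dim UNIV" using True by (simp add: S_def card_image)
    then have "\<not> card S \<le> V.dim S" using V.dim_subset[of S UNIV] by simp
    then have "V.dependent S" using V.independent_bound_general by blast
    then obtain u where u: "\<exists>y\<in>S. u y \<noteq> 0" "(\<Sum>y\<in>S. scale (u y) y) = 0"
      by (subst (asm) V.dependent_finite) (auto simp: S_def)
    define p where "p = (\<Sum>i\<le>V.dim UNIV. monom (u (x ^ i)) i)"
    have cp: "coeff p i = (if i \<le> V.dim UNIV then u (x ^ i) else 0)" for i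
      by (simp add: p_def coeff_sum)
    have "ev p x = (\<Sum>y\<in>S. scale (u y) y)"
      unfolding S_def p_def sum.reindex[OF True] ev_sum ev_monom by (simp add: scale_def)
    then have "ev p x = 0" using u by simp
    moreover have "p \<noteq> 0"
    proof
      assume "p = 0"
      then have "u (x ^ i) = 0" if "i \<le> V.dim UNIV" for i using cp[of i] that by simp
      then show False using u(1) by (auto simp: S_def)
    qed
    ultimately show ?thesis by blast
  qed
qed

text \<open>An element \<theta> for which Q[\<theta>] has maximal dimension generates everything,
  because \<open>adjoin_two\<close> would otherwise yield a larger subalgebra. Scaling by a common
  denominator of its monic relation makes it integral.\<close>

theorem integral_generator_exists:
  assumes "number_field TYPE('k::field_char_0)"
  obtains \<theta> :: "'k::field_char_0" and a where "integral_generator \<theta> (field_degree TYPE('k)) a"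
proof -
  define scale where "scale = (\<lambda>(q::rat) (x::'k). of_rat q * x)"
  obtain B where "finite_dimensional_vector_space scale B"
    using assms by (auto simp: number_field_def scale_def)
  then interpret V: finite_dimensional_vector_space scale B .
  have subsp: "V.subspace R" if "rat_subalgebra R" for R
    unfolding V.subspace_def using that
    by (auto simp: rat_subalgebra_def scale_def intro: unital_subring_0 unital_subring_add
        unital_subring_mult)
  note dep = number_field_algebraic[OF assms]
  have "\<exists>\<theta>. True \<and> (\<forall>\<gamma>. True \<longrightarrow> V.dim (adjoin \<gamma>) \<le> V.dim (adjoin \<theta>))"
    by (rule ex_has_greatest_nat[of _ 0 _ "Suc (V.dim UNIV)"]) (simp_all add: less_Suc_eq_le
        V.dim_subset del: V.dim_UNIV)
  then obtain \<theta> :: 'k where max: "\<And>\<gamma>. V.dim (adjoin \<gamma>) \<le> V.dim (adjoin \<theta>)" by blast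
  have gen: "b \<in> adjoin \<theta>" for b
  proof -
    obtain \<gamma> where \<gamma>: "\<theta> \<in> adjoin \<gamma>" "b \<in> adjoin \<gamma>" using adjoin_two[OF dep] by metis
    have "adjoin \<theta> \<subseteq> adjoin \<gamma>" by (rule adjoin_minimal[OF rat_subalgebra_adjoin \<gamma>(1)])
    then have "adjoin \<theta> = adjoin \<gamma>"
      using V.subspace_dim_equal[OF subsp subsp] rat_subalgebra_adjoin max by blast
    then show ?thesis using \<gamma>(2) by simp
  qed
  obtain f where f: "minimal_relation f \<theta>" using minimal_relation_exists dep by metis
  define g where "g = smult (inverse (lead_coeff f)) f"
  have g: "minimal_relation g \<theta>" "lead_coeff g = 1"
    using f by (auto simp: g_def minimal_relation_def ev_smult)
  define d where "d = degree g"
  obtain D :: int where D: "D > 0" "\<And>i. i \<le> d \<Longrightarrow> of_int D * coeff g i \<in> \<int>"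
    using rat_common_denominator[of "Suc d" "coeff g"] by (auto simp: less_Suc_eq_le)
  have indep\<theta>: "c j = 0" if z: "(\<Sum>j<d. of_rat (c j) * \<theta> ^ j) = 0" and j: "j < d" for c j
  proof -
    define p where "p = (\<Sum>j<d. monom (c j) j)"
    have cp: "coeff p i = (if i < d then c i else 0)" for i by (simp add: p_def coeff_sum)
    have "ev p \<theta> = 0" using z by (simp add: p_def ev_sum ev_monom)
    moreover have "degree p < d" using j by (intro degree_lessI) (auto simp: cp)
    ultimately have "p = 0" using g unfolding minimal_relation_def d_def by (meson not_le)
    then show ?thesis using cp[of j] j by simp
  qed
  define \<eta> where "\<eta> = of_int D * \<theta>"
  have nzD: "(of_int D :: 'k) \<noteq> 0" "(of_int D :: rat) \<noteq> 0" using D by auto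
  have dpos: "d > 0"
  proof (rule ccontr)
    assume "\<not> d > 0"
    then obtain c where "g = [:c:]" unfolding d_def by (auto elim: degree_eq_zeroE)
    then show False using g by (simp add: minimal_relation_def)
  qed
  \<comment> \<open>Scaling \<theta> by D multiplies the j-th coefficient by D^(d-j); for j < d at
    least one factor D is present to clear its denominator.\<close>
  have "\<forall>j<d. \<exists>k::int. - (of_int D ^ (d - j) * coeff g j) = of_int k"
  proof (intro allI impI)
    fix j assume j: "j < d"
    have "(of_int D :: rat) ^ (d - j) * coeff g j = of_int (D ^ (d - j - 1)) * (of_int D * coeff g j)"
      using j by (cases "d - j") auto
    also have "\<dots> \<in> \<int>" by (rule Ints_mult[OF Ints_of_int D(2)]) (use j in simp)
    finally show "\<exists>k. - (of_int D ^ (d - j) * coeff g j) = of_int k"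
      using Ints_minus Ints_cases by metis
  qed
  then obtain a where a: "\<And>j. j < d \<Longrightarrow> - (of_int D ^ (d - j) * coeff g j) = of_int (a j)" by metis
  have pow: "\<eta> ^ d = (\<Sum>j<d. of_int (a j) * \<eta> ^ j)"
  proof -
    have "0 = ev g \<theta>" using g by (simp add: minimal_relation_def)
    also have "\<dots> = (\<Sum>i\<le>d. of_rat (coeff g i) * \<theta> ^ i)" by (rule ev_altdef) (simp add: d_def)
    also have "\<dots> = (\<Sum>i<d. of_rat (coeff g i) * \<theta> ^ i) + \<theta> ^ d"
      using g(2) by (simp add: lessThan_Suc_atMost[symmetric] d_def)
    finally have "of_int D ^ d * \<theta> ^ d = - (\<Sum>i<d. of_int D ^ d * (of_rat (coeff g i) * \<theta> ^ i))"
      by (simp add: sum_distrib_left[symmetric] eq_neg_iff_add_eq_0 distrib_left[symmetric] add.commute)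
    also have "\<dots> = (\<Sum>i<d. of_int (a i) * \<eta> ^ i)"
      unfolding sum_negf[symmetric]
    proof (intro sum.cong refl)
      fix i assume "i \<in> {..<d}"
      then have i: "i < d" by simp
      have "(of_int (a i) :: 'k) = of_rat (of_int (a i))" by simp
      also have "\<dots> = - (of_int D ^ (d - i) * of_rat (coeff g i))"
        unfolding a[OF i, symmetric] by (simp add: of_rat_minus of_rat_mult of_rat_power)
      finally have "of_int (a i) * \<eta> ^ i = - (of_int D ^ (d - i) * of_int D ^ i * (of_rat (coeff g i)
          * \<theta> ^ i))"
        by (simp add: \<eta>_def power_mult_distrib mult_ac)
      also have "of_int D ^ (d - i) * of_int D ^ i = (of_int D ^ d :: 'k)"
        using i by (simp flip: power_add)
      finally show "- (of_int D ^ d * (of_rat (coeff g i) * \<theta> ^ i)) = of_int (a i) * \<eta> ^ i" by simp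
    qed
    finally show ?thesis by (simp add: \<eta>_def power_mult_distrib)
  qed
  have indep: "c j = 0" if z: "(\<Sum>j<d. of_rat (c j) * \<eta> ^ j) = 0" and j: "j < d" for c j
  proof -
    have "(\<Sum>j<d. of_rat (c j * of_int D ^ j) * \<theta> ^ j) = 0"
      using z by (simp add: \<eta>_def power_mult_distrib of_rat_mult of_rat_power mult.assoc)
    from indep\<theta>[OF this j] show ?thesis using nzD by simp
  qed
  have S: "unital_subring (range of_rat :: 'k set)"
    unfolding unital_subring_def
  proof (intro conjI ballI)
    show "1 \<in> (range of_rat :: 'k set)" by (rule range_eqI[of _ _ 1]) simp
    fix x y :: 'k assume "x \<in> range of_rat" "y \<in> range of_rat"
    then obtain p q where "x = of_rat p" "y = of_rat q" by blast
    then show "x - y \<in> range of_rat" "x * y \<in> range of_rat"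
      by (simp_all flip: of_rat_diff of_rat_mult)
  qed
  have aS: "of_int (a j) \<in> (range of_rat :: 'k set)" for j
    by (rule range_eqI[of _ _ "of_int (a j)"]) simp
  note R = power_span_subring[OF S pow aS dpos]
  have "rat_subalgebra {\<Sum>j<d. c j * \<eta> ^ j | c. \<forall>j. c j \<in> range of_rat}" (is "rat_subalgebra ?R")
    unfolding rat_subalgebra_def using R(1,2) by blast
  moreover have "\<theta> \<in> ?R"
  proof -
    have "of_rat (inverse (of_int D)) * \<eta> \<in> ?R"
      by (rule unital_subring_mult[OF R(1) subsetD[OF R(2) rangeI] R(3)])
    moreover have "of_rat (inverse (of_int D)) * \<eta> = \<theta>" using nzD by (simp add: \<eta>_def of_rat_inverse)
    ultimately show ?thesis by simp
  qed
  ultimately have sub: "adjoin \<theta> \<subseteq> ?R" by (rule adjoin_minimal)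
  have span: "\<exists>c. x = (\<Sum>j<d. of_rat (c j) * \<eta> ^ j)" for x
  proof -
    obtain c where c: "x = (\<Sum>j<d. c j * \<eta> ^ j)" "\<forall>j. c j \<in> range of_rat" using sub gen[of x] by blast
    then have "\<forall>j. \<exists>q. c j = of_rat q" by auto
    then obtain q where "\<And>j. c j = of_rat (q j)" by metis
    then show ?thesis using c(1) by auto
  qed
  have inj: "inj_on (\<lambda>j. \<eta> ^ j) {..<d}" by (rule inj_on_powers) (rule indep)
  have dimd: "V.dim UNIV = d"
  proof -
    have "V.independent ((\<lambda>j. \<eta> ^ j) ` {..<d})"
      unfolding V.independent_explicit
      by (auto simp: sum.reindex[OF inj] scale_def dest: indep)
    moreover have "UNIV \<subseteq> V.span ((\<lambda>j. \<eta> ^ j) ` {..<d})"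
    proof
      fix x :: 'k
      obtain c where c: "x = (\<Sum>j<d. scale (c j) (\<eta> ^ j))" using span[of x] by (auto simp: scale_def)
      show "x \<in> V.span ((\<lambda>j. \<eta> ^ j) ` {..<d})"
        unfolding c by (intro V.span_sum V.span_scale V.span_base) auto
    qed
    ultimately have "card ((\<lambda>j. \<eta> ^ j) ` {..<d}) = V.dim UNIV" by (intro V.basis_card_eq_dim) auto
    then show ?thesis by (simp add: card_image[OF inj])
  qed
  have "integral_generator \<eta> d a"
    by unfold_locales (use pow span indep dimd assms in \<open>auto simp: field_degree_def scale_def\<close>)
  then show ?thesis using that dimd by (simp add: field_degree_def scale_def)
qed

section \<open>Complex embeddings\<close>

context integral_generator
begin

lemma \<kappa>_pos: "\<kappa> > 0"
  using power_eq by (cases "\<kappa> = 0") auto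

lemma rep_exists: "\<exists>p. degree p < \<kappa> \<and> ev p \<theta> = x"
proof -
  obtain c where c: "x = (\<Sum>j<\<kappa>. of_rat (c j) * \<theta> ^ j)" using span by blast
  have "degree (\<Sum>j<\<kappa>. monom (c j) j) < \<kappa>"
    using \<kappa>_pos by (intro degree_lessI) (auto simp: coeff_sum)
  then show ?thesis
    using c by (intro exI[of _ "\<Sum>j<\<kappa>. monom (c j) j"]) (simp add: ev_sum ev_monom)
qed

lemma degree_relation: assumes "p \<noteq> 0" "ev p \<theta> = 0" shows "degree p \<ge> \<kappa>"
proof (rule ccontr)
  assume "\<not> ?thesis"
  then have deg: "degree p \<le> \<kappa> - 1" "degree p < \<kappa>" by auto
  have "(\<Sum>j<\<kappa>. of_rat (coeff p j) * \<theta> ^ j) = ev p \<theta>"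
    unfolding ev_altdef[OF deg(1)] using \<kappa>_pos by (intro sum.cong) auto
  then have "coeff p (degree p) = 0" using indep assms(2) deg(2) by metis
  then show False using assms(1) by simp
qed

definition minpoly :: "rat poly" where
  "minpoly = monom 1 \<kappa> - (\<Sum>j<\<kappa>. monom (of_int (a j)) j)"

lemma coeff_minpoly: "coeff minpoly i = (if i = \<kappa> then 1 else if i < \<kappa> then - of_int (a i) else 0)"
  by (simp add: minpoly_def coeff_sum)

lemma degree_minpoly: "degree minpoly = \<kappa>"
  by (rule antisym[OF degree_le le_degree]) (auto simp: coeff_minpoly)

lemma minpoly_nz: "minpoly \<noteq> 0"
  using coeff_minpoly[of \<kappa>] by auto

lemma minimal_relation_minpoly: "minimal_relation minpoly \<theta>"
proof -
  have "ev minpoly \<theta> = 0"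
    unfolding minpoly_def using power_eq by (simp add: ev_diff ev_sum ev_monom)
  then show ?thesis
    using degree_relation minpoly_nz degree_minpoly by (simp add: minimal_relation_def)
qed

definition roots :: "complex set" where
  "roots = {r. ev minpoly r = 0}"

lemma ev_root: assumes "r \<in> roots" "ev p \<theta> = 0" shows "ev p r = 0"
proof -
  have "minpoly dvd p" using minimal_relation_dvd[OF minimal_relation_minpoly assms(2)] .
  then show ?thesis using assms(1) by (auto simp: roots_def ev_mult elim!: dvdE)
qed

text \<open>Irreducibility of the minimal polynomial: a proper factor with root r would give two
  polynomials of degree below \<kappa> whose product vanishes at \<theta>, so one of them would be a
  shorter relation for \<theta>.\<close>

lemma minimal_relation_root: assumes "r \<in> roots" shows "minimal_relation minpoly r"
proof -
  have z: "ev minpoly r = 0" using assms by (simp add: roots_def)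
  obtain h where h: "minimal_relation h r" using minimal_relation_exists[OF minpoly_nz z] .
  then obtain k where k: "minpoly = h * k" using minimal_relation_dvd[OF h z] by (auto elim: dvdE)
  then have nz: "h \<noteq> 0" "k \<noteq> 0" using minpoly_nz by auto
  have deg: "degree h + degree k = \<kappa>" using degree_minpoly k degree_mult_eq[OF nz] by simp
  have "degree h \<noteq> 0"
  proof
    assume "degree h = 0"
    then obtain c where "h = [:c:]" by (rule degree_eq_zeroE)
    then show False using h by (simp add: minimal_relation_def)
  qed
  moreover have "ev h \<theta> * ev k \<theta> = 0"
    using minimal_relation_minpoly by (simp add: minimal_relation_def k ev_mult)
  then have "degree h \<ge> \<kappa> \<or> degree k \<ge> \<kappa>" using degree_relation nz by auto
  ultimately have "degree h = \<kappa>" using deg by linarith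
  then show ?thesis using h z minpoly_nz degree_minpoly by (simp add: minimal_relation_def)
qed

text \<open>The roots are simple: the nonzero derivative has smaller degree, so it cannot vanish at
  a point for which \<open>minpoly\<close> is a minimal relation.\<close>

lemma card_roots: "card roots = \<kappa>" and finite_roots: "finite roots"
proof -
  define G where "G = (map_poly of_rat minpoly :: complex poly)"
  have G: "poly G r = ev minpoly r" for r by (simp add: G_def ev_def)
  have "G \<noteq> 0" using minpoly_nz by (simp add: G_def map_poly_eq_0_iff)
  have "rsquarefree G"
    unfolding rsquarefree_roots
  proof (intro allI notI)
    fix r assume r: "poly G r = 0 \<and> poly (pderiv G) r = 0"
    have "pderiv G = map_poly of_rat (pderiv minpoly)"
      unfolding G_def by (intro poly_eqI) (simp add: coeff_pderiv coeff_map_poly of_rat_mult of_rat_add)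
    then have "ev (pderiv minpoly) r = 0" using r by (simp add: ev_def)
    moreover have "pderiv minpoly \<noteq> 0" "degree (pderiv minpoly) < degree minpoly"
      using \<kappa>_pos degree_minpoly by (simp_all add: pderiv_eq_0_iff degree_pderiv)
    ultimately show False
      using minimal_relation_root[of r] r G unfolding minimal_relation_def roots_def by (auto simp: not_le)
  qed
  from complex_poly_decompose_rsquarefree[OF this]
  have "degree (smult (lead_coeff G) (\<Prod>z | poly G z = 0. [:- z, 1:])) = degree G" by simp
  then have "card {z. poly G z = 0} = degree G"
    using \<open>G \<noteq> 0\<close> by (simp add: degree_prod_eq_sum_degree)
  then show card: "card roots = \<kappa>"
    unfolding G roots_def by (simp add: G_def degree_map_poly degree_minpoly)
  show "finite roots" by (rule card_ge_0_finite) (simp add: card \<kappa>_pos)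
qed

text \<open>Sending p(\<theta>) to p(r) does not depend on p, since every rational relation of
  \<theta> also holds for r; the choice of representatives is therefore immaterial.\<close>

lemma embedding_exists: assumes "r \<in> roots" obtains \<sigma> where "complex_embedding \<sigma>" "\<sigma> \<theta> = r"
proof -
  obtain rep where rep: "\<And>x. ev (rep x) \<theta> = x" using rep_exists by metis
  define \<sigma> where "\<sigma> x = ev (rep x) r" for x
  have eq: "\<sigma> (ev p \<theta>) = ev p r" for p
  proof -
    have "ev (rep (ev p \<theta>) - p) \<theta> = 0" by (simp add: ev_diff rep)
    then have "ev (rep (ev p \<theta>) - p) r = 0" by (rule ev_root[OF assms])
    then show ?thesis by (simp add: \<sigma>_def ev_diff)
  qed
  have "complex_embedding \<sigma>"
    unfolding complex_embedding_def
  proof (intro conjI allI)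
    show "\<sigma> 1 = 1" using eq[of 1] by simp
    fix x y
    show "\<sigma> (x + y) = \<sigma> x + \<sigma> y" using eq[of "rep x + rep y"] by (simp add: ev_add rep \<sigma>_def)
    show "\<sigma> (x * y) = \<sigma> x * \<sigma> y" using eq[of "rep x * rep y"] by (simp add: ev_mult rep \<sigma>_def)
  qed
  moreover have "\<sigma> \<theta> = r" using eq[of "[:0, 1:]"] by simp
  ultimately show ?thesis using that by blast
qed

definition Emb :: "('k \<Rightarrow> complex) set" where
  "Emb = {\<sigma>. complex_embedding \<sigma>}"

lemma bij_Emb: "bij_betw (\<lambda>\<sigma>. \<sigma> \<theta>) Emb roots"
  unfolding bij_betw_def
proof
  show "inj_on (\<lambda>\<sigma>. \<sigma> \<theta>) Emb"
  proof (rule inj_onI, rule ext)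
    fix \<sigma> \<tau> x assume st: "\<sigma> \<in> Emb" "\<tau> \<in> Emb" "\<sigma> \<theta> = \<tau> \<theta>"
    interpret s: embedded_field \<sigma> using st by unfold_locales (simp add: Emb_def)
    interpret t: embedded_field \<tau> using st by unfold_locales (simp add: Emb_def)
    obtain p where "ev p \<theta> = x" using rep_exists by blast
    then show "\<sigma> x = \<tau> x" using s.hom_ev[of p \<theta>] t.hom_ev[of p \<theta>] st by simp
  qed
  have "\<sigma> \<theta> \<in> roots" if "\<sigma> \<in> Emb" for \<sigma>
  proof -
    interpret s: embedded_field \<sigma> using that by unfold_locales (simp add: Emb_def)
    show ?thesis
      using s.hom_ev[of minpoly \<theta>] minimal_relation_minpoly by (simp add: roots_def minimal_relation_def)
  qed
  then show "(\<lambda>\<sigma>. \<sigma> \<theta>) ` Emb = roots"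
  proof (intro subset_antisym subsetI)
    fix r assume "r \<in> roots"
    then obtain \<sigma> where "complex_embedding \<sigma>" "\<sigma> \<theta> = r" by (rule embedding_exists)
    then show "r \<in> (\<lambda>\<sigma>. \<sigma> \<theta>) ` Emb" unfolding Emb_def by blast
  qed blast
qed

lemma card_Emb: "card Emb = \<kappa>"
  using bij_betw_same_card[OF bij_Emb] by (simp only: card_roots)

lemma finite_Emb: "finite Emb"
  using bij_betw_finite[OF bij_Emb] by (simp only: finite_roots)

text \<open>The order Z[\<theta>], given by coordinates so that its discreteness can be read off
  from them.\<close>

definition Zt :: "'k set" where
  "Zt = {\<Sum>j<\<kappa>. c j * \<theta> ^ j | c. \<forall>j. c j \<in> \<int>}"

lemma subring_Ints: "unital_subring (\<int> :: 'a::comm_ring_1 set)"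
  by (simp add: unital_subring_def)

lemma subring_Zt: "unital_subring Zt" and Ints_Zt: "\<int> \<subseteq> Zt" and \<theta>_Zt: "\<theta> \<in> Zt"
  using power_span_subring[OF subring_Ints power_eq _ \<kappa>_pos] by (simp_all add: Zt_def)

lemma Zt_int_coeffs: "x \<in> Zt \<Longrightarrow> \<exists>c. x = (\<Sum>j<\<kappa>. of_int (c j) * \<theta> ^ j)"
proof -
  assume "x \<in> Zt"
  then obtain c where c: "x = (\<Sum>j<\<kappa>. c j * \<theta> ^ j)" "\<forall>j. c j \<in> \<int>" by (auto simp: Zt_def)
  then have "\<forall>j. \<exists>k. c j = of_int k" by (auto elim: Ints_cases)
  then obtain k where "\<And>j. c j = of_int (k j)" by metis
  with c show ?thesis by auto
qed

text \<open>Lagrange interpolation at the conjugates of \<open>\<theta>\<close> recovers the integer coordinates.\<close>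

lemma Zt_discrete: obtains \<epsilon> where "\<epsilon> > 0"
  "\<And>x. x \<in> Zt \<Longrightarrow> (\<And>\<sigma>. \<sigma> \<in> Emb \<Longrightarrow> cmod (\<sigma> x) < \<epsilon>) \<Longrightarrow> x = 0"
proof -
  define L where "L r = smult (1 / (\<Prod>s\<in>roots - {r}. r - s)) (\<Prod>s\<in>roots - {r}. [:- s, 1:])" for r
  have L: "poly (L r) t = (if t = r then 1 else 0)" if "r \<in> roots" "t \<in> roots" for r t
    using that finite_roots by (auto simp: L_def poly_prod)
  have degL: "degree (L r) < \<kappa>" if "r \<in> roots" for r
  proof -
    have "degree (\<Prod>s\<in>roots - {r}. [:- s, 1:]) = \<kappa> - 1"
      using that finite_roots card_roots by (subst degree_prod_eq_sum_degree) auto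
    then show ?thesis using \<kappa>_pos degree_smult_le[of _ "\<Prod>s\<in>roots - {r}. [:- s, 1:]"]
      unfolding L_def by (metis One_nat_def diff_Suc_less le_less_trans)
  qed
  \<comment> \<open>Dominates the coefficients of the interpolation basis; the summand 1 makes B
    positive and the final inequality for the coordinates strict.\<close>
  define B where "B = 1 + (\<Sum>j<\<kappa>. \<Sum>r\<in>roots. cmod (coeff (L r) j))"
  have B: "B > 0" unfolding B_def by (intro add_pos_nonneg sum_nonneg) auto
  have "x = 0" if x: "x \<in> Zt" and small: "\<And>\<sigma>. \<sigma> \<in> Emb \<Longrightarrow> cmod (\<sigma> x) < 1 / B" for x
  proof -
    obtain c where c: "x = (\<Sum>j<\<kappa>. of_int (c j) * \<theta> ^ j)" using Zt_int_coeffs[OF x] by blast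
    define Q where "Q = (\<Sum>j<\<kappa>. monom (of_int (c j)) j :: complex poly)"
    have cQ: "coeff Q j = (if j < \<kappa> then of_int (c j) else 0)" for j by (simp add: Q_def coeff_sum)
    have Qr: "cmod (poly Q r) < 1 / B" if r: "r \<in> roots" for r
    proof -
      obtain \<sigma> where \<sigma>: "complex_embedding \<sigma>" "\<sigma> \<theta> = r" using embedding_exists[OF r] .
      interpret s: embedded_field \<sigma> using \<sigma> by unfold_locales
      have "\<sigma> x = poly Q r"
        by (simp add: c Q_def s.hom_sum s.hom_mult s.hom_power s.hom_of_int \<sigma> poly_sum poly_monom)
      then show ?thesis using small[of \<sigma>] \<sigma> by (simp add: Emb_def)
    qed
    have "Q = (\<Sum>r\<in>roots. smult (poly Q r) (L r))"
    proof (rule poly_eqI_degree)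
      show "poly Q t = poly (\<Sum>r\<in>roots. smult (poly Q r) (L r)) t" if t: "t \<in> roots" for t
      proof -
        have "poly (\<Sum>r\<in>roots. smult (poly Q r) (L r)) t = (\<Sum>r\<in>roots. if r = t then poly Q t else 0)"
          unfolding poly_sum by (intro sum.cong) (auto simp: L t)
        then show ?thesis using t finite_roots by simp
      qed
      show "degree Q < card roots" using \<kappa>_pos card_roots by (intro degree_lessI) (auto simp: cQ)
      have "coeff (L r) j = 0" if "r \<in> roots" "j \<ge> \<kappa>" for r j
        using degL[OF that(1)] that(2) by (intro coeff_eq_0) simp
      then show "degree (\<Sum>r\<in>roots. smult (poly Q r) (L r)) < card roots"
        using \<kappa>_pos card_roots by (intro degree_lessI) (auto simp: coeff_sum)
    qed
    then have cj: "coeff Q j = (\<Sum>r\<in>roots. poly Q r * coeff (L r) j)" for j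
      by (metis (mono_tags, lifting) coeff_smult coeff_sum sum.cong)
    have "c j = 0" if j: "j < \<kappa>" for j
    proof -
      have "cmod (coeff Q j) \<le> (\<Sum>r\<in>roots. cmod (poly Q r) * cmod (coeff (L r) j))"
        unfolding cj by (rule order.trans[OF norm_sum]) (simp add: norm_mult)
      also have "\<dots> \<le> (\<Sum>r\<in>roots. 1 / B * cmod (coeff (L r) j))"
        using Qr by (intro sum_mono mult_right_mono) (auto intro: less_imp_le)
      also have "\<dots> = 1 / B * (\<Sum>r\<in>roots. cmod (coeff (L r) j))" by (simp add: sum_distrib_left)
      also have "\<dots> < 1 / B * B"
      proof (rule mult_strict_left_mono)
        have "(\<Sum>r\<in>roots. cmod (coeff (L r) j)) \<le> (\<Sum>j<\<kappa>. \<Sum>r\<in>roots. cmod (coeff (L r) j))"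
          using j by (intro member_le_sum) (auto intro: sum_nonneg)
        then show "(\<Sum>r\<in>roots. cmod (coeff (L r) j)) < B" by (simp add: B_def)
      qed (use B in simp)
      finally have "cmod (of_int (c j)) < 1" using B j by (simp add: cQ)
      then show ?thesis by simp
    qed
    then show ?thesis by (simp add: c)
  qed
  then show ?thesis using that[of "1 / B"] B by auto
qed

end

section \<open>Algebraic integers\<close>

context integral_generator
begin

definition bounded_denominators :: "'k set \<Rightarrow> bool" where
  "bounded_denominators S \<longleftrightarrow> (\<exists>D::int. D \<noteq> 0 \<and> (\<forall>x\<in>S. of_int D * x \<in> Zt))"

text \<open>The algebraic integers of the field: a subring with a common denominator over
  Z[\<theta>] lies in a finitely generated module, which is the usual criterion for
  integrality.\<close>

definition Ok :: "'k set" where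
  "Ok = {x. \<exists>S. unital_subring S \<and> bounded_denominators S \<and> Zt \<subseteq> S \<and> x \<in> S}"

lemma OkI: "unital_subring S \<Longrightarrow> bounded_denominators S \<Longrightarrow> Zt \<subseteq> S \<Longrightarrow> x \<in> S \<Longrightarrow> x \<in> Ok"
  unfolding Ok_def by blast

lemma bounded_denominators_Zt: "bounded_denominators Zt"
  unfolding bounded_denominators_def by (rule exI[of _ 1]) simp

lemma Zt_Ok: "Zt \<subseteq> Ok"
  using OkI[OF subring_Zt bounded_denominators_Zt] by blast

lemma of_int_Zt: "of_int n \<in> Zt"
  using Ints_Zt by auto

lemma Zt_mult: "x \<in> Zt \<Longrightarrow> y \<in> Zt \<Longrightarrow> x * y \<in> Zt"
  by (rule unital_subring_mult[OF subring_Zt])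

lemma common_denominator:
  fixes f :: "nat \<Rightarrow> 'k"
  shows "\<exists>D::int. D \<noteq> 0 \<and> (\<forall>i<n. of_int D * f i \<in> Zt)"
proof (induction n)
  case (Suc n)
  then obtain D :: int where D: "D \<noteq> 0" "\<And>i. i < n \<Longrightarrow> of_int D * f i \<in> Zt" by auto
  obtain c where c: "f n = (\<Sum>j<\<kappa>. of_rat (c j) * \<theta> ^ j)" using span by blast
  obtain E :: int where E0: "E > 0" "\<And>j. j < \<kappa> \<Longrightarrow> of_int E * c j \<in> \<int>"
    using rat_common_denominator[of \<kappa> c] by blast
  have E: "E \<noteq> 0" "\<And>j. j < \<kappa> \<Longrightarrow> of_int E * (of_rat (c j) :: 'k) \<in> \<int>"
  proof -
    fix j assume "j < \<kappa>"
    then obtain k where "of_int E * c j = of_int k" using E0(2) by (auto elim: Ints_cases)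
    then have "of_rat (of_int E * c j) = (of_rat (of_int k) :: 'k)" by (simp only:)
    then show "of_int E * (of_rat (c j) :: 'k) \<in> \<int>" by (simp add: of_rat_mult)
  qed (use E0 in simp)
  have "of_int E * f n = (\<Sum>j<\<kappa>. of_int E * of_rat (c j) * \<theta> ^ j)"
    by (simp add: c sum_distrib_left mult.assoc)
  also have "\<dots> \<in> Zt"
    by (intro unital_subring_sum[OF subring_Zt] Zt_mult[OF subsetD[OF Ints_Zt E(2)]]
        unital_subring_power[OF subring_Zt \<theta>_Zt]) simp
  finally have En: "of_int E * f n \<in> Zt" .
  have "of_int (D * E) * f i \<in> Zt" if "i < Suc n" for i
  proof (cases "i = n")
    case True
    then show ?thesis using Zt_mult[OF of_int_Zt En, of D] by (simp add: mult.assoc)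
  next
    case False
    then have "of_int E * (of_int D * f i) \<in> Zt" using that by (intro Zt_mult[OF of_int_Zt D(2)]) simp
    then show ?thesis by (simp add: mult_ac)
  qed
  then show ?case using D(1) E(1) by (intro exI[of _ "D * E"]) simp
qed (auto intro: exI[of _ 1])

text \<open>Elements of S[x] are sums of products of an element of S and a power of x, so the
  product of the two denominators works.\<close>

lemma bounded_denominators_adjoin:
  assumes S: "unital_subring S" "bounded_denominators S" "Zt \<subseteq> S" and x: "x \<in> Ok"
  obtains S' where "unital_subring S'" "bounded_denominators S'" "S \<subseteq> S'" "x \<in> S'"
proof -
  define S' where "S' = {poly p x | p. \<forall>i. coeff p i \<in> S}"
  obtain T where T: "unital_subring T" "bounded_denominators T" "x \<in> T" using x by (auto simp: Ok_def)
  obtain D :: int where D: "D \<noteq> 0" "\<And>y. y \<in> S \<Longrightarrow> of_int D * y \<in> Zt"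
    using S(2) by (auto simp: bounded_denominators_def)
  obtain E :: int where E: "E \<noteq> 0" "\<And>y. y \<in> T \<Longrightarrow> of_int E * y \<in> Zt"
    using T(2) by (auto simp: bounded_denominators_def)
  have "of_int (D * E) * poly p x \<in> Zt" if "\<forall>i. coeff p i \<in> S" for p
  proof -
    have "of_int (D * E) * poly p x = (\<Sum>i\<le>degree p. (of_int D * coeff p i) * (of_int E * x ^ i))"
      by (simp add: poly_altdef sum_distrib_left mult_ac)
    also have "\<dots> \<in> Zt"
      by (intro unital_subring_sum[OF subring_Zt] Zt_mult[OF D(2) E(2)] unital_subring_power[OF T(1,3)])
         (use that in simp)
    finally show ?thesis .
  qed
  then have "bounded_denominators S'"
    unfolding bounded_denominators_def S'_def using D(1) E(1) by (intro exI[of _ "D * E"]) auto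
  moreover have "unital_subring S'"
    unfolding unital_subring_def
  proof (intro conjI ballI)
    show "1 \<in> S'" unfolding S'_def
      using unital_subring_0[OF S(1)] unital_subring_1[OF S(1)]
          by (intro CollectI exI[of _ 1]) (simp add: coeff_1)
    fix y z assume "y \<in> S'" "z \<in> S'"
    then obtain p q where pq: "y = poly p x" "\<forall>i. coeff p i \<in> S" "z = poly q x" "\<forall>i. coeff q i \<in> S"
      unfolding S'_def by blast
    show "y - z \<in> S'" unfolding S'_def
      using pq unital_subring_diff[OF S(1)] by (intro CollectI exI[of _ "p - q"]) simp
    show "y * z \<in> S'" unfolding S'_def
      using pq unital_subring_coeff_mult[OF S(1)] by (intro CollectI exI[of _ "p * q"]) simp
  qed
  moreover have "S \<subseteq> S'"
  proof
    fix y assume "y \<in> S"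
    then show "y \<in> S'" unfolding S'_def
      using unital_subring_0[OF S(1)] by (intro CollectI exI[of _
          "[:y:]"]) (simp add: coeff_pCons split: nat.split)
  qed
  moreover have "x \<in> S'"
    unfolding S'_def using unital_subring_0[OF S(1)] unital_subring_1[OF S(1)]
    by (intro CollectI exI[of _ "[:0, 1:]"]) (simp add: coeff_pCons split: nat.split)
  ultimately show ?thesis using that by blast
qed

lemma Ok_common_subring:
  assumes "\<And>j. j < (n::nat) \<Longrightarrow> s j \<in> Ok"
  shows "\<exists>S. unital_subring S \<and> bounded_denominators S \<and> Zt \<subseteq> S \<and> (\<forall>j<n. s j \<in> S)"
  using assms
proof (induction n)
  case 0
  then show ?case using subring_Zt bounded_denominators_Zt by auto
next
  case (Suc n)
  then obtain S where S: "unital_subring S" "bounded_denominators S" "Zt \<subseteq> S" "\<forall>j<n. s j \<in> S"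
    using less_SucI by metis
  have "s n \<in> Ok" using Suc.prems by simp
  then obtain S' where S': "unital_subring S'" "bounded_denominators S'" "S \<subseteq> S'" "s n \<in> S'"
    using bounded_denominators_adjoin[OF S(1-3)] by blast
  have "\<forall>j<Suc n. s j \<in> S'" using S(4) S'(3,4) by (auto simp: less_Suc_eq)
  then show ?case using S' S(3) by (intro exI[of _ S']) auto
qed

lemma subring_Ok: "unital_subring Ok"
  unfolding unital_subring_def
proof (intro conjI ballI)
  show "1 \<in> Ok" using Zt_Ok unital_subring_1[OF subring_Zt] by blast
  fix x y assume xy: "x \<in> Ok" "y \<in> Ok"
  define s where "s j = (if j = 0 then x else y)" for j :: nat
  have "s j \<in> Ok" for j using xy by (simp add: s_def)
  then obtain S where S: "unital_subring S" "bounded_denominators S" "Zt \<subseteq> S" "\<forall>j<2. s j \<in> S"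
    using Ok_common_subring[of 2 s] by auto
  have "x \<in> S" "y \<in> S" using S(4)[rule_format, of 0] S(4)[rule_format, of 1] by (simp_all add: s_def)
  then show "x - y \<in> Ok" "x * y \<in> Ok"
    using OkI[OF S(1-3)] unital_subring_diff[OF S(1)] unital_subring_mult[OF S(1)] by blast+
qed

text \<open>Over a suitable S containing the coefficients, S[t] is spanned by finitely many powers
  of t, and these have a common denominator.\<close>

lemma Ok_integrally_closed:
  assumes pow: "t ^ d = (\<Sum>j<d. s j * t ^ j)" and s: "\<And>j. j < d \<Longrightarrow> s j \<in> Ok" and d: "d > 0"
  shows "t \<in> Ok"
proof -
  obtain S where S: "unital_subring S" "bounded_denominators S" "Zt \<subseteq> S" and sS: "\<forall>j<d. s j \<in> S"
    using Ok_common_subring[of d s] s by auto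
  define R where "R = {\<Sum>j<d. c j * t ^ j | c. \<forall>j. c j \<in> S}"
  have R: "unital_subring R" "S \<subseteq> R" "t \<in> R"
    using power_span_subring[OF S(1) pow _ d] sS unfolding R_def by simp_all
  obtain D :: int where D: "D \<noteq> 0" "\<And>y. y \<in> S \<Longrightarrow> of_int D * y \<in> Zt"
    using S(2) by (auto simp: bounded_denominators_def)
  obtain E :: int where E: "E \<noteq> 0" "\<And>i. i < d \<Longrightarrow> of_int E * t ^ i \<in> Zt"
    using common_denominator[of d "\<lambda>i. t ^ i"] by blast
  have "of_int (D * E) * x \<in> Zt" if "x \<in> R" for x
  proof -
    obtain c where c: "x = (\<Sum>j<d. c j * t ^ j)" "\<forall>j. c j \<in> S" using \<open>x \<in> R\<close> by (auto simp: R_def)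
    have "of_int (D * E) * x = (\<Sum>j<d. (of_int D * c j) * (of_int E * t ^ j))"
      by (simp add: c(1) sum_distrib_left mult_ac)
    also have "\<dots> \<in> Zt"
      by (intro unital_subring_sum[OF subring_Zt] Zt_mult[OF D(2) E(2)]) (use c(2) in auto)
    finally show ?thesis .
  qed
  then have "bounded_denominators R"
    unfolding bounded_denominators_def using D(1) E(1) by (intro exI[of _ "D * E"]) auto
  moreover have "Zt \<subseteq> R" using S(3) R(2) by (rule subset_trans)
  ultimately show ?thesis using R(3) by (rule OkI[OF R(1)])
qed

lemma algebraic_int_Ok: assumes "algebraic_int x" shows "x \<in> Ok"
proof -
  obtain p where p: "lead_coeff p = 1" "\<forall>i. coeff p i \<in> \<int>" "poly p x = 0"
    using assms by (auto elim: algebraic_int.cases)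
  define d where "d = degree p"
  have "d > 0"
  proof (rule ccontr)
    assume "\<not> d > 0"
    then obtain c where "p = [:c:]" unfolding d_def by (auto elim: degree_eq_zeroE)
    then show False using p by simp
  qed
  have "poly p x = (\<Sum>i<d. coeff p i * x ^ i) + x ^ d"
    using p(1) by (simp add: poly_altdef d_def flip: lessThan_Suc_atMost)
  then have "x ^ d = (\<Sum>i<d. - coeff p i * x ^ i)"
    using p(3) by (simp add: sum_negf eq_neg_iff_add_eq_0 add.commute)
  then show ?thesis
  proof (rule Ok_integrally_closed)
    show "- coeff p j \<in> Ok" for j
      using p(2) Ints_Zt Zt_Ok Ints_minus by blast
  qed (rule \<open>d > 0\<close>)
qed

lemma of_int_Ok: "of_int n \<in> Ok"
  using of_int_Zt Zt_Ok by blast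

text \<open>The monic equation bounds \<theta>, and hence Z[\<theta>], by 1. All powers of x share
  one denominator, so they could not be unbounded at v.\<close>

lemma Ok_nonarchimedean: assumes "nonarchimedean_place v p" "x \<in> Ok" shows "v x \<le> 1"
proof -
  interpret nonarchimedean_place v p by fact
  have \<theta>: "v \<theta> \<le> 1"
  proof (rule ccontr)
    assume "\<not> v \<theta> \<le> 1"
    then have gt: "v \<theta> > 1" by simp
    have "v (\<Sum>j<\<kappa>. of_int (a j) * \<theta> ^ j) \<le> v \<theta> ^ (\<kappa> - 1)"
    proof (rule sum_le_bound)
      fix j assume "j \<in> {..<\<kappa>}"
      then have "v \<theta> ^ j \<le> v \<theta> ^ (\<kappa> - 1)" using gt by (intro power_increasing) auto
      moreover have "v (of_int (a j)) * v \<theta> ^ j \<le> 1 * v \<theta> ^ j" by (intro mult_right_mono) auto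
      ultimately show "v (of_int (a j) * \<theta> ^ j) \<le> v \<theta> ^ (\<kappa> - 1)" by (simp add: mult power)
    qed simp
    then have "v \<theta> ^ \<kappa> \<le> v \<theta> ^ (\<kappa> - 1)" by (simp flip: power_eq add: power)
    moreover have "v \<theta> ^ (\<kappa> - 1) < v \<theta> ^ \<kappa>" using gt \<kappa>_pos by (intro power_strict_increasing) auto
    ultimately show False by simp
  qed
  have Zt: "v y \<le> 1" if y: "y \<in> Zt" for y
  proof -
    obtain c where c: "y = (\<Sum>j<\<kappa>. of_int (c j) * \<theta> ^ j)" using Zt_int_coeffs[OF y] by blast
    show ?thesis unfolding c
      by (rule sum_le_bound) (use \<theta> in \<open>auto simp: mult power intro!: mult_le_one power_le_one\<close>)
  qed
  obtain S where S: "unital_subring S" "bounded_denominators S" "x \<in> S" using assms(2) by (auto simp: Ok_def)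
  obtain D :: int where D: "D \<noteq> 0" "\<And>y. y \<in> S \<Longrightarrow> of_int D * y \<in> Zt"
    using S(2) by (auto simp: bounded_denominators_def)
  have le: "v (of_int D) * v x ^ n \<le> 1" for n
    using Zt[OF D(2)[OF unital_subring_power[OF S(1,3), of n]]] by (simp add: mult power)
  have pos: "v (of_int D) > 0" using D(1) by simp
  show ?thesis
  proof (rule ccontr)
    assume "\<not> v x \<le> 1"
    then obtain n where "1 / v (of_int D) < v x ^ n" using real_arch_pow[of "v x" "1 / v (of_int D)"] by auto
    then show False using le[of n] pos by (simp add: field_simps)
  qed
qed

text \<open>The powers of x tend to zero at every embedding; multiplied by their common denominator
  they lie in Z[\<theta>], which is discrete. Taking powers is what raises the threshold to
  1.\<close>

lemma Ok_discrete:
  assumes x: "x \<in> Ok" and small: "\<And>\<sigma>. \<sigma> \<in> Emb \<Longrightarrow> cmod (\<sigma> x) < 1"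
  shows "x = 0"
proof -
  obtain S where S: "unital_subring S" "bounded_denominators S" "x \<in> S" using x by (auto simp: Ok_def)
  obtain D :: int where D: "D \<noteq> 0" "\<And>y. y \<in> S \<Longrightarrow> of_int D * y \<in> Zt"
    using S(2) by (auto simp: bounded_denominators_def)
  obtain \<epsilon> where e: "\<epsilon> > 0" "\<And>x. x \<in> Zt \<Longrightarrow> (\<And>\<sigma>. \<sigma> \<in> Emb \<Longrightarrow> cmod (\<sigma> x) < \<epsilon>) \<Longrightarrow> x = 0"
    using Zt_discrete by blast
  have "\<forall>\<^sub>F n in sequentially. cmod (\<sigma> (of_int D * x ^ n)) < \<epsilon>" if s: "\<sigma> \<in> Emb" for \<sigma>
  proof -
    interpret embedded_field \<sigma> using s by unfold_locales (simp add: Emb_def)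
    have "(\<lambda>n. cmod (\<sigma> x) ^ n) \<longlonglongrightarrow> 0" using small[OF s] by (intro LIMSEQ_power_zero) simp
    then have "(\<lambda>n. cmod (of_int D) * cmod (\<sigma> x) ^ n) \<longlonglongrightarrow> cmod (of_int D) * 0"
      by (intro tendsto_mult tendsto_const)
    then have "(\<lambda>n. cmod (\<sigma> (of_int D * x ^ n))) \<longlonglongrightarrow> 0"
      by (simp add: hom_mult hom_power hom_of_int norm_mult norm_power)
    then show ?thesis using e(1) by (rule order_tendstoD)
  qed
  then have "\<forall>\<^sub>F n in sequentially. \<forall>\<sigma>\<in>Emb. cmod (\<sigma> (of_int D * x ^ n)) < \<epsilon>"
    using finite_Emb by (simp add: eventually_ball_finite)
  then obtain n where "\<forall>\<sigma>\<in>Emb. cmod (\<sigma> (of_int D * x ^ n)) < \<epsilon>"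
    using eventually_happens by fastforce
  then have "of_int D * x ^ n = 0"
    using D(2)[OF unital_subring_power[OF S(1,3)]] by (intro e(2)) auto
  then show ?thesis using D(1) by simp
qed

end

section \<open>Independence of non-Archimedean places\<close>

lemma (in absolute_value) v_power_int: "v (x powi n) = v x powi n"
  by (cases n) (simp_all add: power_int_def power inverse)

text \<open>Over different primes q/p works. Over the same prime some element has different absolute
  values; a high power widens their ratio beyond p, and scaling by a power of p then brings 1 into
  the gap.\<close>

lemma places_separate:
  assumes "nonarchimedean_place v p" "nonarchimedean_place u q" "u \<noteq> v"
  shows "\<exists>x. v x > 1 \<and> u x < 1"
proof -
  interpret v: nonarchimedean_place v p by fact
  interpret u: nonarchimedean_place u q by fact
  show ?thesis
  proof (cases "p = q")
    case False
    have np: "\<not> int p dvd int q" "\<not> int q dvd int p"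
      using primes_dvd_imp_eq[OF v.prime u.prime] primes_dvd_imp_eq[OF u.prime v.prime] False
      unfolding int_dvd_int_iff by metis+
    have "v (of_nat q) = 1" "u (of_nat p) = 1"
      using v.v_of_int_eq_1[OF np(1)] u.v_of_int_eq_1[OF np(2)] by simp_all
    then have "v (of_nat q / of_nat p) > 1" "u (of_nat q / of_nat p) < 1"
      using v.v_p u.v_p v.p_gt_1 u.p_gt_1 by (simp_all add: v.divide u.divide inverse_less_1_iff)
    then show ?thesis by blast
  next
    case True
    have *: "\<exists>x. v x > 1 \<and> u x < 1" if a: "v a > u a" "a \<noteq> 0" for a
    proof -
      have upos: "u a > 0" using a by simp
      then have "v a / u a > 1" using a by simp
      then obtain n where n: "real p < (v a / u a) ^ n" using real_arch_pow by blast
      then have n': "real p * u a ^ n < v a ^ n" using upos by (simp add: power_divide field_simps)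
      \<comment> \<open>p^m is the least integral power of p above \<open>u a ^ n\<close>, so it is
        at most p times that and hence below \<open>v a ^ n\<close>.\<close>
      define m where "m = \<lfloor>log (real p) (u a ^ n)\<rfloor> + 1"
      have "log (real p) (u a ^ n) < of_int m" "of_int m \<le> log (real p) (u a ^ n) + 1"
        unfolding m_def by linarith+
      then have "u a ^ n < real p powr of_int m" "real p powr of_int m
          \<le> real p powr (log (real p) (u a ^ n) + 1)"
        using upos v.p_gt_1 by (auto simp: log_less_iff)
      moreover have "real p powr (log (real p) (u a ^ n) + 1) = real p * u a ^ n"
        using upos v.p_gt_1 by (simp add: powr_add)
      ultimately have m: "u a ^ n < real p powi m" "real p powi m < v a ^ n"
        using n' v.p_gt_1 by (simp_all add: powr_real_of_int')
      have pp: "real p powi m > 0" using v.p_gt_1 by simp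
      have "v (a ^ n * of_nat p powi m) = v a ^ n / real p powi m"
        by (simp add: v.mult v.power v.v_power_int v.v_p power_int_inverse divide_inverse)
      moreover have "u (a ^ n * of_nat p powi m) = u a ^ n / real p powi m"
        using u.v_p True by (simp add: u.mult u.power u.v_power_int power_int_inverse divide_inverse)
      ultimately show ?thesis using m pp by (intro exI[of _ "a ^ n * of_nat p powi m"]) simp
    qed
    obtain a where a: "u a \<noteq> v a" using assms(3) by blast
    then have nz: "a \<noteq> 0" by auto
    show ?thesis
    proof (cases "v a > u a")
      case False
      then have "v (inverse a) > u (inverse a)"
        using a nz by (simp add: v.inverse u.inverse)
      then show ?thesis using * nz by simp
    qed (use * nz in blast)
  qed
qed

lemma weak_approximation:
  assumes v: "nonarchimedean_place v p" and F: "finite F" "F \<subseteq> nonarchimedean_places" "v \<notin> F"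
  shows "\<exists>x. v x > 1 \<and> (\<forall>u\<in>F. u x < 1)"
  using F
proof (induction F)
  case empty
  interpret v: nonarchimedean_place v p by fact
  show ?case
    using v.v_p v.p_gt_1 by (intro exI[of _ "inverse (of_nat p)"]) (simp add: v.inverse)
next
  case (insert w F)
  interpret v: nonarchimedean_place v p by fact
  obtain q where "nonarchimedean_place w q" using insert.prems(1) nonarchimedean_places_iff by blast
  then interpret w: nonarchimedean_place w q .
  obtain x where x: "v x > 1" "\<And>u. u \<in> F \<Longrightarrow> u x < 1" using insert by blast
  obtain y where y: "v y > 1" "w y < 1"
    using places_separate[OF v \<open>nonarchimedean_place w q\<close>] insert.prems by blast
  have np: "\<exists>q. nonarchimedean_place u q" if "u \<in> F" for u
    using insert.prems(1) that nonarchimedean_places_iff by blast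
  have av: "absolute_value u" if "u \<in> F" for u
    using absolute_value_nonarchimedean insert.prems(1) that by blast
  have ev: "\<forall>\<^sub>F n in sequentially. \<forall>u\<in>F. u (x ^ n * y) < 1"
  proof (rule eventually_ball_finite[OF insert.hyps(1)], rule ballI)
    fix u assume u: "u \<in> F"
    then interpret absolute_value u by (rule av)
    have "(\<lambda>n. u x ^ n) \<longlonglongrightarrow> 0" using x(2)[OF u] by (intro LIMSEQ_power_zero) simp
    then have "(\<lambda>n. u x ^ n * u y) \<longlonglongrightarrow> 0 * u y" by (intro tendsto_mult tendsto_const)
    then have "(\<lambda>n. u (x ^ n * y)) \<longlonglongrightarrow> 0" by (simp add: mult power)
    then show "\<forall>\<^sub>F n in sequentially. u (x ^ n * y) < 1" by (rule order_tendstoD) simp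
  qed
  then have "\<forall>\<^sub>F n in sequentially. n \<ge> 1 \<and> (\<forall>u\<in>F. u (x ^ n * y) < 1)"
    using eventually_ge_at_top[of 1] by (auto intro: eventually_conj)
  then obtain n where n: "n \<ge> 1" "\<And>u. u \<in> F \<Longrightarrow> u (x ^ n * y) < 1"
    using eventually_happens by fastforce
  have xn: "v (x ^ n) > 1" using x(1) n(1) by (simp add: v.power one_less_power)
  consider "w x < 1" | "w x = 1" | "w x > 1" by linarith
  then show ?case
  proof cases
    case 1
    then show ?thesis using x by blast
  next
    case 2
    have "v (x ^ n * y) > 1" using xn y(1) by (simp add: v.mult less_1_mult)
    moreover have "w (x ^ n * y) < 1" using 2 y(2) by (simp add: w.mult w.power)
    ultimately show ?thesis using n(2) by blast
  next
    case 3
    \<comment> \<open>A unit at v and at w, where x^n dominates the denominator; at the places of F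
      the denominator is a unit and x^n survives.\<close>
    define e where "e = x ^ n / (1 + x ^ n)"
    have "v (x ^ n + 1) = v (x ^ n)" using xn by (intro v.add_eq_of_less) simp
    moreover have "v (x ^ n) \<noteq> 0" using xn by linarith
    ultimately have "v e = 1" unfolding e_def v.divide add.commute[of 1] by (metis divide_self)
    then have vy: "v (e * y) > 1" using y(1) by (simp add: v.mult)
    have wxn: "w (x ^ n) > 1" using 3 n(1) by (simp add: w.power one_less_power)
    have "w (x ^ n + 1) = w (x ^ n)" using wxn by (intro w.add_eq_of_less) simp
    moreover have "w (x ^ n) \<noteq> 0" using wxn by linarith
    ultimately have "w e = 1" unfolding e_def w.divide add.commute[of 1] by (metis divide_self)
    then have wy: "w (e * y) < 1" using y(2) by (simp add: w.mult)
    have "u (e * y) < 1" if u: "u \<in> F" for u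
    proof -
      obtain q' where "nonarchimedean_place u q'" using np[OF u] by blast
      then interpret u: nonarchimedean_place u q' .
      have "u (x ^ n) < 1" using x(2)[OF u] n(1) by (simp add: u.power power_less_one_iff)
      then have "u (1 + x ^ n) = 1" using u.add_eq_of_less[of "x ^ n" 1] by simp
      then have "u (e * y) = u (x ^ n * y)" by (simp add: e_def u.mult u.divide)
      then show ?thesis using n(2)[OF u] by simp
    qed
    then show ?thesis using vy wy by blast
  qed
qed

section \<open>Separating places by algebraic integers\<close>

context integral_generator
begin

text \<open>Among the relations of fixed length with nonzero leading coefficient, one whose leading
  coefficient is smallest cannot be divisible by p throughout.\<close>

lemma integer_relation:
  assumes p: "p > (1::nat)"
  obtains n c where "(\<Sum>i\<le>n. of_int (c i) * x ^ i) = (0::'k)" "\<exists>i\<le>n. \<not> int p dvd c i"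
proof -
  obtain q where q: "q \<noteq> 0" "ev q x = 0" using number_field_algebraic[OF number_field] by blast
  define n where "n = degree q"
  obtain D :: int where D: "D > 0" "\<And>i. i \<le> n \<Longrightarrow> of_int D * coeff q i \<in> \<int>"
    using rat_common_denominator[of "Suc n" "coeff q"] by (auto simp: less_Suc_eq_le)
  then have "\<forall>i. \<exists>k. i \<le> n \<longrightarrow> of_int D * coeff q i = of_int k" by (metis Ints_cases)
  then obtain c0 where c0: "\<And>i. i \<le> n \<Longrightarrow> of_int D * coeff q i = of_int (c0 i)" by metis
  have "(\<Sum>i\<le>n. of_int (c0 i) * x ^ i) = (\<Sum>i\<le>n. of_int D * (of_rat (coeff q i) * x ^ i))"
  proof (intro sum.cong refl)
    fix i assume "i \<in> {..n}"
    then have "(of_rat (of_int (c0 i)) :: 'k) = of_rat (of_int D * coeff q i)" using c0 by simp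
    then show "of_int (c0 i) * x ^ i = of_int D * (of_rat (coeff q i) * x ^ i)" by (simp add: of_rat_mult)
  qed
  also have "\<dots> = 0" using q(2) by (simp add: ev_altdef[of q n] n_def flip: sum_distrib_left)
  finally have r0: "(\<Sum>i\<le>n. of_int (c0 i) * x ^ i) = 0" .
  have "c0 n \<noteq> 0" using c0[of n] D(1) q(1) by (auto simp: n_def)
  then obtain c where c: "(\<Sum>i\<le>n. of_int (c i) * x ^ i) = 0" "c n \<noteq> 0"
    and min: "\<And>c'. (\<Sum>i\<le>n. of_int (c' i) * x ^ i) = 0 \<Longrightarrow> c' n \<noteq> 0 \<Longrightarrow> nat \<bar>c n\<bar> \<le> nat \<bar>c' n\<bar>"
    using ex_has_least_nat[of "\<lambda>c. (\<Sum>i\<le>n. of_int (c i) * x ^ i) = 0 \<and> c n \<noteq> 0" c0 "\<lambda>c. nat \<bar>c n\<bar>"] r0 by blast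
  have "\<exists>i\<le>n. \<not> int p dvd c i"
  proof (rule ccontr)
    assume "\<not> ?thesis"
    then have dvd: "c i = int p * (c i div int p)" if "i \<le> n" for i using that by auto
    define c' where "c' i = c i div int p" for i
    have "of_nat p * (\<Sum>i\<le>n. of_int (c' i) * x ^ i) = (\<Sum>i\<le>n. of_int (int p * c' i) * x ^ i)"
      by (simp add: sum_distrib_left mult.assoc)
    also have "\<dots> = 0" using c(1) dvd by (simp add: c'_def)
    finally have z: "(\<Sum>i\<le>n. of_int (c' i) * x ^ i) = 0" using p by simp
    have cn: "c n = int p * c' n" using dvd[of n] by (simp add: c'_def)
    then have "c' n \<noteq> 0" using c(2) by auto
    then have "nat \<bar>c n\<bar> \<le> nat \<bar>c' n\<bar>" using min z by blast
    moreover have "1 * \<bar>c' n\<bar> < int p * \<bar>c' n\<bar>" using p \<open>c' n \<noteq> 0\<close> by (intro mult_strict_right_mono) auto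
    ultimately show False by (simp add: cn abs_mult)
  qed
  with c(1) show ?thesis using that by blast
qed

text \<open>If \<open>v x > 1\<close> and \<open>c\<^sub>n x^n + \<dots> + c\<^sub>0 = 0\<close> is primitive at \<open>p\<close>, then the partial Horner sums \<open>s\<^sub>k\<close> of the
  relation satisfy \<open>s\<^sub>k, x s\<^sub>k \<in> Ok\<close>, and some \<open>x s\<^sub>k\<close> is a unit at \<open>v\<close>.\<close>

lemma separator:
  assumes v: "nonarchimedean_place v p" and F: "finite F" "F \<subseteq> nonarchimedean_places" "v \<notin> F"
  shows "\<exists>h\<in>Ok. v h = 1 \<and> (\<forall>u\<in>F. u h < 1)"
proof -
  interpret nonarchimedean_place v p by fact
  obtain x where x: "v x > 1" "\<And>u. u \<in> F \<Longrightarrow> u x < 1" using weak_approximation[OF v F] by blast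
  have "p > 1" using p_gt_1 by simp
  then obtain n c where c: "(\<Sum>i\<le>n. of_int (c i) * x ^ i) = 0" "\<exists>i\<le>n. \<not> int p dvd c i"
    by (rule integer_relation)
  define s where "s = rec_nat (of_int (c n)) (\<lambda>k y. x * y + of_int (c (n - Suc k)))"
  have s0: "s 0 = of_int (c n)" and sS: "s (Suc k) = x * s k + of_int (c (n - Suc k))" for k
    by (simp_all add: s_def)
  \<comment> \<open>\<open>s k\<close> is the leading coefficient after the top powers have been
    absorbed, so the relation shortens to degree n - k.\<close>
  have rel: "s k * x ^ (n - k) + (\<Sum>i<n - k. of_int (c i) * x ^ i) = 0" if "k \<le> n" for k
    using that
  proof (induction k)
    case 0
    show ?case using c(1) by (simp add: s0 add.commute flip: lessThan_Suc_atMost)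
  next
    case (Suc k)
    define d where "d = n - Suc k"
    have d: "n - k = Suc d" using Suc.prems by (simp add: d_def)
    have "s (Suc k) * x ^ d + (\<Sum>i<d. of_int (c i) * x ^ i)
        = s k * x ^ Suc d + (\<Sum>i<Suc d. of_int (c i) * x ^ i)"
      by (simp add: sS d_def[symmetric] algebra_simps)
    also have "\<dots> = 0" using Suc.IH Suc.prems by (simp add: d)
    finally show ?case by (simp add: d_def)
  qed
  \<comment> \<open>Multiplying the shortened relation by a power of \<open>s k\<close> gives a
    monic equation for \<open>x * s k\<close> with integral coefficients.\<close>
  have xs: "x * s k \<in> Ok" if k: "k < n" and sk: "s k \<in> Ok" for k
  proof -
    define d where "d = n - k"
    have "d > 0" using k by (simp add: d_def)
    have "(x * s k) ^ d = s k ^ (d - 1) * (s k * x ^ d)"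
      using \<open>d > 0\<close> by (cases d) (simp_all add: power_mult_distrib)
    also have "s k * x ^ d = - (\<Sum>i<d. of_int (c i) * x ^ i)"
      using rel[of k] k by (simp add: d_def eq_neg_iff_add_eq_0)
    also have "s k ^ (d - 1) * \<dots> = (\<Sum>i<d. (- of_int (c i) * s k ^ (d - 1 - i)) * (x * s k) ^ i)"
    proof -
      have "s k ^ (d - 1) * (of_int (c i) * x ^ i) = of_int (c i) * s k ^ (d - 1 - i) * (x * s k) ^ i"
          if "i < d" for i
      proof -
        have "s k ^ (d - 1) = s k ^ (d - 1 - i) * s k ^ i" using that by (simp flip: power_add)
        then show ?thesis by (simp add: power_mult_distrib mult_ac)
      qed
      then have "(\<Sum>i<d. s k ^ (d - 1) * (of_int (c i) * x ^ i))
          = (\<Sum>i<d. of_int (c i) * s k ^ (d - 1 - i) * (x * s k) ^ i)"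
        by (intro sum.cong refl) simp
      then show ?thesis by (simp only: mult_minus_right mult_minus_left sum_negf sum_distrib_left)
    qed
    finally show ?thesis
    proof (rule Ok_integrally_closed)
      show "- of_int (c i) * s k ^ (d - 1 - i) \<in> Ok" for i
        by (intro unital_subring_mult[OF subring_Ok] unital_subring_minus[OF subring_Ok]
            unital_subring_power[OF subring_Ok] of_int_Ok sk)
    qed (rule \<open>d > 0\<close>)
  qed
  have sk: "s k \<in> Ok" if "k \<le> n" for k
    using that
  proof (induction k)
    case (Suc k)
    then show ?case unfolding sS by (intro unital_subring_add[OF subring_Ok] xs of_int_Ok) simp_all
  qed (simp add: s0 of_int_Ok)
  have small: "v (s k) < 1" if k: "k \<le> n" for k
  proof (cases "k = n")
    case True
    then show ?thesis using rel[of n] by simp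
  next
    case False
    then have "v x * v (s k) \<le> 1" using Ok_nonarchimedean[OF v xs[OF _ sk]] k by (simp add: mult)
    moreover have "v x * 1 \<le> v x * v (s k)" if "v (s k) \<ge> 1" using that by (intro mult_left_mono) auto
    ultimately show ?thesis using x(1) by linarith
  qed
  \<comment> \<open>Every \<open>s k\<close> is a non-unit at v, whereas some coefficient is a unit;
    it is not the leading one, which is \<open>s 0\<close>. The recursion then shows
    \<open>x * s k\<close> to be that coefficient, up to sign and a smaller term.\<close>
  obtain i where i: "i \<le> n" "\<not> int p dvd c i" using c(2) by blast
  have ci: "v (of_int (c i)) = 1" using i by (simp add: v_of_int_eq_1)
  have "i \<noteq> n" using small[of 0] ci by (auto simp: s0)
  define k where "k = n - Suc i"
  have k: "k < n" "n - Suc k = i" using i \<open>i \<noteq> n\<close> by (auto simp: k_def)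
  have "x * s k = - of_int (c i) + s (Suc k)" by (simp add: sS k)
  then have "v (x * s k) = v (- of_int (c i))" using small[of "Suc k"] k ci
      by (simp only:) (intro add_eq_of_less, simp)
  then have "v (x * s k) = 1" using ci by simp
  moreover have "x * s k \<in> Ok" using xs sk k by simp
  moreover have "u (x * s k) < 1" if u: "u \<in> F" for u
  proof -
    have "\<exists>q. nonarchimedean_place u q" using F(2) u nonarchimedean_places_iff by blast
    then obtain q where uq: "nonarchimedean_place u q" by blast
    then interpret u: nonarchimedean_place u q .
    have "u (s k) \<le> 1" using Ok_nonarchimedean[OF uq] sk k by simp
    then have "u x * u (s k) \<le> u x" by (simp add: mult_left_le)
    then show ?thesis using x(2)[OF u] by (simp add: u.mult)
  qed
  ultimately show ?thesis by blast
qed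

section \<open>Counting residues modulo an algebraic integer\<close>

lemma inj_power: "inj_on (\<lambda>j. \<theta> ^ j) {..<\<kappa>}"
  by (rule inj_on_powers) (rule indep)

text \<open>The basis is found among the powers of \<theta>, so its integral combinations are
  algebraic integers.\<close>

lemma local_basis:
  assumes "absolute_value v"
  obtains B where "finite B" "B \<subseteq> Ok" "absolute_value.independent_over_rat v B" "local_degree v = card B"
proof -
  interpret absolute_value v by fact
  define W where "W = (\<lambda>j. \<theta> ^ j) ` {..<\<kappa>}"
  have fin: "finite W" by (simp add: W_def)
  have sp: "\<exists>c. x = (\<Sum>w\<in>W. of_rat (c w) * w)" for x
  proof -
    obtain c where c: "x = (\<Sum>j<\<kappa>. of_rat (c j) * \<theta> ^ j)" using span by blast
    define g where "g = the_inv_into {..<\<kappa>} (\<lambda>j. \<theta> ^ j)"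
    have "(\<Sum>w\<in>W. of_rat (c (g w)) * w) = (\<Sum>j<\<kappa>. of_rat (c j) * \<theta> ^ j)"
      unfolding W_def sum.reindex[OF inj_power] comp_def
      by (intro sum.cong refl) (simp add: g_def the_inv_into_f_f[OF inj_power])
    then have "x = (\<Sum>w\<in>W. of_rat (c (g w)) * w)" by (simp add: c)
    then show ?thesis by (rule exI[of _ "\<lambda>w. c (g w)"])
  qed
  obtain B where B: "B \<subseteq> W" "independent_over_rat B" "dense_over_rat B"
    using exists_independent_dense[OF fin sp] by blast
  have "W \<subseteq> Ok"
    unfolding W_def using Zt_Ok unital_subring_power[OF subring_Zt \<theta>_Zt] by blast
  moreover have "finite B" using B(1) fin by (rule finite_subset)
  ultimately show ?thesis using that B local_degree_eq_card by blast
qed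

text \<open>Combinations of the local basis with digits below p^n stay distinct modulo y as long as
  p^n is at most of the order of 1 / v y. It is essential that K does not depend on y.\<close>

lemma local_residues:
  assumes v: "nonarchimedean_place v p"
  shows "\<exists>K>0. \<forall>y. y \<noteq> 0 \<longrightarrow> (\<exists>Z. finite Z \<and> Z \<subseteq> Ok \<and> (\<forall>z\<in>Z. \<forall>z'\<in>Z. z \<noteq> z' \<longrightarrow> v (z - z') > v y) \<and>
    1 \<le> K * real (card Z) * v y ^ local_degree v)"
proof -
  interpret nonarchimedean_place v p by fact
  obtain B where B: "finite B" "B \<subseteq> Ok" "independent_over_rat B" "local_degree v = card B"
    using local_basis[OF absolute_value_axioms] by blast
  obtain C where C: "C > 0" "\<And>c b. b \<in> B \<Longrightarrow> v (of_rat (c b)) \<le> C * v (\<Sum>b\<in>B. of_rat (c b) * b)"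
    using B(3) unfolding independent_over_rat_def by blast
  have main: "\<exists>Z. finite Z \<and> Z \<subseteq> Ok \<and> (\<forall>z\<in>Z. \<forall>z'\<in>Z. z \<noteq> z' \<longrightarrow> v (z - z') > v y) \<and>
      1 \<le> C ^ card B * real (card Z) * v y ^ card B" if y: "y \<noteq> 0" for y
  proof -
    have Cy: "C * v y > 0" using C(1) y by simp
    obtain n0 where "1 / (C * v y) < real p ^ n0" using real_arch_pow[OF p_gt_1] by blast
    then have ex: "\<exists>n. 1 \<le> C * v y * real p ^ n" using Cy by (auto simp: field_simps intro!: exI[of _ n0])
    \<comment> \<open>The defining inequality gives the count, and minimality gives separation:
      digits differ by less than p^n, so for n > 0 a nonzero difference has absolute value at least
      p^(1-n) > C v y.\<close>
    define n where "n = (LEAST n. 1 \<le> C * v y * real p ^ n)"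
    have n: "1 \<le> C * v y * real p ^ n" unfolding n_def using ex by (rule LeastI_ex)
    have n_min: "C * v y < inverse (real p) ^ k" if "n = Suc k" for k
    proof -
      have "\<not> 1 \<le> C * v y * real p ^ k" using not_less_Least[of k "\<lambda>n. 1 \<le> C * v y * real p ^ n"] that
        by (simp add: n_def)
      then show ?thesis using p_gt_1 by (simp add: field_simps)
    qed
    define A where "A = B \<rightarrow>\<^sub>E {..<p ^ n}"
    define g where "g f = (\<Sum>b\<in>B. of_nat (f b) * b)" for f :: "'k \<Rightarrow> nat"
    have sep: "v (g f - g f') > v y" if ff': "f \<in> A" "f' \<in> A" "f \<noteq> f'" for f f'
    proof -
      obtain b where b: "b \<in> B" "f b \<noteq> f' b" using ff' unfolding A_def by (meson PiE_ext)
      have lt: "f b < p ^ n" "f' b < p ^ n" using ff' b(1) by (auto simp: A_def)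
      have "n \<noteq> 0" using lt b(2) by (cases n) auto
      then obtain k where k: "n = Suc k" by (cases n) auto
      have "\<bar>int (f b) - int (f' b)\<bar> < int p ^ Suc k"
        using lt unfolding k by (simp only: abs_less_iff flip: of_nat_power) linarith
      then have "v (of_int (int (f b) - int (f' b))) \<ge> inverse (real p) ^ k"
        using b(2) by (intro v_of_int_ge) auto
      then have "C * v y < v (of_int (int (f b) - int (f' b)))" using n_min[OF k] by linarith
      also have "\<dots> = v (of_rat (of_int (int (f b) - int (f' b))))" by (simp only: of_rat_of_int_eq)
      also have "\<dots> \<le> C * v (\<Sum>b\<in>B. of_rat (of_int (int (f b) - int (f' b))) * b)"
        by (rule C(2)[OF b(1), of "\<lambda>b. of_int (int (f b) - int (f' b))"])
      also have "(\<Sum>b\<in>B. of_rat (of_int (int (f b) - int (f' b))) * b) = g f - g f'"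
        unfolding of_rat_of_int_eq by (simp add: g_def left_diff_distrib sum_subtractf)
      finally show ?thesis using C(1) by simp
    qed
    have inj: "inj_on g A"
    proof (rule inj_onI, rule ccontr)
      fix f f' assume "f \<in> A" "f' \<in> A" "g f = g f'" "f \<noteq> f'"
      then show False using sep[of f f'] nonneg[of y] by simp
    qed
    have finA: "finite A" unfolding A_def using B(1) by (intro finite_PiE) auto
    have "card (g ` A) = (p ^ n) ^ card B"
      by (simp add: card_image[OF inj]) (simp add: A_def card_PiE B(1))
    then have "C ^ card B * real (card (g ` A)) * v y ^ card B = (C * v y * real p ^ n) ^ card B"
      by (simp add: power_mult_distrib mult_ac)
    also have "\<dots> \<ge> 1" using n by (rule one_le_power)
    finally have "1 \<le> C ^ card B * real (card (g ` A)) * v y ^ card B" .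
    moreover have "g ` A \<subseteq> Ok"
      unfolding g_def using B(2)
      by (auto intro!: unital_subring_sum[OF subring_Ok] unital_subring_mult[OF subring_Ok]
          unital_subring_of_nat[OF subring_Ok])
    moreover have "v (z - z') > v y" if zz': "z \<in> g ` A" "z' \<in> g ` A" "z \<noteq> z'" for z z'
    proof -
      obtain f f' where "f \<in> A" "f' \<in> A" "z = g f" "z' = g f'" using zz'(1,2) by blast
      then show ?thesis using sep[of f f'] zz'(3) by auto
    qed
    ultimately show ?thesis using finA by (intro exI[of _ "g ` A"]) simp
  qed
  have "C ^ card B > 0" using C(1) by simp
  then show ?thesis unfolding B(4) using main by blast
qed

text \<open>A Chinese remainder argument with high powers of separators. Residues have to be
  separated but not prescribed, so it is enough that \<open>h v\<close> is a unit at v and small at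
  the other places of F, without any congruence to 1.\<close>

lemma residues:
  assumes F: "finite F" "F \<subseteq> nonarchimedean_places"
  shows "\<exists>K>0. \<forall>y\<in>Ok. y \<noteq> 0 \<longrightarrow> (\<exists>Z. finite Z \<and> Z \<subseteq> Ok \<and>
      (\<forall>z\<in>Z. \<forall>z'\<in>Z. z \<noteq> z' \<longrightarrow> (\<exists>v\<in>F. v (z - z') > v y)) \<and>
      1 \<le> K * real (card Z) * (\<Prod>v\<in>F. v y ^ local_degree v))"
proof -
  have place: "\<exists>p. nonarchimedean_place v p" if "v \<in> F" for v
    using F(2) that nonarchimedean_places_iff by blast
  define good where "good v y K Z \<longleftrightarrow> finite Z \<and> Z \<subseteq> Ok \<and> (\<forall>z\<in>Z. \<forall>z'\<in>Z. z \<noteq> z' \<longrightarrow> v (z - z') > v y) \<and>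
    1 \<le> K * real (card Z) * v y ^ local_degree v" for v :: "'k \<Rightarrow> real" and y K Z
  have "\<forall>v\<in>F. \<exists>K>0. \<forall>y. y \<noteq> 0 \<longrightarrow> (\<exists>Z. good v y K Z)"
    unfolding good_def using place local_residues by blast
  from bchoice[OF this] obtain K where K0: "\<forall>v\<in>F. K v > 0 \<and> (\<forall>y. y \<noteq> 0 \<longrightarrow> (\<exists>Z. good v y (K v) Z))" ..
  then have K: "\<And>v. v \<in> F \<Longrightarrow> K v > 0" by simp
  have ex_h: "\<forall>v\<in>F. \<exists>h. h \<in> Ok \<and> v h = 1 \<and> (\<forall>u\<in>F - {v}. u h < 1)"
  proof
    fix v assume "v \<in> F"
    then obtain p where "nonarchimedean_place v p" using place by blast
    from separator[OF this, of "F - {v}"] F show "\<exists>h. h \<in> Ok \<and> v h = 1 \<and> (\<forall>u\<in>F - {v}. u h < 1)" by blast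
  qed
  from bchoice[OF ex_h] obtain h where h0: "\<forall>v\<in>F. h v \<in> Ok \<and> v (h v) = 1 \<and> (\<forall>u\<in>F - {v}. u (h v) < 1)" ..
  then have h: "\<And>v. v \<in> F \<Longrightarrow> h v \<in> Ok" "\<And>v. v \<in> F \<Longrightarrow> v (h v) = 1"
    "\<And>v u. v \<in> F \<Longrightarrow> u \<in> F \<Longrightarrow> u \<noteq> v \<Longrightarrow> u (h v) < 1" by simp_all
  have main: "\<exists>Z. finite Z \<and> Z \<subseteq> Ok \<and> (\<forall>z\<in>Z. \<forall>z'\<in>Z. z \<noteq> z' \<longrightarrow> (\<exists>v\<in>F. v (z - z') > v y)) \<and>
      1 \<le> (\<Prod>v\<in>F. K v) * real (card Z) * (\<Prod>v\<in>F. v y ^ local_degree v)"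
    if y: "y \<in> Ok" "y \<noteq> 0" for y
  proof -
    have "\<forall>v\<in>F. \<exists>Z. good v y (K v) Z" using K0 y(2) by simp
    from bchoice[OF this] obtain Z where Z0: "\<forall>v\<in>F. good v y (K v) (Z v)" ..
    have Z: "\<And>v. v \<in> F \<Longrightarrow> finite (Z v)" "\<And>v. v \<in> F \<Longrightarrow> Z v \<subseteq> Ok"
      "\<And>v z z'. v \<in> F \<Longrightarrow> z \<in> Z v \<Longrightarrow> z' \<in> Z v \<Longrightarrow> z \<noteq> z' \<Longrightarrow> v (z - z') > v y"
      "\<And>v. v \<in> F \<Longrightarrow> 1 \<le> K v * real (card (Z v)) * v y ^ local_degree v"
      using Z0 unfolding good_def by simp_all
    have "\<forall>\<^sub>F N in sequentially. \<forall>v\<in>F. \<forall>u\<in>F. u \<noteq> v \<longrightarrow> u (h v) ^ N < u y"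
    proof (intro eventually_ball_finite[OF F(1)] ballI)
      fix v u assume vu: "v \<in> F" "u \<in> F"
      obtain q where "nonarchimedean_place u q" using place vu by blast
      then interpret nonarchimedean_place u q .
      show "\<forall>\<^sub>F N in sequentially. u \<noteq> v \<longrightarrow> u (h v) ^ N < u y"
      proof (cases "u = v")
        case False
        then have "(\<lambda>N. u (h v) ^ N) \<longlonglongrightarrow> 0" using h(3)[OF vu] by (intro LIMSEQ_power_zero) simp
        then have "\<forall>\<^sub>F N in sequentially. u (h v) ^ N < u y" using y(2) by (intro order_tendstoD) auto
        then show ?thesis by (rule eventually_mono) simp
      qed simp
    qed
    then obtain N where N: "\<And>v u. v \<in> F \<Longrightarrow> u \<in> F \<Longrightarrow> u \<noteq> v \<Longrightarrow> u (h v) ^ N < u y"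
      using eventually_happens by fastforce
    define g where "g f = (\<Sum>v\<in>F. h v ^ N * f v)" for f :: "('k \<Rightarrow> real) \<Rightarrow> 'k"
    define A where "A = Pi\<^sub>E F Z"
    have sep: "\<exists>v\<in>F. v (g f - g f') > v y" if ff': "f \<in> A" "f' \<in> A" "f \<noteq> f'" for f f'
    proof -
      obtain v where v: "v \<in> F" "f v \<noteq> f' v" using ff' unfolding A_def by (meson PiE_ext)
      obtain p where vp: "nonarchimedean_place v p" using place v by blast
      then interpret nonarchimedean_place v p .
      have fZ: "f u \<in> Z u" "f' u \<in> Z u" if "u \<in> F" for u using ff' that by (auto simp: A_def)
      have "g f - g f' = (\<Sum>u\<in>F. h u ^ N * (f u - f' u))"
        by (simp add: g_def right_diff_distrib sum_subtractf)
      also have "\<dots> = h v ^ N * (f v - f' v) + (\<Sum>u\<in>F - {v}. h u ^ N * (f u - f' u))"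
        using F(1) v(1) by (simp add: sum.remove)
      finally have eq: "g f - g f' = h v ^ N * (f v - f' v) + (\<Sum>u\<in>F - {v}. h u ^ N * (f u - f' u))" .
      have main: "v (h v ^ N * (f v - f' v)) > v y"
        using h(2)[OF v(1)] Z(3)[OF v(1) fZ[OF v(1)] v(2)] by (simp add: mult power)
      have rest: "v (\<Sum>u\<in>F - {v}. h u ^ N * (f u - f' u)) \<le> v y"
      proof (rule sum_le_bound)
        fix u assume u: "u \<in> F - {v}"
        then have uF: "u \<in> F" by simp
        have "f u - f' u \<in> Ok" using fZ[OF uF] Z(2)[OF uF] unital_subring_diff[OF subring_Ok] by blast
        then have "v (f u - f' u) \<le> 1" by (rule Ok_nonarchimedean[OF vp])
        moreover have "v (h u) ^ N < v y" using N[of u v] u v(1) by auto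
        ultimately have "v (h u) ^ N * v (f u - f' u) \<le> v y * 1" by (intro mult_mono) auto
        then show "v (h u ^ N * (f u - f' u)) \<le> v y" by (simp add: mult power)
      qed simp
      have "v (g f - g f') = v (h v ^ N * (f v - f' v))"
        unfolding eq by (rule add_eq_of_less) (use main rest in linarith)
      then show ?thesis using main v(1) by metis
    qed
    have inj: "inj_on g A"
    proof (rule inj_onI, rule ccontr)
      fix f f' assume ff: "f \<in> A" "f' \<in> A" "g f = g f'" "f \<noteq> f'"
      then obtain v where v: "v \<in> F" "v (g f - g f') > v y" using sep by blast
      obtain p where "nonarchimedean_place v p" using place v by blast
      then interpret nonarchimedean_place v p .
      show False using v(2) ff(3) nonneg[of y] by simp
    qed
    have finA: "finite A" unfolding A_def using F(1) Z(1) by (intro finite_PiE) auto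
    have cardA: "card (g ` A) = (\<Prod>v\<in>F. card (Z v))"
      by (simp add: card_image[OF inj]) (simp add: A_def card_PiE F(1))
    have "1 \<le> (\<Prod>v\<in>F. K v * real (card (Z v)) * v y ^ local_degree v)"
      using Z(4) by (intro prod_ge_1) auto
    then have "1 \<le> (\<Prod>v\<in>F. K v) * real (card (g ` A)) * (\<Prod>v\<in>F. v y ^ local_degree v)"
      by (simp add: cardA prod.distrib)
    moreover have "g ` A \<subseteq> Ok"
    proof
      fix z assume "z \<in> g ` A"
      then obtain f where f: "f \<in> A" "z = g f" by blast
      have "f v \<in> Ok" if "v \<in> F" for v using f(1) Z(2)[OF that] that by (auto simp: A_def)
      then show "z \<in> Ok" unfolding f(2) g_def
        by (intro unital_subring_sum[OF subring_Ok] unital_subring_mult[OF subring_Ok]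
            unital_subring_power[OF subring_Ok] h(1))
    qed
    moreover have "\<exists>v\<in>F. v (z - z') > v y" if zz': "z \<in> g ` A" "z' \<in> g ` A" "z \<noteq> z'" for z z'
    proof -
      obtain f f' where "f \<in> A" "f' \<in> A" "z = g f" "z' = g f'" using zz'(1,2) by blast
      then show ?thesis using sep[of f f'] zz'(3) by auto
    qed
    ultimately show ?thesis using finA by (intro exI[of _ "g ` A"]) simp
  qed
  have "(\<Prod>v\<in>F. K v) > 0" using K by (rule prod_pos)
  then show ?thesis by (intro exI[of _ "\<Prod>v\<in>F. K v"] conjI ballI impI main)
qed

end

section \<open>Archimedean places\<close>

lemma rat_near: "e > 0 \<Longrightarrow> \<exists>q::rat. \<bar>r - of_rat q\<bar> < (e::real)"
  using of_rat_dense[of "r - e" "r + e"] by (metis abs_diff_less_iff add_diff_cancel diff_add_cancel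
      diff_less_eq less_add_same_cancel1 less_trans abs_minus_commute)

lemma of_real_of_rat: "of_real (of_rat q) = (of_rat q :: complex)"
  by (cases q) (simp add: of_rat_rat)

definition embedding_degree :: "('k \<Rightarrow> complex) \<Rightarrow> nat" where
  "embedding_degree \<sigma> = (if \<forall>x. \<sigma> x \<in> \<real> then 1 else 2)"

context embedded_field
begin

lemma cmod_of_rat: "cmod (of_rat q) = \<bar>of_rat q\<bar>"
  using norm_of_real[of "of_rat q", where 'a = complex] unfolding of_real_of_rat .

lemma local_degree_real:
  assumes "\<forall>x. \<sigma> x \<in> \<real>"
  shows "local_degree (\<lambda>x. cmod (\<sigma> x)) = 1"
proof -
  have "independent_over_rat {1}"
    unfolding independent_over_rat_def by (intro exI[of _ 1]) simp
  moreover have "dense_over_rat {1}"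
    unfolding dense_over_rat_def
  proof (intro allI impI)
    fix x and e :: real assume "e > 0"
    then obtain q :: rat where q: "\<bar>Re (\<sigma> x) - of_rat q\<bar> < e" using rat_near by blast
    have "\<sigma> x = of_real (Re (\<sigma> x))" using assms by (simp add: of_real_Re)
    then have "\<sigma> (x - of_rat q) = of_real (Re (\<sigma> x) - of_rat q)"
      by (metis hom_diff hom_of_rat of_real_diff of_real_of_rat)
    then have "cmod (\<sigma> (x - of_rat q)) = \<bar>Re (\<sigma> x) - of_rat q\<bar>" by (simp only: norm_of_real)
    then show "\<exists>c. cmod (\<sigma> (x - (\<Sum>b\<in>{1}. of_rat (c b) * b))) < e"
      using q by (intro exI[of _ "\<lambda>_. q"]) simp
  qed
  ultimately show ?thesis using local_degree_eq_card[of "{1}"] by simp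
qed

lemma local_degree_complex:
  assumes "\<sigma> x0 \<notin> \<real>"
  shows "local_degree (\<lambda>x. cmod (\<sigma> x)) = 2"
proof -
  define t where "t = \<sigma> x0"
  have im: "Im t \<noteq> 0" using assms by (simp add: t_def complex_is_Real_iff)
  have ne: "1 \<noteq> x0" using assms by auto
  have sum: "(\<Sum>b\<in>{1, x0}. of_rat (c b) * b) = of_rat (c 1) + of_rat (c x0) * x0" for c
    using ne by simp
  have hom: "\<sigma> (of_rat p + of_rat q * x0) = of_real (of_rat p) + of_real (of_rat q) * t" for p q
    by (simp add: hom_add hom_mult hom_of_rat t_def of_real_of_rat)
  have "independent_over_rat {1, x0}"
    unfolding independent_over_rat_def
  proof (intro exI conjI allI ballI)
    \<comment> \<open>Solving for the coordinates: |c x0| is at most |z| / |Im t|, and |c 1| is at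
      most |z| + |c x0| |t|.\<close>
    define C where "C = 1 + (1 + cmod t) / \<bar>Im t\<bar>"
    show "C > 0" by (auto simp: C_def intro!: add_pos_nonneg)
    fix c b assume b: "b \<in> {1, x0}"
    define z where "z = of_real (of_rat (c 1)) + of_real (of_rat (c x0)) * t"
    have "Im z = of_rat (c x0) * Im t" by (simp add: z_def)
    then have "\<bar>of_rat (c x0)\<bar> * \<bar>Im t\<bar> \<le> cmod z" using abs_Im_le_cmod[of z] by (simp add: abs_mult)
    then have c2: "\<bar>of_rat (c x0)\<bar> \<le> cmod z / \<bar>Im t\<bar>" using im by (simp add: field_simps)
    have "of_real (of_rat (c 1)) = z - of_real (of_rat (c x0)) * t" by (simp add: z_def)
    then have "cmod (of_real (of_rat (c 1))) \<le> cmod z + cmod (of_real (of_rat (c x0)) * t)"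
      by (metis norm_triangle_ineq4)
    then have "\<bar>of_rat (c 1)\<bar> \<le> cmod z + \<bar>of_rat (c x0)\<bar> * cmod t" by (simp add: norm_mult)
    also have "\<dots> \<le> cmod z + cmod z / \<bar>Im t\<bar> * cmod t" using c2 by (intro add_left_mono mult_right_mono) auto
    finally have c1: "\<bar>of_rat (c 1)\<bar> \<le> cmod z + cmod z / \<bar>Im t\<bar> * cmod t" .
    have C: "C * cmod z = cmod z + cmod z / \<bar>Im t\<bar> + cmod z / \<bar>Im t\<bar> * cmod t"
      by (simp add: C_def field_simps add_divide_distrib)
    have "0 \<le> cmod z / \<bar>Im t\<bar>" "0 \<le> cmod z / \<bar>Im t\<bar> * cmod t" "0 \<le> cmod z" by auto
    then have "\<bar>of_rat (c 1)\<bar> \<le> C * cmod z" "\<bar>of_rat (c x0)\<bar> \<le> C * cmod z"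
      using c1 c2 unfolding C by linarith+
    then have "\<bar>of_rat (c b)\<bar> \<le> C * cmod z" using b by blast
    then show "cmod (\<sigma> (of_rat (c b))) \<le> C * cmod (\<sigma> (\<Sum>b\<in>{1, x0}. of_rat (c b) * b))"
      unfolding sum hom z_def by (simp add: hom_of_rat cmod_of_rat)
  qed
  moreover have "dense_over_rat {1, x0}"
    unfolding dense_over_rat_def
  proof (intro allI impI)
    fix x and e :: real assume e: "e > 0"
    define r2 where "r2 = Im (\<sigma> x) / Im t"
    define r1 where "r1 = Re (\<sigma> x) - r2 * Re t"
    have rx: "\<sigma> x = of_real r1 + of_real r2 * t"
      using im by (simp add: complex_eq_iff r1_def r2_def)
    have "e / 2 > 0" "e / (2 * (1 + cmod t)) > 0" using e
        by (auto intro!: divide_pos_pos mult_pos_pos add_pos_nonneg)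
    then obtain q1 q2 :: rat where q: "\<bar>r1 - of_rat q1\<bar> < e / 2" "\<bar>r2 - of_rat q2\<bar> < e / (2 * (1 + cmod t))"
      using rat_near by metis
    have "\<sigma> (x - (of_rat q1 + of_rat q2 * x0)) = of_real (r1 - of_rat q1) + of_real (r2 - of_rat q2) * t"
      unfolding hom_diff hom rx by (simp add: algebra_simps)
    then have "cmod (\<sigma> (x - (of_rat q1 + of_rat q2 * x0))) \<le> \<bar>r1 - of_rat q1\<bar> + \<bar>r2 - of_rat q2\<bar> * cmod t"
      by (metis norm_triangle_ineq norm_mult norm_of_real)
    also have "\<dots> < e / 2 + e / (2 * (1 + cmod t)) * (1 + cmod t)"
      using q by (intro add_less_le_mono mult_mono) auto
    also have "\<dots> = e"
    proof -
      have "1 + cmod t \<noteq> 0" by (metis add.commute add_nonneg_eq_0_iff norm_ge_zero zero_le_one zero_neq_one)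
      then show ?thesis by (simp add: field_simps)
    qed
    finally have fin: "cmod (\<sigma> (x - (of_rat q1 + of_rat q2 * x0))) < e" .
    show "\<exists>c. cmod (\<sigma> (x - (\<Sum>b\<in>{1, x0}. of_rat (c b) * b))) < e"
      unfolding sum by (rule exI[of _ "\<lambda>b. if b = 1 then q1 else q2"]) (use fin ne in simp)
  qed
  ultimately show ?thesis using local_degree_eq_card[of "{1, x0}"] ne by simp
qed

lemma local_degree_embedding: "local_degree (\<lambda>x. cmod (\<sigma> x)) = embedding_degree \<sigma>"
  using local_degree_real local_degree_complex by (auto simp: embedding_degree_def)

end

context integral_generator
begin

lemma archimedean_places_eq: "archimedean_places = (\<lambda>\<sigma> x. cmod (\<sigma> x)) ` Emb"
  unfolding archimedean_places_def Emb_def by blast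

lemma finite_archimedean_places: "finite (archimedean_places :: ('k \<Rightarrow> real) set)"
  unfolding archimedean_places_eq using finite_Emb by simp

lemma embedded_field_Emb: "\<sigma> \<in> Emb \<Longrightarrow> embedded_field \<sigma>"
  by unfold_locales (simp add: Emb_def)

lemma archimedean_place_cases:
  assumes "w \<in> archimedean_places"
  obtains \<sigma> where "\<sigma> \<in> Emb" "w = (\<lambda>x. cmod (\<sigma> x))" "embedded_field \<sigma>" "local_degree w = embedding_degree \<sigma>"
proof -
  obtain \<sigma> where s: "\<sigma> \<in> Emb" "w = (\<lambda>x. cmod (\<sigma> x))" using assms unfolding archimedean_places_eq by blast
  interpret embedded_field \<sigma> using embedded_field_Emb[OF s(1)] .
  show ?thesis using that[OF s embedded_field_axioms] local_degree_embedding s(2) by blast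
qed

lemma absolute_value_archimedean:
  fixes w :: "'k \<Rightarrow> real"
  shows "w \<in> archimedean_places \<Longrightarrow> absolute_value w"
proof -
  assume "w \<in> archimedean_places"
  then obtain \<sigma> where s: "w = (\<lambda>x. cmod (\<sigma> x))" "embedded_field \<sigma>"
    using archimedean_place_cases[of w] by blast
  interpret embedded_field \<sigma> by (rule s(2))
  show ?thesis unfolding s(1) by (rule absolute_value_axioms)
qed

text \<open>A non-real embedding and its conjugate give the same place, so over each place there are
  at least as many embeddings as the local degree.\<close>

lemma sum_local_degree: "(\<Sum>w\<in>archimedean_places. local_degree (w :: 'k \<Rightarrow> real)) \<le> \<kappa>"
proof -
  define A where "A = (archimedean_places :: ('k \<Rightarrow> real) set)"
  define fib where "fib w = {\<sigma> \<in> Emb. (\<lambda>x. cmod (\<sigma> x)) = w}" for w :: "'k \<Rightarrow> real"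
  have finA: "finite A" by (simp add: A_def finite_archimedean_places)
  have ff: "finite (fib w)" for w unfolding fib_def using finite_Emb by simp
  have "local_degree w \<le> card (fib w)" if w: "w \<in> A" for w
  proof -
    obtain \<sigma> where s: "\<sigma> \<in> Emb" "w = (\<lambda>x. cmod (\<sigma> x))" "local_degree w = embedding_degree \<sigma>"
      using archimedean_place_cases[of w] w unfolding A_def by blast
    show ?thesis
    proof (cases "\<forall>x. \<sigma> x \<in> \<real>")
      case True
      have "\<sigma> \<in> fib w" using s by (simp add: fib_def)
      then have "card (fib w) \<ge> 1" using ff by (metis One_nat_def Suc_leI card_gt_0_iff empty_iff)
      then show ?thesis using s(3) True by (simp add: embedding_degree_def)
    next
      case False
      then obtain x0 where x0: "\<sigma> x0 \<notin> \<real>" by blast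
      define \<tau> where "\<tau> x = cnj (\<sigma> x)" for x
      have "\<tau> \<in> Emb" using s(1) by (auto simp: Emb_def complex_embedding_def \<tau>_def)
      then have sub: "{\<sigma>, \<tau>} \<subseteq> fib w" using s by (auto simp: fib_def \<tau>_def)
      have "\<tau> \<noteq> \<sigma>"
      proof
        assume "\<tau> = \<sigma>"
        then have "cnj (\<sigma> x0) = \<sigma> x0" by (simp add: \<tau>_def fun_eq_iff)
        then show False using x0 by (simp add: Reals_cnj_iff)
      qed
      then have "card {\<sigma>, \<tau>} = 2" by simp
      then have "2 \<le> card (fib w)" using card_mono[OF ff sub] by simp
      then show ?thesis using s(3) False by (simp add: embedding_degree_def)
    qed
  qed
  then have "(\<Sum>w\<in>A. local_degree w) \<le> (\<Sum>w\<in>A. card (fib w))" by (intro sum_mono) auto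
  also have "\<dots> = card (\<Union>w\<in>A. fib w)"
    using finA ff by (intro card_UN_disjoint[symmetric]) (auto simp: fib_def)
  also have "\<dots> \<le> card Emb" using finite_Emb by (intro card_mono) (auto simp: fib_def)
  finally show ?thesis by (simp add: A_def card_Emb)
qed

lemma local_degree_archimedean:
  assumes "w \<in> archimedean_places" shows "1 \<le> local_degree (w :: 'k \<Rightarrow> real)" "local_degree w \<le> \<kappa>"
proof -
  have "\<exists>\<sigma>::'k \<Rightarrow> complex. local_degree w = embedding_degree \<sigma>"
    by (rule archimedean_place_cases[OF assms]) (rule exI)
  then show "1 \<le> local_degree w" by (auto simp: embedding_degree_def)
  have "local_degree w \<le> (\<Sum>w\<in>archimedean_places. local_degree (w :: 'k \<Rightarrow> real))"
    using assms by (rule member_le_sum) (simp_all add: finite_archimedean_places)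
  then show "local_degree w \<le> \<kappa>" using sum_local_degree by linarith
qed

section \<open>The product formula as an inequality\<close>

text \<open>Real and imaginary parts are cut into intervals of length 1/2; two algebraic integers in
  one cell differ by one whose conjugates are all below 1, hence agree. At a real embedding only one
  coordinate varies, so the exponent is the local degree.\<close>

lemma box_count:
  assumes Q: "finite Q" "Q \<subseteq> Ok" and T: "\<And>x w. x \<in> Q \<Longrightarrow> w \<in> archimedean_places \<Longrightarrow> w x \<le> T w"
    and T0: "\<And>w. w \<in> archimedean_places \<Longrightarrow> T w \<ge> 0"
  shows "real (card Q) \<le> (\<Prod>w\<in>archimedean_places. (4 * T w + 2) ^ local_degree w)"
proof -
  define A where "A = (archimedean_places :: ('k \<Rightarrow> real) set)"
  have finA: "finite A" by (simp add: A_def finite_archimedean_places)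
  have "\<forall>w\<in>A. \<exists>\<sigma>. \<sigma> \<in> Emb \<and> w = (\<lambda>x. cmod (\<sigma> x)) \<and> local_degree w = embedding_degree \<sigma>"
    unfolding A_def using archimedean_place_cases by metis
  from bchoice[OF this] obtain s where
    s0: "\<forall>w\<in>A. s w \<in> Emb \<and> w = (\<lambda>x. cmod (s w x)) \<and> local_degree w = embedding_degree (s w)" ..
  have s: "s w \<in> Emb" "w x = cmod (s w x)" "local_degree w = embedding_degree (s w)" if "w \<in> A" for w x
    using s0 that by (metis (mono_tags, lifting))+
  \<comment> \<open>At most 4 T w + 2 integers: 4 T w from the length, one for the endpoints and one
    for rounding.\<close>
  define I where "I w = {\<lfloor>- 2 * T w\<rfloor>..\<lfloor>2 * T w\<rfloor>}" for w
  define J where "J w = (if \<forall>x. s w x \<in> \<real> then I w \<times> {0} else I w \<times> I w)" for w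
  define cell where "cell x = (\<lambda>w\<in>A. (\<lfloor>2 * Re (s w x)\<rfloor>, \<lfloor>2 * Im (s w x)\<rfloor>))" for x
  have "cell x \<in> Pi\<^sub>E A J" if x: "x \<in> Q" for x
    unfolding cell_def
  proof (rule restrict_PiE_iff[THEN iffD2], rule ballI)
    fix w assume w: "w \<in> A"
    have le: "cmod (s w x) \<le> T w" using T[OF x, of w] w s(2)[OF w, of x] by (simp add: A_def)
    then have "\<bar>Re (s w x)\<bar> \<le> T w" "\<bar>Im (s w x)\<bar> \<le> T w"
      using abs_Re_le_cmod[of "s w x"] abs_Im_le_cmod[of "s w x"] by linarith+
    then have "\<lfloor>2 * Re (s w x)\<rfloor> \<in> I w" "\<lfloor>2 * Im (s w x)\<rfloor> \<in> I w"
      unfolding I_def by (auto intro!: floor_mono)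
    moreover have "Im (s w x) = 0" if "\<forall>x. s w x \<in> \<real>" using that by (simp add: complex_is_Real_iff)
    ultimately show "(\<lfloor>2 * Re (s w x)\<rfloor>, \<lfloor>2 * Im (s w x)\<rfloor>) \<in> J w" by (simp add: J_def)
  qed
  then have img: "cell ` Q \<subseteq> Pi\<^sub>E A J" by blast
  have finJ: "finite (J w)" for w by (simp add: J_def I_def)
  have inj: "inj_on cell Q"
  proof (rule inj_onI)
    fix x y assume xy: "x \<in> Q" "y \<in> Q" "cell x = cell y"
    have "x - y = 0"
    proof (rule Ok_discrete)
      show "x - y \<in> Ok" using xy Q(2) unital_subring_diff[OF subring_Ok] by blast
      fix \<sigma> assume sig: "\<sigma> \<in> Emb"
      define w where "w = (\<lambda>x. cmod (\<sigma> x))"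
      have w: "w \<in> A" using sig by (auto simp: A_def archimedean_places_eq w_def)
      interpret embedded_field "s w" using embedded_field_Emb[OF s(1)[OF w]] .
      have "cell x w = cell y w" using xy(3) by simp
      then have "\<lfloor>2 * Re (s w x)\<rfloor> = \<lfloor>2 * Re (s w y)\<rfloor>" "\<lfloor>2 * Im (s w x)\<rfloor> = \<lfloor>2 * Im (s w y)\<rfloor>"
        using w by (simp_all add: cell_def)
      then have "\<bar>2 * Re (s w x) - 2 * Re (s w y)\<bar> < 1" "\<bar>2 * Im (s w x) - 2 * Im (s w y)\<bar> < 1"
        by linarith+
      then have "\<bar>Re (s w (x - y))\<bar> + \<bar>Im (s w (x - y))\<bar> < 1" by (simp add: hom_diff)
      then have "cmod (s w (x - y)) < 1" using cmod_le[of "s w (x - y)"] by linarith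
      then show "cmod (\<sigma> (x - y)) < 1" using s(2)[OF w, of "x - y"] by (simp add: w_def)
    qed
    then show "x = y" by simp
  qed
  have cI: "real (card (I w)) \<le> 4 * T w + 2" if "w \<in> A" for w
  proof -
    have "T w \<ge> 0" using T0 that by (simp add: A_def)
    then have "\<lfloor>- 2 * T w\<rfloor> \<le> \<lfloor>2 * T w\<rfloor>" by (intro floor_mono) simp
    then have "real (card (I w)) = of_int (\<lfloor>2 * T w\<rfloor> - \<lfloor>- 2 * T w\<rfloor> + 1)" by (simp add: I_def)
    then show ?thesis by linarith
  qed
  have "real (card Q) = real (card (cell ` Q))" using card_image[OF inj] by simp
  also have "\<dots> \<le> real (card (Pi\<^sub>E A J))"
    using card_mono[OF finite_PiE[OF finA finJ] img] by simp
  also have "\<dots> = (\<Prod>w\<in>A. real (card (J w)))" by (simp add: card_PiE[OF finA])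
  also have "\<dots> \<le> (\<Prod>w\<in>A. (4 * T w + 2) ^ local_degree w)"
  proof (rule prod_mono)
    fix w assume w: "w \<in> A"
    have "real (card (I w)) * real (card (I w)) \<le> (4 * T w + 2) * (4 * T w + 2)"
      using cI[OF w] by (intro mult_mono) auto
    then show "0 \<le> real (card (J w)) \<and> real (card (J w)) \<le> (4 * T w + 2) ^ local_degree w"
      using cI[OF w] by (simp add: s(3)[OF w] J_def embedding_degree_def card_cartesian_product
          power2_eq_square)
  qed
  finally show ?thesis by (simp add: A_def)
qed

text \<open>With H the side of the box, both counts are divided by H^\<kappa>. As H grows the size R
  of the fixed residues disappears and only 4 C w y remains at each Archimedean place. The resulting
  constant depends on F but not on y.\<close>

lemma product_inequality_constant:
  fixes F :: "('k \<Rightarrow> real) set"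
  assumes F: "finite F" "F \<subseteq> nonarchimedean_places"
  shows "\<exists>K>0. \<forall>y\<in>Ok. y \<noteq> 0 \<longrightarrow>
    1 \<le> K * (\<Prod>w\<in>archimedean_places. w y ^ local_degree w) * (\<Prod>v\<in>F. v y ^ local_degree v)"
proof -
  define A where "A = (archimedean_places :: ('k \<Rightarrow> real) set)"
  have finA: "finite A" by (simp add: A_def finite_archimedean_places)
  have av: "absolute_value w" if "w \<in> A" for w using that absolute_value_archimedean by (simp add: A_def)
  have nn: "w x \<ge> 0" if "w \<in> A" for w x using absolute_value.nonneg[OF av[OF that]] .
  obtain K where K: "K > 0" and res: "\<forall>y\<in>Ok. y \<noteq> 0 \<longrightarrow> (\<exists>Z. finite Z \<and> Z \<subseteq> Ok \<and>
      (\<forall>z\<in>Z. \<forall>z'\<in>Z. z \<noteq> z' \<longrightarrow> (\<exists>v\<in>F. v (z - z') > v y)) \<and>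
      1 \<le> K * real (card Z) * (\<Prod>v\<in>F. v y ^ local_degree v))"
    using residues[OF F] by (elim exE conjE)
  \<comment> \<open>C H bounds every element of the box at every Archimedean place.\<close>
  define C where "C = 1 + (\<Sum>w\<in>A. \<Sum>j<\<kappa>. w \<theta> ^ j)"
  have C1: "C \<ge> 1" unfolding C_def using nn by (auto intro!: sum_nonneg)
  define K' where "K' = K * (\<Prod>w\<in>A. (4 * C) ^ local_degree w)"
  have K': "K' > 0" using K C1 by (auto simp: K'_def intro!: mult_pos_pos prod_pos)
  have main: "1 \<le> K' * (\<Prod>w\<in>A. w y ^ local_degree w) * (\<Prod>v\<in>F. v y ^ local_degree v)"
    if y: "y \<in> Ok" "y \<noteq> 0" for y
  proof -
    obtain Z where Z: "finite Z" "Z \<subseteq> Ok" "\<forall>z\<in>Z. \<forall>z'\<in>Z. z \<noteq> z' \<longrightarrow> (\<exists>v\<in>F. v (z - z') > v y)"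
      and cZ: "1 \<le> K * real (card Z) * (\<Prod>v\<in>F. v y ^ local_degree v)"
      using res[rule_format, OF y] by (elim exE conjE)
    define R where "R = (\<Sum>w\<in>A. \<Sum>z\<in>Z. w z)"
    have R0: "R \<ge> 0" unfolding R_def using nn by (intro sum_nonneg) auto
    have R: "w z \<le> R" if "w \<in> A" "z \<in> Z" for w z
    proof -
      have "w z \<le> (\<Sum>z\<in>Z. w z)" using that nn Z(1) by (intro member_le_sum) auto
      also have "\<dots> \<le> R" unfolding R_def using that nn finA by (intro member_le_sum) (auto intro: sum_nonneg)
      finally show ?thesis .
    qed
    have count: "real (card Z) \<le> (\<Prod>w\<in>A. ((4 * R + 2) / real H + 4 * C * w y) ^ local_degree w)"
      if H: "H > 0" for H :: nat
    proof -
      define S where "S = ({..<\<kappa>} \<rightarrow>\<^sub>E {..<H})"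
      define e where "e f = (\<Sum>j<\<kappa>. of_nat (f j) * \<theta> ^ j)" for f :: "nat \<Rightarrow> nat"
      define P where "P = (\<lambda>(z, f). z + y * e f)"
      have eOk: "e f \<in> Ok" for f
      proof -
        have "e f \<in> Zt" unfolding e_def
          by (intro unital_subring_sum[OF subring_Zt] unital_subring_mult[OF subring_Zt]
              unital_subring_of_nat[OF subring_Zt] unital_subring_power[OF subring_Zt] \<theta>_Zt)
        then show ?thesis using Zt_Ok by blast
      qed
      have inj_e: "f = f'" if ff': "f \<in> S" "f' \<in> S" "e f = e f'" for f f'
      proof -
        have "(\<Sum>j<\<kappa>. of_rat (of_nat (f j) - of_nat (f' j)) * \<theta> ^ j) = e f - e f'"
          by (simp add: e_def of_rat_diff left_diff_distrib sum_subtractf)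
        then have "(\<Sum>j<\<kappa>. of_rat (of_nat (f j) - of_nat (f' j)) * \<theta> ^ j) = 0" using ff'(3) by simp
        from indep[OF this] have "f j = f' j" if "j \<in> {..<\<kappa>}" for j using that by simp
        then show ?thesis using ff'(1,2) unfolding S_def by (intro PiE_ext)
      qed
      have inj: "inj_on P (Z \<times> S)"
      proof (rule inj_onI)
        fix a b assume ab: "a \<in> Z \<times> S" "b \<in> Z \<times> S" "P a = P b"
        obtain z f z' f' where zf: "a = (z, f)" "b = (z', f')" by (cases a, cases b)
        have mem: "z \<in> Z" "z' \<in> Z" "f \<in> S" "f' \<in> S" using ab zf by auto
        have "z + y * e f = z' + y * e f'" using ab(3) zf by (simp add: P_def)
        then have eq: "z - z' = y * (e f' - e f)" by (simp add: algebra_simps)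
        \<comment> \<open>A multiple of y by an algebraic integer is at most v y at every place of
          F, whereas distinct residues differ by more at some place.\<close>
        have "z = z'"
        proof (rule ccontr)
          assume "z \<noteq> z'"
          then obtain v where v: "v \<in> F" "v (z - z') > v y" using Z(3) mem by blast
          obtain p where vp: "nonarchimedean_place v p" using F(2) v(1) nonarchimedean_places_iff by blast
          then interpret nonarchimedean_place v p .
          have "v (e f' - e f) \<le> 1"
            by (rule Ok_nonarchimedean[OF vp]) (rule unital_subring_diff[OF subring_Ok eOk eOk])
          then have "v (z - z') \<le> v y" unfolding eq by (simp add: mult mult_left_le)
          then show False using v(2) by simp
        qed
        moreover from this have "e f = e f'" using eq y(2) by simp
        then have "f = f'" using inj_e mem by blast
        ultimately show "a = b" using zf by simp
      qed
      have finS: "finite S" unfolding S_def by (intro finite_PiE) auto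
      have "card S = H ^ \<kappa>" by (simp add: S_def card_PiE)
      then have card: "card (P ` (Z \<times> S)) = card Z * H ^ \<kappa>"
        using card_image[OF inj] by (simp add: card_cartesian_product)
      define T where "T w = R + w y * (C * real H)" for w
      have "real (card (P ` (Z \<times> S))) \<le> (\<Prod>w\<in>archimedean_places. (4 * T w + 2) ^ local_degree w)"
      proof (rule box_count)
        show "finite (P ` (Z \<times> S))" using Z(1) finS by simp
        show "P ` (Z \<times> S) \<subseteq> Ok"
          using Z(2) eOk y(1) unital_subring_add[OF subring_Ok] unital_subring_mult[OF subring_Ok]
          by (auto simp: P_def)
        show "0 \<le> T w" if "w \<in> archimedean_places" for w
          using that R0 C1 nn[of w y] by (simp add: T_def A_def)
        fix x and w :: "'k \<Rightarrow> real" assume x: "x \<in> P ` (Z \<times> S)" and "w \<in> archimedean_places"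
        then have w: "w \<in> A" by (simp add: A_def)
        interpret absolute_value w by (rule av[OF w])
        obtain z f where zf: "z \<in> Z" "f \<in> S" "x = z + y * e f" using x by (auto simp: P_def)
        have "w (e f) \<le> (\<Sum>j<\<kappa>. w (of_nat (f j)) * w \<theta> ^ j)"
          unfolding e_def using sum_le[of "\<lambda>j. of_nat (f j) * \<theta> ^ j" "{..<\<kappa>}"] by (simp add: mult power)
        also have "\<dots> \<le> (\<Sum>j<\<kappa>. real H * w \<theta> ^ j)"
        proof (intro sum_mono mult_right_mono)
          fix j assume "j \<in> {..<\<kappa>}"
          then have fj: "f j < H" using zf(2) by (auto simp: S_def)
          have "w (of_nat n) \<le> real n" for n
          proof (induction n)
            case (Suc n)
            then show ?case using triangle[of 1 "of_nat n"] by simp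
          qed simp
          then show "w (of_nat (f j)) \<le> real H" using fj by (meson less_imp_le of_nat_le_iff order.trans)
        qed simp
        also have "\<dots> = real H * (\<Sum>j<\<kappa>. w \<theta> ^ j)" by (simp add: sum_distrib_left)
        also have "\<dots> \<le> real H * C"
        proof (intro mult_left_mono)
          have "(\<Sum>j<\<kappa>. w \<theta> ^ j) \<le> (\<Sum>w\<in>A. \<Sum>j<\<kappa>. w \<theta> ^ j)"
            using w finA nn by (intro member_le_sum) (auto intro!: sum_nonneg)
          then show "(\<Sum>j<\<kappa>. w \<theta> ^ j) \<le> C" by (simp add: C_def)
        qed simp
        finally have "w y * w (e f) \<le> w y * (C * real H)"
            by (intro mult_left_mono) (simp_all add: mult.commute)
        then show "w x \<le> T w"
          using triangle[of z "y * e f"] R[OF w zf(1)] by (simp add: zf(3) mult T_def)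
      qed
      also have "\<dots> = (\<Prod>w\<in>A. (real H * ((4 * R + 2) / real H + 4 * C * w y)) ^ local_degree w)"
        unfolding A_def by (intro prod.cong refl) (use H in \<open>simp add: T_def field_simps\<close>)
      also have "\<dots> = real H ^ (\<Sum>w\<in>A. local_degree w) * (\<Prod>w\<in>A. ((4 * R + 2) / real H + 4 * C * w y) ^
          local_degree w)"
        by (simp add: power_mult_distrib prod.distrib power_sum)
      \<comment> \<open>The powers of H can be cancelled because the Archimedean local degrees add
        up to at most \<kappa>.\<close>
      also have "\<dots> \<le> real H ^ \<kappa> * (\<Prod>w\<in>A. ((4 * R + 2) / real H + 4 * C * w y) ^ local_degree w)"
        using sum_local_degree H R0 C1 nn
        by (intro mult_right_mono power_increasing prod_nonneg) (auto simp: A_def)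
      finally have "real H ^ \<kappa> * real (card Z) \<le> real H ^ \<kappa> * (\<Prod>w\<in>A. ((4 * R + 2) / real H + 4 * C * w
          y) ^ local_degree w)"
        by (simp add: card mult.commute)
      then show ?thesis using H by simp
    qed
    have "(\<lambda>H. (\<Prod>w\<in>A. ((4 * R + 2) / real H + 4 * C * w y) ^ local_degree w))
        \<longlonglongrightarrow> (\<Prod>w\<in>A. (0 + 4 * C * w y) ^ local_degree w)"
      by (intro tendsto_prod tendsto_power tendsto_add tendsto_const lim_const_over_n)
    then have "real (card Z) \<le> (\<Prod>w\<in>A. (0 + 4 * C * w y) ^ local_degree w)"
      by (rule LIMSEQ_le_const) (use count in \<open>auto intro!: exI[of _ 1]\<close>)
    also have "\<dots> = (\<Prod>w\<in>A. (4 * C) ^ local_degree w) * (\<Prod>w\<in>A. w y ^ local_degree w)"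
      by (simp add: power_mult_distrib prod.distrib)
    finally have "K * real (card Z) * (\<Prod>v\<in>F. v y ^ local_degree v)
      \<le> K * ((\<Prod>w\<in>A. (4 * C) ^ local_degree w) * (\<Prod>w\<in>A. w y ^ local_degree w)) * (\<Prod>v\<in>F. v y ^ local_degree v)"
    proof (intro mult_right_mono mult_left_mono prod_nonneg ballI zero_le_power)
      fix v assume "v \<in> F"
      then obtain p where "nonarchimedean_place v p" using F(2) nonarchimedean_places_iff by blast
      then interpret nonarchimedean_place v p .
      show "v y \<ge> 0" by simp
    qed (use K in simp_all)
    then show ?thesis using cZ by (simp add: K'_def mult.assoc)
  qed
  show ?thesis using K' main unfolding A_def by (intro exI[of _ K'] conjI ballI impI)
qed

theorem product_inequality:
  fixes F :: "('k \<Rightarrow> real) set"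
  assumes F: "finite F" "F \<subseteq> nonarchimedean_places" and y: "y \<in> Ok" "y \<noteq> 0"
  shows "1 \<le> (\<Prod>w\<in>archimedean_places. w y ^ local_degree w) * (\<Prod>v\<in>F. v y ^ local_degree v)"
proof -
  obtain K where K: "K > 0" "\<forall>y\<in>Ok. y \<noteq> 0 \<longrightarrow>
    1 \<le> K * (\<Prod>w\<in>archimedean_places. w y ^ local_degree w) * (\<Prod>v\<in>F. v y ^ local_degree v)"
    using product_inequality_constant[OF F] by (elim exE conjE)
  define Y where "Y = (\<Prod>w\<in>archimedean_places. w y ^ local_degree w) * (\<Prod>v\<in>F. v y ^ local_degree v)"
  have avF: "absolute_value v" if "v \<in> F" for v
    using absolute_value_nonarchimedean F(2) that by blast
  have Y0: "Y \<ge> 0"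
    unfolding Y_def using absolute_value.nonneg[OF avF] absolute_value.nonneg[OF absolute_value_archimedean]
    by (intro mult_nonneg_nonneg prod_nonneg ballI zero_le_power) auto
  have pow: "1 \<le> K * Y ^ N" for N
  proof -
    have "y ^ N \<in> Ok" "y ^ N \<noteq> 0" using y unital_subring_power[OF subring_Ok] by auto
    then have "1 \<le> K * (\<Prod>w\<in>archimedean_places. w (y ^ N) ^ local_degree w) * (\<Prod>v\<in>F. v (y ^ N) ^
        local_degree v)"
      by (rule K(2)[rule_format])
    also have "(\<Prod>w\<in>archimedean_places. w (y ^ N) ^ local_degree w) =
        (\<Prod>w\<in>archimedean_places. w y ^ local_degree w) ^ N"
      unfolding prod_power_distrib
      by (intro prod.cong refl) (simp add: absolute_value.power[OF absolute_value_archimedean]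
          power_mult[symmetric] mult.commute)
    also have "(\<Prod>v\<in>F. v (y ^ N) ^ local_degree v) = (\<Prod>v\<in>F. v y ^ local_degree v) ^ N"
      unfolding prod_power_distrib
      by (intro prod.cong refl) (simp add: absolute_value.power[OF avF] power_mult[symmetric] mult.commute)
    finally show ?thesis by (simp add: Y_def power_mult_distrib mult.assoc)
  qed
  have "1 \<le> Y"
  proof (rule ccontr)
    assume "\<not> 1 \<le> Y"
    then have "(\<lambda>N. Y ^ N) \<longlonglongrightarrow> 0" using Y0 by (intro LIMSEQ_power_zero) simp
    then have "(\<lambda>N. K * Y ^ N) \<longlonglongrightarrow> K * 0" by (intro tendsto_mult tendsto_const)
    then have "1 \<le> K * 0" by (rule LIMSEQ_le_const) (use pow in auto)
    then show False by simp
  qed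
  then show ?thesis by (simp add: Y_def)
qed

end

section \<open>Normalised estimates\<close>

text \<open>On [0,1] one has x \<le> x^t; apply this to a/(a+b) and b/(a+b). It lets normalised
  absolute values be taken inside the sums that occur in \<open>c1\<close>.\<close>

lemma powr_add_le:
  fixes a b t :: real
  assumes "a \<ge> 0" "b \<ge> 0" "0 < t" "t \<le> 1"
  shows "(a + b) powr t \<le> a powr t + b powr t"
proof (cases "a + b = 0")
  case True
  then show ?thesis using assms by (simp add: add_nonneg_eq_0_iff)
next
  case False
  define s where "s = a + b"
  have s: "s > 0" using False assms by (simp add: s_def)
  have le: "x \<le> x powr t" if "0 \<le> x" "x \<le> 1" for x :: real
  proof (cases "x = 0")
    case False
    then have "x powr 1 \<le> x powr t" using that assms by (intro powr_mono') auto
    then show ?thesis using that by simp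
  qed simp
  have "1 = a / s + b / s" using s by (simp add: s_def add_divide_distrib[symmetric])
  also have "\<dots> \<le> (a / s) powr t + (b / s) powr t"
    using assms s by (intro add_mono le) (auto simp: s_def)
  also have "\<dots> = (a powr t + b powr t) / s powr t"
    using assms s by (simp add: powr_divide add_divide_distrib)
  finally show ?thesis using s by (simp add: s_def field_simps)
qed

lemma inf_prod_greatest:
  assumes "\<And>F. finite F \<Longrightarrow> F \<subseteq> V \<Longrightarrow> c \<le> (\<Prod>v\<in>F. f v)"
  shows "c \<le> inf_prod V f"
  unfolding inf_prod_def by (rule cINF_greatest) (use assms in auto)

lemma inf_prod_nonneg: "(\<And>v. v \<in> V \<Longrightarrow> 0 \<le> f v) \<Longrightarrow> 0 \<le> inf_prod V f"
  by (rule inf_prod_greatest) (auto intro: prod_nonneg)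

lemma prod_antimono:
  fixes f :: "'a \<Rightarrow> real"
  assumes "finite G" "F \<subseteq> G" "\<And>v. v \<in> G \<Longrightarrow> 0 \<le> f v \<and> f v \<le> 1"
  shows "(\<Prod>v\<in>G. f v) \<le> (\<Prod>v\<in>F. f v)"
proof -
  have "(\<Prod>v\<in>G. f v) = (\<Prod>v\<in>G - F. f v) * (\<Prod>v\<in>F. f v)"
    using assms by (simp add: prod.subset_diff)
  also have "\<dots> \<le> 1 * (\<Prod>v\<in>F. f v)"
    using assms by (intro mult_right_mono prod_le_1 prod_nonneg) auto
  finally show ?thesis by simp
qed

text \<open>The finite inequality uses one set of places for both factors, while the conclusion has
  two separate infima. As all factors are at most 1, passing to the union of two finite sets
  separates them, and the infima are then taken one after the other.\<close>

lemma inf_prod_mult_bound: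
  fixes f g :: "'a \<Rightarrow> real"
  assumes A: "A > 0" and l: "l > 0"
    and f: "\<And>v. v \<in> V \<Longrightarrow> 0 \<le> f v \<and> f v \<le> 1" and g: "\<And>v. v \<in> V \<Longrightarrow> 0 \<le> g v \<and> g v \<le> 1"
    and bound: "\<And>F. finite F \<Longrightarrow> F \<subseteq> V \<Longrightarrow> 1 \<le> A * (\<Prod>v\<in>F. f v ^ l * g v)"
  shows "1 \<le> A * (inf_prod V f ^ l * inf_prod V g)"
proof -
  have two: "1 \<le> A * ((\<Prod>v\<in>F. f v) ^ l * (\<Prod>v\<in>G. g v))"
    if FG: "finite F" "F \<subseteq> V" "finite G" "G \<subseteq> V" for F G
  proof -
    have "1 \<le> A * ((\<Prod>v\<in>F \<union> G. f v) ^ l * (\<Prod>v\<in>F \<union> G. g v))"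
      using bound[of "F \<union> G"] FG by (simp add: prod.distrib prod_power_distrib)
    also have "\<dots> \<le> A * ((\<Prod>v\<in>F. f v) ^ l * (\<Prod>v\<in>G. g v))"
    proof (intro mult_left_mono mult_mono power_mono)
      show "(\<Prod>v\<in>F \<union> G. f v) \<le> (\<Prod>v\<in>F. f v)" using FG f by (intro prod_antimono) auto
      show "(\<Prod>v\<in>F \<union> G. g v) \<le> (\<Prod>v\<in>G. g v)" using FG g by (intro prod_antimono) auto
      show "0 \<le> (\<Prod>v\<in>F \<union> G. f v)" "0 \<le> (\<Prod>v\<in>F \<union> G. g v)" using FG f g by (auto intro!: prod_nonneg)
      show "0 \<le> (\<Prod>v\<in>F. f v) ^ l" using FG f by (auto intro!: prod_nonneg zero_le_power)
    qed (use A in simp)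
    finally show ?thesis .
  qed
  define J where "J = inf_prod V g"
  have J0: "J \<ge> 0" unfolding J_def using g by (intro inf_prod_nonneg) auto
  have one: "1 \<le> A * ((\<Prod>v\<in>F. f v) ^ l * J)" if F: "finite F" "F \<subseteq> V" for F
  proof -
    define b where "b = (\<Prod>v\<in>F. f v) ^ l"
    have b0: "b \<ge> 0" unfolding b_def using F f by (auto intro!: prod_nonneg zero_le_power)
    have "1 \<le> A * b" using two[OF F, of "{}"] by (simp add: b_def)
    then have "b \<noteq> 0" by auto
    then have b: "b > 0" using b0 by simp
    have "1 / (A * b) \<le> J"
      unfolding J_def
    proof (rule inf_prod_greatest)
      fix G assume "finite G" "G \<subseteq> V"
      then show "1 / (A * b) \<le> (\<Prod>v\<in>G. g v)"
        using two[OF F, of G] A b by (simp add: b_def[symmetric] field_simps)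
    qed
    then show ?thesis using A b by (simp add: b_def[symmetric] field_simps)
  qed
  have "J \<noteq> 0" using one[of "{}"] by auto
  then have J: "J > 0" using J0 by simp
  \<comment> \<open>The bound concerns l-th powers of finite products, so its l-th root bounds the
    products themselves and hence their infimum.\<close>
  have "root l (1 / (A * J)) \<le> inf_prod V f"
  proof (rule inf_prod_greatest)
    fix F assume F: "finite F" "F \<subseteq> V"
    have "1 / (A * J) \<le> (\<Prod>v\<in>F. f v) ^ l" using one[OF F] A J by (simp add: field_simps)
    then have "root l (1 / (A * J)) \<le> root l ((\<Prod>v\<in>F. f v) ^ l)" using l by (rule real_root_le_mono[rotated])
    also have "\<dots> = (\<Prod>v\<in>F. f v)" using l F f by (intro real_root_power_cancel prod_nonneg) auto
    finally show "root l (1 / (A * J)) \<le> (\<Prod>v\<in>F. f v)" .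
  qed
  then have "root l (1 / (A * J)) ^ l \<le> inf_prod V f ^ l"
    using A J by (intro power_mono real_root_ge_zero) auto
  then have "1 / (A * J) \<le> inf_prod V f ^ l" using l A J by (simp add: real_root_pow_pos2)
  then show ?thesis using A J by (simp add: J_def[symmetric] field_simps)
qed

lemma normalised_abs_nonneg: "normalised_abs v x \<ge> 0"
  by (simp add: normalised_abs_def)

lemma Max_image_powr_le:
  fixes f :: "'a \<Rightarrow> real"
  assumes "finite J" "J \<noteq> {}"
  shows "Max (f ` J) powr t \<le> Max ((\<lambda>j. f j powr t) ` J)"
proof -
  have "Max (f ` J) \<in> f ` J" using assms by (intro Max_in) auto
  then obtain j where "j \<in> J" "Max (f ` J) = f j" by blast
  then show ?thesis using assms by (simp add: Max_ge)
qed

lemma Max_insert_1_powr_le: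
  fixes f :: "'a \<Rightarrow> real"
  assumes "finite J"
  shows "Max (insert 1 (f ` J)) powr t \<le> Max (insert 1 ((\<lambda>j. f j powr t) ` J))"
proof -
  have "Max (insert 1 (f ` J)) \<in> insert 1 (f ` J)" using assms by (intro Max_in) auto
  then consider "Max (insert 1 (f ` J)) = 1" | j where "j \<in> J" "Max (insert 1 (f ` J)) = f j" by blast
  then show ?thesis
  proof cases
    case 1
    then show ?thesis using assms by (simp add: Max_ge)
  next
    case 2
    then show ?thesis using assms by (simp add: Max_ge)
  qed
qed

context integral_generator
begin

lemma normalised_product_inequality:
  fixes F :: "('k \<Rightarrow> real) set"
  assumes F: "finite F" "F \<subseteq> nonarchimedean_places" and y: "y \<in> Ok" "y \<noteq> 0"
  shows "1 \<le> (\<Prod>w\<in>archimedean_places. normalised_abs w y) * (\<Prod>v\<in>F. normalised_abs v y)"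
proof -
  have \<kappa>: "real \<kappa> > 0" using \<kappa>_pos by simp
  have avF: "absolute_value v" if "v \<in> F" for v
    using absolute_value_nonarchimedean F(2) that by blast
  have nrm: "(v y ^ local_degree v) powr (1 / real \<kappa>) = normalised_abs v y" if "absolute_value v" for v
    using absolute_value.pos[OF that y(2)]
    by (simp add: normalised_abs_def powr_powr degree flip: powr_realpow)
  have nn: "v y ^ local_degree v \<ge> 0" if "absolute_value v" for v
    using absolute_value.nonneg[OF that, of y] by simp
  have prods: "(\<Prod>v\<in>A. v y ^ local_degree v) powr (1 / real \<kappa>) = (\<Prod>v\<in>A. normalised_abs v y)"
    if "\<And>v. v \<in> A \<Longrightarrow> absolute_value v" for A
  proof -
    have "(\<Prod>v\<in>A. v y ^ local_degree v) powr (1 / real \<kappa>) = (\<Prod>v\<in>A. (v y ^ local_degree v) powr (1 / real \<kappa>))"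
      by (rule prod_powr_distrib)
    also have "\<dots> = (\<Prod>v\<in>A. normalised_abs v y)" using nrm that by (intro prod.cong) auto
    finally show ?thesis .
  qed
  define a where "a = (\<Prod>w\<in>archimedean_places. w y ^ local_degree w)"
  define b where "b = (\<Prod>v\<in>F. v y ^ local_degree v)"
  have "0 \<le> a" "0 \<le> b" unfolding a_def b_def
    using nn avF absolute_value_archimedean by (auto intro!: prod_nonneg)
  moreover have "1 \<le> a * b" unfolding a_def b_def by (rule product_inequality[OF F y])
  then have "1 \<le> (a * b) powr (1 / real \<kappa>)" by (rule ge_one_powr_ge_zero) simp
  ultimately have "1 \<le> a powr (1 / real \<kappa>) * b powr (1 / real \<kappa>)" by (simp add: powr_mult)
  then show ?thesis
    unfolding a_def b_def using prods[of archimedean_places] prods[of F] avF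
        absolute_value_archimedean by simp
qed

lemma archimedean_exponent:
  assumes "w \<in> archimedean_places"
  shows "0 < real (local_degree (w :: 'k \<Rightarrow> real)) / real \<kappa>" "real (local_degree w) / real \<kappa> \<le> 1"
  using local_degree_archimedean[OF assms] \<kappa>_pos by auto

end

section \<open>Local estimates for a linear form with integral data\<close>

locale euler_form_integral = integral_generator \<theta> \<kappa> a + euler_form m \<alpha> lam
  for \<theta> :: "'k::field_char_0" and \<kappa> a m and \<alpha> lam :: "nat \<Rightarrow> 'k" +
  assumes \<alpha>_Ok: "\<And>j. j \<in> {1..m} \<Longrightarrow> \<alpha> j \<in> Ok" and lam_Ok: "\<And>j. j \<in> {0..m} \<Longrightarrow> lam j \<in> Ok"
begin

definition M :: "('k \<Rightarrow> real) \<Rightarrow> real" where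
  "M u = Max (insert 1 ((\<lambda>j. normalised_abs u (\<alpha> j)) ` {1..m}))"

text \<open>The factor of \<open>c1\<close> at u; it bounds the growth in l of the normalised
  approximations apart from the factorial.\<close>

definition E :: "('k \<Rightarrow> real) \<Rightarrow> real" where
  "E u = M u ^ m * (\<Prod>i=1..m. normalised_abs u (\<alpha> i) + M u)"

lemma c1_eq: "c1 m \<alpha> = (\<Prod>u\<in>archimedean_places. E u)"
  by (simp add: c1_def E_def M_def)

lemma M_ge_1: "M u \<ge> 1"
  by (simp add: M_def)

lemma E_ge_1: "E u \<ge> 1"
proof -
  have "1 \<le> (\<Prod>i=1..m. normalised_abs u (\<alpha> i) + M u)"
    by (intro prod_ge_1 add_increasing normalised_abs_nonneg M_ge_1)
  then have "1 * 1 \<le> E u" unfolding E_def using M_ge_1[of u] by (intro mult_mono one_le_power) auto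
  then show ?thesis by simp
qed

lemma archimedean_normalised:
  assumes u: "u \<in> archimedean_places"
  obtains D where "D \<ge> 1" "\<And>l \<mu>. \<mu> < m \<Longrightarrow> normalised_abs u (W (m * l + \<mu>) (monom 1 \<mu> * P ^ l))
    \<le> D * fact (m * l + \<mu>) powr (real (local_degree u) / real \<kappa>) * E u ^ l"
proof -
  define t where "t = real (local_degree u) / real \<kappa>"
  have t: "0 < t" "t \<le> 1" using archimedean_exponent[OF u] by (simp_all add: t_def)
  have nrm: "normalised_abs u x = u x powr t" for x by (simp add: normalised_abs_def t_def degree)
  obtain \<sigma> where s: "u = (\<lambda>x. cmod (\<sigma> x))" "embedded_field \<sigma>" using archimedean_place_cases[OF u] by blast
  define M0 where "M0 = Max (insert 1 ((\<lambda>j. u (\<alpha> j)) ` {1..m}))"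
  have M0: "M0 \<ge> 1" "\<And>j. j \<in> {1..m} \<Longrightarrow> u (\<alpha> j) \<le> M0"
    unfolding M0_def by (auto intro!: Max_ge simp del: Max_insert)
  have M0t: "M0 powr t \<le> M u"
    unfolding M0_def M_def nrm by (rule Max_insert_1_powr_le) simp
  define C where "C = 1 + (\<Sum>j=0..m. u (lam j))"
  have C: "C \<ge> 1" unfolding C_def s(1) by (simp add: sum_nonneg)
  \<comment> \<open>C accounts for the coefficients of the linear form and M u ^ m for the shift,
    whose exponent \<mu> is below m.\<close>
  define D where "D = C powr t * M u ^ m"
  have "D \<ge> 1 * 1" unfolding D_def using C t M_ge_1[of u]
      by (intro mult_mono one_le_power ge_one_powr_ge_zero) auto
  then have D1: "D \<ge> 1" by simp
  have bound: "normalised_abs u (W (m * l + \<mu>) (monom 1 \<mu> * P ^ l)) \<le> D * fact (m * l + \<mu>) powr t * E u ^ l"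
    if mu: "\<mu> < m" for l \<mu>
  proof -
    define N where "N = m * l + \<mu>"
    have "u (W N (monom 1 \<mu> * P ^ l)) \<le> (\<Sum>j=0..m. u (lam j)) * fact N * M0 ^ \<mu> * (\<Prod>j=1..m. u (\<alpha> j) + M0) ^ l"
      using archimedean_bound[OF s(2) M0(1) _ refl N_def] M0(2) unfolding s(1) by blast
    also have "\<dots> \<le> C * fact N * M0 ^ \<mu> * (\<Prod>j=1..m. u (\<alpha> j) + M0) ^ l"
      using M0(1) unfolding C_def s(1) by (intro mult_right_mono zero_le_power prod_nonneg) auto
    finally have le: "u (W N (monom 1 \<mu> * P ^ l)) \<le> C * fact N * M0 ^ \<mu> * (\<Prod>j=1..m. u (\<alpha> j) + M0) ^ l" .
    have pos: "u (\<alpha> j) + M0 > 0" for j using M0(1) unfolding s(1) by (intro add_nonneg_pos) auto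
    have pr: "(\<Prod>j=1..m. u (\<alpha> j) + M0) > 0" using pos by (intro prod_pos) auto
    have "normalised_abs u (W N (monom 1 \<mu> * P ^ l))
        \<le> (C * fact N * M0 ^ \<mu> * (\<Prod>j=1..m. u (\<alpha> j) + M0) ^ l) powr t"
      unfolding nrm using le t by (intro powr_mono2) (auto simp: s(1))
    also have "\<dots> = C powr t * fact N powr t * (M0 powr t) ^ \<mu> * ((\<Prod>j=1..m. u (\<alpha> j) + M0) powr t) ^ l"
    proof -
      have p: "(x ^ n) powr t = (x powr t) ^ n" if "x > 0" for x :: real and n
        using that by (simp add: powr_powr mult.commute flip: powr_realpow)
      show ?thesis using C M0(1) pr by (simp add: powr_mult p less_imp_le)
    qed
    also have "(\<Prod>j=1..m. u (\<alpha> j) + M0) powr t = (\<Prod>j=1..m. (u (\<alpha> j) + M0) powr t)"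
      by (rule prod_powr_distrib)
    also have "C powr t * fact N powr t * (M0 powr t) ^ \<mu> * (\<Prod>j=1..m. (u (\<alpha> j) + M0) powr t) ^ l
      \<le> C powr t * fact N powr t * M u ^ m * E u ^ l"
    proof (intro mult_mono power_mono)
      have "(M0 powr t) ^ \<mu> \<le> M u ^ \<mu>" using M0t by (intro power_mono) auto
      also have "\<dots> \<le> M u ^ m" using mu M_ge_1 by (intro power_increasing) auto
      finally show "(M0 powr t) ^ \<mu> \<le> M u ^ m" .
      have "(\<Prod>j=1..m. (u (\<alpha> j) + M0) powr t) \<le> (\<Prod>j=1..m. normalised_abs u (\<alpha> j) + M u)"
      proof (intro prod_mono conjI)
        fix j
        have "(u (\<alpha> j) + M0) powr t \<le> u (\<alpha> j) powr t + M0 powr t"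
          using t M0(1) by (intro powr_add_le) (auto simp: s(1))
        then show "(u (\<alpha> j) + M0) powr t \<le> normalised_abs u (\<alpha> j) + M u" using M0t by (simp add: nrm)
      qed simp
      also have "\<dots> \<le> E u"
      proof -
        have "0 \<le> (\<Prod>j=1..m. normalised_abs u (\<alpha> j) + M u)"
          by (intro prod_nonneg ballI add_nonneg_nonneg normalised_abs_nonneg order.trans[OF
              zero_le_one M_ge_1])
        then have "1 * (\<Prod>j=1..m. normalised_abs u (\<alpha> j) + M u) \<le> E u"
          unfolding E_def by (intro mult_right_mono one_le_power M_ge_1)
        then show ?thesis by simp
      qed
      finally show "(\<Prod>j=1..m. (u (\<alpha> j) + M0) powr t) \<le> E u" .
    qed (use M_ge_1[of u] in \<open>auto intro!: prod_nonneg mult_nonneg_nonneg zero_le_power\<close>)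
    finally show ?thesis by (simp add: N_def D_def mult_ac)
  qed
  show ?thesis by (rule that[OF D1]) (use bound in \<open>simp add: t_def\<close>)
qed

text \<open>Over all Archimedean places the exponents of N! add up to at most 1, so the factorial
  enters only once.\<close>

lemma archimedean_product:
  "\<exists>D>0. \<forall>l. \<forall>\<mu><m. (\<Prod>w\<in>archimedean_places. normalised_abs w (W (m * l + \<mu>) (monom 1 \<mu> * P ^ l)))
    \<le> D * fact (m * l + m) * c1 m \<alpha> ^ l"
proof -
  have "\<forall>w\<in>archimedean_places. \<exists>D. D \<ge> 1 \<and> (\<forall>l. \<forall>\<mu><m. normalised_abs w (W (m * l + \<mu>) (monom 1 \<mu> * P ^ l))
    \<le> D * fact (m * l + \<mu>) powr (real (local_degree w) / real \<kappa>) * E w ^ l)"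
    using archimedean_normalised by metis
  from bchoice[OF this] obtain D where D: "\<forall>w\<in>archimedean_places. D w \<ge> 1 \<and>
    (\<forall>l. \<forall>\<mu><m. normalised_abs w (W (m * l + \<mu>) (monom 1 \<mu> * P ^ l))
    \<le> D w * fact (m * l + \<mu>) powr (real (local_degree w) / real \<kappa>) * E w ^ l)" ..
  have Dpos: "(\<Prod>w\<in>archimedean_places. D w) > 0" using D by (intro prod_pos) force
  moreover have "(\<Prod>w\<in>archimedean_places. normalised_abs w (W (m * l + \<mu>) (monom 1 \<mu> * P ^ l)))
    \<le> (\<Prod>w\<in>archimedean_places. D w) * fact (m * l + m) * c1 m \<alpha> ^ l" if mu: "\<mu> < m" for l \<mu>
  proof -
    define N where "N = m * l + \<mu>"
    have "(\<Prod>w\<in>archimedean_places. normalised_abs w (W N (monom 1 \<mu> * P ^ l)))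
      \<le> (\<Prod>w\<in>archimedean_places. D w * fact N powr (real (local_degree w) / real \<kappa>) * E w ^ l)"
      using D mu normalised_abs_nonneg unfolding N_def by (intro prod_mono) auto
    also have "\<dots> = (\<Prod>w\<in>archimedean_places. D w) *
        (\<Prod>w\<in>archimedean_places. fact N powr (real (local_degree (w :: 'k \<Rightarrow> real)) / real \<kappa>)) * c1 m \<alpha> ^ l"
      by (simp add: prod.distrib c1_eq prod_power_distrib)
    also have "\<dots> \<le> (\<Prod>w\<in>archimedean_places. D w) * fact (m * l + m) * c1 m \<alpha> ^ l"
    proof (intro mult_right_mono mult_left_mono)
      have "(\<Prod>w\<in>archimedean_places. fact N powr (real (local_degree (w :: 'k \<Rightarrow> real)) / real \<kappa>))
          = fact N powr (\<Sum>w\<in>archimedean_places. real (local_degree (w :: 'k \<Rightarrow> real)) / real \<kappa>)"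
        using finite_archimedean_places by (simp add: powr_sum)
      also have "\<dots> \<le> fact N powr 1"
      proof (rule powr_mono)
        have "(\<Sum>w\<in>archimedean_places. real (local_degree (w :: 'k \<Rightarrow> real))) \<le> real \<kappa>"
          using sum_local_degree by (metis of_nat_le_iff of_nat_sum)
        then show "(\<Sum>w\<in>archimedean_places. real (local_degree (w :: 'k \<Rightarrow> real)) / real \<kappa>) \<le> 1"
          using \<kappa>_pos by (simp add: sum_divide_distrib[symmetric])
      qed simp
      also have "\<dots> \<le> fact (m * l + m)" using mu by (simp add: N_def fact_mono)
      finally show "(\<Prod>w\<in>archimedean_places. fact N powr (real (local_degree (w :: 'k \<Rightarrow> real)) / real
          \<kappa>)) \<le> fact (m * l + m)" .
      show "0 \<le> c1 m \<alpha> ^ l" unfolding c1_eq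
        by (intro zero_le_power prod_nonneg) (use E_ge_1 in \<open>auto intro: order.trans[OF zero_le_one]\<close>)
    qed (use Dpos in simp)
    finally show ?thesis by (simp add: N_def)
  qed
  ultimately show ?thesis by blast
qed

text \<open>N! is replaced by (m l)!, which is at least as large at v, so that the bound no longer
  depends on the shift.\<close>

lemma nonarchimedean_normalised:
  assumes v: "nonarchimedean_place v p" and lim: "(\<lambda>i. v (w i)) \<longlonglongrightarrow> 0" and mu: "\<mu> < m"
  shows "normalised_abs v (W (m * l + \<mu>) (monom 1 \<mu> * P ^ l))
    \<le> Max ((\<lambda>j. normalised_abs v (\<alpha> j)) ` {1..m}) ^ l * normalised_abs v (fact (m * l) * fact l)"
proof -
  interpret nonarchimedean_place v p by fact
  define N where "N = m * l + \<mu>"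
  define S where "S = monom 1 \<mu> * P ^ l"
  define t where "t = real (local_degree v) / real \<kappa>"
  have t: "0 \<le> t" by (simp add: t_def)
  have nrm: "normalised_abs v x = v x powr t" for x by (simp add: normalised_abs_def t_def degree)
  define M0 where "M0 = Max ((\<lambda>j. v (\<alpha> j)) ` {1..m})"
  have a1: "v (\<alpha> j) \<le> 1" if "j \<in> {1..m}" for j by (rule Ok_nonarchimedean[OF v \<alpha>_Ok[OF that]])
  have M0: "v (\<alpha> j) \<le> M0" if "j \<in> {1..m}" for j using that by (simp add: M0_def)
  have "M0 \<in> (\<lambda>j. v (\<alpha> j)) ` {1..m}" unfolding M0_def using m by (intro Max_in) auto
  then have M0': "0 < M0" "M0 \<le> 1" using a1 \<alpha>_nz by auto
  note sub = unital_subring_unit_ball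
  have "coeff S i \<in> {x. v x \<le> 1}" for i
    unfolding S_def P_def
    by (intro unital_subring_coeff_mult[OF sub] unital_subring_coeff_power[OF sub]
        unital_subring_coeff_prod[OF sub])
       (auto simp: coeff_pCons a1 split: nat.split)
  then have coeff: "v (coeff S i) \<le> 1" for i by simp
  have "v (W N S) \<le> v (fact N) * v (fact l) * M0 ^ l"
  proof (rule nonarchimedean_bound[OF v _ _ coeff _ M0 M0' lim])
    show "[:- \<alpha> j, 1:] ^ l dvd S" if "j \<in> {1..m}" for j
      unfolding S_def P_def using that by (intro dvd_mult dvd_power_same dvd_prodI) auto
    show "degree S \<le> N"
      unfolding S_def N_def by (rule degree_monom_mult_P_power)
    show "v (lam j) \<le> 1" if "j \<in> {0..m}" for j by (rule Ok_nonarchimedean[OF v lam_Ok[OF that]])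
  qed
  also have "v (fact N) \<le> v (fact (m * l))" by (rule v_fact_antimono) (simp add: N_def)
  then have "v (fact N) * v (fact l) * M0 ^ l \<le> v (fact (m * l)) * v (fact l) * M0 ^ l"
    using M0' by (intro mult_right_mono) auto
  finally have "v (W N S) powr t \<le> (v (fact (m * l)) * v (fact l) * M0 ^ l) powr t"
    using t by (intro powr_mono2) auto
  also have "\<dots> = v (fact (m * l) * fact l) powr t * (M0 powr t) ^ l"
  proof -
    have "(M0 ^ l) powr t = (M0 powr t) ^ l"
      using M0' by (simp add: powr_powr mult.commute flip: powr_realpow)
    then show ?thesis using M0' by (simp add: mult powr_mult)
  qed
  also have "\<dots> \<le> v (fact (m * l) * fact l) powr t * Max ((\<lambda>j. normalised_abs v (\<alpha> j)) ` {1..m}) ^ l"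
    using Max_image_powr_le[of "{1..m}" "\<lambda>j. v (\<alpha> j)" t] m unfolding M0_def nrm
    by (intro mult_left_mono power_mono) auto
  finally show ?thesis by (simp add: nrm N_def S_def mult.commute)
qed

lemma approximation_Ok: "W (m * l + \<mu>) (monom 1 \<mu> * P ^ l) \<in> Ok"
proof (rule W_in_subring[OF subring_Ok])
  show "degree (monom 1 \<mu> * P ^ l) \<le> m * l + \<mu>"
    by (rule degree_monom_mult_P_power)
  show "coeff (monom 1 \<mu> * P ^ l) i \<in> Ok" for i
    unfolding P_def
    by (intro unital_subring_coeff_mult[OF subring_Ok] unital_subring_coeff_power[OF subring_Ok]
        unital_subring_coeff_prod[OF subring_Ok])
       (auto simp: coeff_pCons unital_subring_0[OF subring_Ok] unital_subring_1[OF subring_Ok]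
          intro!: unital_subring_minus[OF subring_Ok] \<alpha>_Ok split: nat.split)
qed (use \<alpha>_Ok lam_Ok in auto)

text \<open>Levels at which \<phi> does not vanish occur beyond every l0, and D does not depend on
  the level, so the bracketed quantity is at least 1 / D infinitely often.\<close>

theorem vanishing_bound:
  assumes V: "V \<subseteq> nonarchimedean_places" and lim: "\<And>v. v \<in> V \<Longrightarrow> (\<lambda>i. v (w i)) \<longlonglongrightarrow> 0"
  shows "\<exists>D>0. \<forall>l0. \<exists>l\<ge>l0. 1 \<le> D * (c2 m \<alpha> V ^ l * fact (m * l + m) *
    inf_prod V (\<lambda>v. normalised_abs v (fact (m * l) * fact l)))"
proof -
  obtain D where D: "D > 0" "\<And>l \<mu>. \<mu> < m \<Longrightarrow>
    (\<Prod>w\<in>archimedean_places. normalised_abs w (W (m * l + \<mu>) (monom 1 \<mu> * P ^ l)))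
        \<le> D * fact (m * l + m) * c1 m \<alpha> ^ l"
    using archimedean_product by auto
  have "\<exists>l\<ge>l0. 1 \<le> D * (c2 m \<alpha> V ^ l * fact (m * l + m) *
    inf_prod V (\<lambda>v. normalised_abs v (fact (m * l) * fact l)))" for l0
  proof -
    \<comment> \<open>Asking for l \<ge> \<open>Suc l0\<close> also makes l positive, as the l-th
      root in \<open>inf_prod_mult_bound\<close> requires.\<close>
    obtain l \<mu> where l: "l \<ge> Suc l0" "\<mu> < m" "\<phi> (monom 1 \<mu> * P ^ l) \<noteq> 0" using nonvanishing by blast
    define y where "y = W (m * l + \<mu>) (monom 1 \<mu> * P ^ l)"
    have y: "y \<in> Ok" "y \<noteq> 0" using approximation_Ok l(3) by (simp_all add: y_def W_def)
    define f where "f v = Max ((\<lambda>j. normalised_abs v (\<alpha> j)) ` {1..m})" for v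
    define g where "g v = normalised_abs v (fact (m * l) * fact l)" for v :: "'k \<Rightarrow> real"
    have place: "\<exists>p. nonarchimedean_place v p" if "v \<in> V" for v
      using V that nonarchimedean_places_iff by blast
    have le1: "normalised_abs v x \<le> 1" if "v \<in> V" "x \<in> Ok" for v x
    proof -
      obtain p where "nonarchimedean_place v p" using place \<open>v \<in> V\<close> by blast
      then interpret nonarchimedean_place v p .
      have "v x \<le> 1" by (rule Ok_nonarchimedean[OF nonarchimedean_place_axioms \<open>x \<in> Ok\<close>])
      then show ?thesis by (simp add: normalised_abs_def powr_le1)
    qed
    have f01: "0 \<le> f v \<and> f v \<le> 1" if v: "v \<in> V" for v
    proof -
      have "f v \<in> (\<lambda>j. normalised_abs v (\<alpha> j)) ` {1..m}" unfolding f_def using m by (intro Max_in) auto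
      then show ?thesis using le1[OF v] \<alpha>_Ok normalised_abs_nonneg by auto
    qed
    have g01: "0 \<le> g v \<and> g v \<le> 1" if v: "v \<in> V" for v
    proof -
      have "fact (m * l) * fact l \<in> Ok"
        using of_int_Ok[of "fact (m * l) * fact l"] by simp
      then show ?thesis using le1[OF v] normalised_abs_nonneg by (simp add: g_def)
    qed
    define A where "A = D * fact (m * l + m) * c1 m \<alpha> ^ l"
    have "c1 m \<alpha> > 0" unfolding c1_eq by (intro prod_pos) (use E_ge_1 in \<open>auto intro: less_le_trans[OF
        zero_less_one]\<close>)
    then have A: "A > 0" using D(1) by (simp add: A_def)
    have "1 \<le> A * (inf_prod V f ^ l * inf_prod V g)"
    proof (rule inf_prod_mult_bound[OF A _ f01 g01])
      show "l > 0" using l(1) by simp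
      fix F assume F: "finite F" "F \<subseteq> V"
      have "1 \<le> (\<Prod>w\<in>archimedean_places. normalised_abs w y) * (\<Prod>v\<in>F. normalised_abs v y)"
        using F V y by (intro normalised_product_inequality) auto
      also have "\<dots> \<le> A * (\<Prod>v\<in>F. f v ^ l * g v)"
      proof (intro mult_mono prod_mono conjI)
        show "(\<Prod>w\<in>archimedean_places. normalised_abs w y) \<le> A" unfolding y_def A_def by (rule D(2)[OF l(2)])
        fix v assume "v \<in> F"
        then have v: "v \<in> V" using F by blast
        obtain p where "nonarchimedean_place v p" using place[OF v] by blast
        then show "normalised_abs v y \<le> f v ^ l * g v"
          unfolding y_def f_def g_def by (rule nonarchimedean_normalised[OF _ lim[OF v] l(2)])
      qed (use A in \<open>auto intro!: prod_nonneg normalised_abs_nonneg\<close>)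
      finally show "1 \<le> A * (\<Prod>v\<in>F. f v ^ l * g v)" .
    qed
    also have "\<dots> = D * (c2 m \<alpha> V ^ l * fact (m * l + m) * inf_prod V g)"
      by (simp add: A_def c2_def f_def[abs_def] power_mult_distrib mult_ac)
    finally show ?thesis unfolding g_def[abs_def] using l(1) by (intro exI[of _ l]) auto
  qed
  then show ?thesis using D(1) by blast
qed

end

theorem theorem1:
  fixes m :: nat
    and \<alpha> lam :: "nat \<Rightarrow> 'k::field_char_0"
    and V :: "('k \<Rightarrow> real) set"
  assumes "number_field TYPE('k)"
    and "m \<ge> 1"
    and "\<And>j. j \<in> {1..m} \<Longrightarrow> algebraic_int (\<alpha> j) \<and> \<alpha> j \<noteq> 0"
    and "inj_on \<alpha> {1..m}"
    and "\<And>j. j \<in> {0..m} \<Longrightarrow> algebraic_int (lam j)"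
    and "\<exists>j\<in>{0..m}. lam j \<noteq> 0"
    and "V \<subseteq> nonarchimedean_places"
    and "limsup (\<lambda>l. ereal (c2 m \<alpha> V ^ l * real (m * l + m) ^ field_degree TYPE('k)
            * fact (m * l + m)
            * inf_prod V (\<lambda>v. normalised_abs v (fact (m * l) * fact l)))) = 0"
  shows "\<exists>v\<in>V. to_completion v (lam 0) \<oplus>\<^bsub>field_completion v\<^esub>
            (\<Oplus>\<^bsub>field_completion v\<^esub>j\<in>{1..m}. to_completion v (lam j) \<otimes>\<^bsub>field_completion v\<^esub> euler_series v (\<alpha> j))
          \<noteq> \<zero>\<^bsub>field_completion v\<^esub>"
proof (rule ccontr)
  assume neg: "\<not> ?thesis"
  obtain \<theta> :: 'k and a where gen: "integral_generator \<theta> (field_degree TYPE('k)) a"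
    by (rule integral_generator_exists[OF assms(1)])
  interpret integral_generator \<theta> "field_degree TYPE('k)" a by (rule gen)
  interpret euler_form_integral \<theta> "field_degree TYPE('k)" a m \<alpha> lam
  proof
    show "1 \<le> m" "inj_on \<alpha> {1..m}" "\<exists>j\<in>{0..m}. lam j \<noteq> 0" by (fact assms)+
    show "\<alpha> j \<noteq> 0" "\<alpha> j \<in> Ok" if "j \<in> {1..m}" for j
      using assms(3)[OF that] algebraic_int_Ok by simp_all
    show "lam j \<in> Ok" if "j \<in> {0..m}" for j
      using assms(5)[OF that] algebraic_int_Ok by simp
  qed
  have lim: "(\<lambda>i. v (w i)) \<longlonglongrightarrow> 0" if v: "v \<in> V" for v
  proof -
    have "\<exists>p. nonarchimedean_place v p" using assms(7) v nonarchimedean_places_iff by blast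
    then obtain p where vp: "nonarchimedean_place v p" ..
    then interpret nonarchimedean_place v p .
    have "v (\<alpha> j) \<le> 1" if "j \<in> {1..m}" for j by (rule Ok_nonarchimedean[OF vp \<alpha>_Ok[OF that]])
    moreover have "to_completion v (lam 0) \<oplus>\<^bsub>field_completion v\<^esub>
        (\<Oplus>\<^bsub>field_completion v\<^esub>j\<in>{1..m}. to_completion v (lam j) \<otimes>\<^bsub>field_completion v\<^esub> euler_series v (\<alpha> j))
        = \<zero>\<^bsub>field_completion v\<^esub>" using neg v by blast
    ultimately show ?thesis unfolding w_def[abs_def] by (rule euler_linear_form)
  qed
  obtain D where D: "D > 0" "\<And>l0. \<exists>l\<ge>l0. 1 \<le> D * (c2 m \<alpha> V ^ l * fact (m * l + m) *
    inf_prod V (\<lambda>v. normalised_abs v (fact (m * l) * fact l)))"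
    using vanishing_bound[OF assms(7) lim] by auto
  define u where "u l = c2 m \<alpha> V ^ l * fact (m * l + m) *
    inf_prod V (\<lambda>v. normalised_abs v (fact (m * l) * fact l))" for l
  define U where "U l = c2 m \<alpha> V ^ l * real (m * l + m) ^ field_degree TYPE('k) * fact (m * l + m) *
    inf_prod V (\<lambda>v. normalised_abs v (fact (m * l) * fact l))" for l
  have "limsup (\<lambda>l. ereal (U l)) < ereal (1 / D)" using assms(8) D(1) by (simp add: U_def)
  then have "\<forall>\<^sub>F l in sequentially. ereal (U l) < ereal (1 / D)" by (rule Limsup_lessD)
  then obtain l0 where l0: "\<And>l. l \<ge> l0 \<Longrightarrow> U l < 1 / D" by (auto simp: eventually_sequentially)
  obtain l where l: "l \<ge> l0" "1 \<le> D * u l" using D(2)[of l0] unfolding u_def by blast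
  have "0 < D * u l" using l(2) by linarith
  then have u0: "u l > 0" using D(1) by (simp add: zero_less_mult_iff)
  \<comment> \<open>The power of m l + m is at least 1 and \<open>u l\<close> is positive, so
    \<open>u l\<close> is at most \<open>U l\<close>, which is below 1 / D.\<close>
  have "1 \<le> m * l + m" using assms(2) by simp
  then have "real 1 \<le> real (m * l + m)" by (simp only: of_nat_le_iff)
  then have "1 \<le> real (m * l + m)" by simp
  then have "1 \<le> real (m * l + m) ^ field_degree TYPE('k)" by (rule one_le_power)
  then have "u l * 1 \<le> u l * real (m * l + m) ^ field_degree TYPE('k)" using u0 by (intro mult_left_mono) auto
  also have "\<dots> = U l" by (simp add: u_def U_def mult_ac)
  finally have "u l < 1 / D" using l0[OF l(1)] by simp
  then show False using l(2) D(1) by (simp add: field_simps)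
qed

end
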